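(* Let $g$ be a non-negative integer, fix positive integers $n,s>0$ and a tuple of positive integers $\underline{r}=(r_1,\dots,r_s)$ with $\sum_{i=1}^s(r_i-1)=2g-2+n$. Then the map $$h_g^{-,\underline{r}}\colon \mathcal{H}_{n,s}\to\mathbb{Q},\qquad(\mathbf{x},\underline{k})\mapsto h^{\underline{k},\underline{r}}_{g;\mathbf{x}^+,\mathbf{x}^-}$$ is piecewise polynomial with respect to the leaky resonance arrangement: for each chamber $\mathfrak{c}$ there is a polynomial $P_{\mathfrak{c}}$ in $(\mathbf{x},\underline{k})$ which agrees with $h_g^{-,\underline{r}}$ at all integer points of $\mathfrak{c}$. Restricted to each chamber, it is a polynomial of degree $1+\sum_{i=1}^sr_i-n$.
   Context: **Fock space.** Let $\Lambda=\mathbb{C}[p_1,p_2,\dots]$; for $j>0$ let $J_j=j\,\partial/\partial p_j$ and let $J_{-j}$ be multiplication by $p_j$. For an operator $A$ on $\Lambda$, $\langle A\rangle$ is the constant term of $A\cdot 1$. Let $\varsigma(u)=e^{u/2}-e^{-u/2}$. For $n\in\mathbb{Z}$, $$\mathcal{E}_n(u)=\frac{1}{\varsigma(u)}\sum_{N\ge 0}\frac{1}{N!}\sum_{\substack{j_1,\dots,j_N\in\mathbb{Z}\setminus\{0\}\\ j_1+\dots+j_N=n}}\ \prod_{i=1}^N\frac{\varsigma(j_iu)}{j_i}\ {:}J_{j_1}\cdots J_{j_N}{:}$$ where ${:}\ {:}$ moves all $J_j$ with $j<0$ to the left (the $N=0$ term is $\delta_{n,0}/\varsigma(u)$). For $r\ge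 0$, $\mathcal{F}_r^k$ is $r!$ times the coefficient of $u^r$ in $\mathcal{E}_{-k}(u)$. For operators $A_1,\dots,A_N$, the connected expectation is $\langle A_1\cdots A_N\rangle^\circ=\sum_{\pi}(-1)^{|\pi|-1}(|\pi|-1)!\prod_{B\in\pi}\langle\prod_{i\in B}A_i\rangle$, summed over set partitions $\pi$ of $\{1,\dots,N\}$, with the factors in each block in increasing order of index. **Completed cycles leaky Hurwitz numbers.** For tuples of positive integers $\mu,\nu$, integers $k_1,\dots,k_s$ and positive integers $r_1,\dots,r_s$ with $\sum(r_i-1)=2g-2+\ell(\mu)+\ell(\nu)$ and $\sum\mu_i=\sum\nu_j+\sum k_l$, $$h^{\underline{k},\underline{r}}_{g;\mu,\nu}=\frac{1}{\prod_i\mu_i\prod_j\nu_j}\Big\langle\prod_i J_{\mu_i}\prod_{i=1}^s\frac{\mathcal{F}^{k_i}_{r_i}}{r_i}\prod_jJ_{-\nu_j}\Big\rangle^\circ,$$ where each $J_{\mu_i}$, each $\mathcal F^{k_i}_{r_i}/r_i$ and each $J_{-\nu_j}$ is one of the factors. **Arrangement.** $\mathcal{H}_{n,s}=\{(\mathbf{x},\underline{k})\in\mathbb{Z}^n\times\mathbb{Z}^s\mid\sum_{i=1}^nx_i=\sum_{i=1}^sk_i\}$. For $I\subset[n]$, $J\subset[s]$ with $(I,J)\ne(\emptyset,\emptyset),([n],[s])$, let $W_{IJ}=\{\sum_{i\in I}x_i=\sum_{j\in J}k_j\}$ inside the real hyperplane $\sum x_i=\sum k_i$ in $\mathbb{R}^n\times\mathbb{R}^s$.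 The collection $(W_{IJ})_{I,J}$ is the leaky resonance arrangement, and the connected components of its complement are the chambers (so all $x_i\neq0$ on chambers). $\mathbf{x}^+$ is the tuple of positive entries of $\mathbf{x}$, and $\mathbf{x}^-$ the tuple of absolute values of its negative entries.
   Formalization: The degree claim is proved on every chamber where the map does not vanish identically; it does vanish on some chambers (for example n=1, s=2, with k_2<0<x_1), and there the polynomial is zero rather than of degree 1+sum r_i-n. *)

theory Defs
  imports
    "HOL-Analysis.Analysis"
    "HOL-Library.Poly_Mapping"
    "HOL-Library.Groups_Big_Fun"
    "HOL-Library.Disjoint_Sets"
    "HOL-Computational_Algebra.Formal_Laurent_Series"
begin

section \<open>Multivariate polynomials\<close>

text \<open>A polynomial with coefficients in \<open>'a\<close> and variables indexed by \<open>'v\<close> maps exponent vectors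
  to coefficients; the ring structure is that of \<^theory>\<open>HOL-Library.Poly_Mapping\<close>.\<close>

type_synonym ('v, 'a) mpoly = "('v \<Rightarrow>\<^sub>0 nat) \<Rightarrow>\<^sub>0 'a"

definition mvar :: "'v \<Rightarrow> ('v, 'a::comm_ring_1) mpoly" where
  "mvar v = Poly_Mapping.single (Poly_Mapping.single v 1) 1"

definition mconst :: "'a::comm_ring_1 \<Rightarrow> ('v, 'a) mpoly" where
  "mconst c = Poly_Mapping.single 0 c"

definition mpartial :: "'v \<Rightarrow> ('v, 'a::comm_ring_1) mpoly \<Rightarrow> ('v, 'a) mpoly" where
  "mpartial v f = (\<Sum>m \<in> Poly_Mapping.keys f.
     Poly_Mapping.single (m - Poly_Mapping.single v 1)
       (of_nat (Poly_Mapping.lookup m v) * Poly_Mapping.lookup f m))"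

definition meval :: "('v \<Rightarrow> 'a::comm_ring_1) \<Rightarrow> ('v, 'a) mpoly \<Rightarrow> 'a" where
  "meval a f = (\<Sum>m \<in> Poly_Mapping.keys f.
     Poly_Mapping.lookup f m * (\<Prod>v \<in> Poly_Mapping.keys m. a v ^ Poly_Mapping.lookup m v))"

definition monom_degree :: "('v \<Rightarrow>\<^sub>0 nat) \<Rightarrow> nat" where
  "monom_degree m = (\<Sum>v \<in> Poly_Mapping.keys m. Poly_Mapping.lookup m v)"

text \<open>The total degree of the zero polynomial is set to 0.\<close>

definition total_degree :: "('v, 'a::comm_ring_1) mpoly \<Rightarrow> nat" where
  "total_degree f = Max (insert 0 (monom_degree ` Poly_Mapping.keys f))"


section \<open>Operators on Fock space\<close>

text \<open>The variable with index \<open>j\<close> is $p_j$. The index 0 is never used: the operators below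
  preserve the polynomials in $p_1, p_2, \ldots$, and only their action on 1 enters the
  expectations.\<close>

type_synonym fock = "(nat, complex) mpoly"

type_synonym fock_op = "fock \<Rightarrow> fock"

text \<open>This gives \<open>Jop 0 = 0\<close>, but \<open>Jop 0\<close> is excluded everywhere below.\<close>

definition Jop :: "int \<Rightarrow> fock_op" where
  "Jop j f = (if j < 0 then mvar (nat (- j)) * f else of_int j * mpartial (nat j) f)"

definition op_scale :: "complex \<Rightarrow> fock_op \<Rightarrow> fock_op" where
  "op_scale c A f = mconst c * A f"

definition op_prod :: "fock_op list \<Rightarrow> fock_op" where
  "op_prod As = foldr (\<circ>) As id"

definition vev :: "fock_op \<Rightarrow> complex" where
  "vev A = Poly_Mapping.lookup (A 1) 0"

definition normal_ordered :: "int list \<Rightarrow> fock_op" where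
  "normal_ordered js =
     op_prod (map Jop (filter (\<lambda>j. j < 0) js @ filter (\<lambda>j. \<not> j < 0) js))"

text \<open>\<open>varsigma j\<close> is the power series $\varsigma(ju)$ in $u$.\<close>

definition varsigma :: "int \<Rightarrow> complex fps" where
  "varsigma j = fps_exp (of_int j / 2) - fps_exp (- of_int j / 2)"

text \<open>The scalar factor, a Laurent series in $u$, of the summand of $\mathcal{E}_n(u)$ indexed by
  $N$ and $(j_1, \ldots, j_N)$, where $N$ is the length of the list.\<close>

definition E_weight :: "int list \<Rightarrow> complex fls" where
  "E_weight js =
     fps_to_fls (fps_const (1 / fact (length js))
                 * (\<Prod>j\<leftarrow>js. fps_const (1 / of_int j) * varsigma j))
     / fps_to_fls (varsigma 1)"

definition E_indices :: "int \<Rightarrow> int list set" where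
  "E_indices n = {js. 0 \<notin> set js \<and> sum_list js = n}"

text \<open>\<open>E_coeff n m\<close> is the coefficient of $u^m$ in $\mathcal{E}_n(u)$. On a given element of Fock
  space all but finitely many of the normally ordered products with $j_1 + \cdots + j_N = n$
  vanish (lemma \<open>finite_E_support\<close> below), so that the sum over all $N$ and all tuples is finite.\<close>

definition E_coeff :: "int \<Rightarrow> int \<Rightarrow> fock_op" where
  "E_coeff n m f =
     Sum_any (\<lambda>js. if js \<in> E_indices n
                   then mconst (fls_nth (E_weight js) m) * normal_ordered js f else 0)"

definition F_op :: "nat \<Rightarrow> int \<Rightarrow> fock_op" where
  "F_op r k = op_scale (fact r) (E_coeff (- k) (int r))"

text \<open>\<open>nths As B\<close> lists the factors with index in the block \<open>B\<close> in increasing order.\<close>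

definition connected_expectation :: "fock_op list \<Rightarrow> complex" where
  "connected_expectation As =
     (\<Sum>\<pi> | partition_on {..<length As} \<pi>.
        (- 1) ^ (card \<pi> - 1) * fact (card \<pi> - 1) * (\<Prod>B\<in>\<pi>. vev (op_prod (nths As B))))"


subsection \<open>Local finiteness of the operators\<close>

definition weight :: "(nat \<Rightarrow>\<^sub>0 nat) \<Rightarrow> nat" where
  "weight m = (\<Sum>v \<in> Poly_Mapping.keys m. v * Poly_Mapping.lookup m v)"

lemma weight_superset:
  assumes "finite S" "Poly_Mapping.keys m \<subseteq> S"
  shows "weight m = (\<Sum>v\<in>S. v * Poly_Mapping.lookup m v)"
  unfolding weight_def using assms
  by (intro sum.mono_neutral_left) (auto simp: in_keys_iff)

lemma weight_minus_single:
  assumes "Poly_Mapping.lookup m v \<noteq> 0"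
  shows "weight (m - Poly_Mapping.single v 1) + v = weight m"
proof -
  let ?S = "Poly_Mapping.keys m" and ?m = "m - Poly_Mapping.single v 1"
  have v: "v \<in> ?S" using assms by (simp add: in_keys_iff)
  have sub: "Poly_Mapping.keys ?m \<subseteq> ?S"
    by (auto simp: in_keys_iff lookup_minus)
  have "weight ?m = (\<Sum>w\<in>?S. w * Poly_Mapping.lookup ?m w)"
    by (rule weight_superset) (use sub in auto)
  also have "\<dots> = v * (Poly_Mapping.lookup m v - 1)
      + (\<Sum>w\<in>?S - {v}. w * Poly_Mapping.lookup m w)"
  proof -
    have "(\<Sum>w\<in>?S - {v}. w * Poly_Mapping.lookup ?m w)
        = (\<Sum>w\<in>?S - {v}. w * Poly_Mapping.lookup m w)"
      by (rule sum.cong) (simp_all add: lookup_minus lookup_single)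
    moreover have "Poly_Mapping.lookup ?m v = Poly_Mapping.lookup m v - 1"
      by (simp add: lookup_minus lookup_single)
    ultimately show ?thesis
      using sum.remove[OF finite_keys v, of "\<lambda>w. w * Poly_Mapping.lookup ?m w"] by simp
  qed
  finally have 1: "weight ?m = v * (Poly_Mapping.lookup m v - 1)
      + (\<Sum>w\<in>?S - {v}. w * Poly_Mapping.lookup m w)" .
  have 2: "weight m = v * Poly_Mapping.lookup m v
      + (\<Sum>w\<in>?S - {v}. w * Poly_Mapping.lookup m w)"
    unfolding weight_def by (rule sum.remove[OF finite_keys v])
  obtain l where "Poly_Mapping.lookup m v = Suc l"
    using assms by (cases "Poly_Mapping.lookup m v") auto
  with 1 2 show ?thesis by (simp del: One_nat_def)
qed

lemma keys_mpartial_weight: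
  assumes "m' \<in> Poly_Mapping.keys (mpartial v f)"
  shows "\<exists>m \<in> Poly_Mapping.keys f. weight m' + v = weight m"
proof -
  from assms have "m' \<in> (\<Union>m \<in> Poly_Mapping.keys f. Poly_Mapping.keys
     (Poly_Mapping.single (m - Poly_Mapping.single v 1)
       (of_nat (Poly_Mapping.lookup m v) * Poly_Mapping.lookup f m)))"
    unfolding mpartial_def by (rule subsetD[OF keys_sum])
  then obtain m where m: "m \<in> Poly_Mapping.keys f"
    "m' \<in> Poly_Mapping.keys (Poly_Mapping.single (m - Poly_Mapping.single v 1)
       (of_nat (Poly_Mapping.lookup m v) * Poly_Mapping.lookup f m))"
    by (elim UN_E)
  from m(2) have "m' = m - Poly_Mapping.single v 1" "Poly_Mapping.lookup m v \<noteq> 0"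
    by (metis keys_single empty_iff singletonD, metis keys_single empty_iff mult_zero_left of_nat_0)
  with m(1) show ?thesis using weight_minus_single[of m v] by metis
qed

lemma keys_J_weight:
  assumes "j > 0" "m' \<in> Poly_Mapping.keys (Jop j f)"
  shows "\<exists>m \<in> Poly_Mapping.keys f. int (weight m') + j = int (weight m)"
proof -
  have "Jop j f = Poly_Mapping.single 0 (of_int j) * mpartial (nat j) f"
    using assms(1) by (simp add: Jop_def)
  then obtain a b where ab: "m' = a + b" "a \<in> Poly_Mapping.keys (Poly_Mapping.single 0 (of_int j :: complex))"
    "b \<in> Poly_Mapping.keys (mpartial (nat j) f)"
    using assms(2) keys_mult[of "Poly_Mapping.single 0 (of_int j)" "mpartial (nat j) f"]
    by (simp only:) blast
  have "a = 0"
    using ab(2) by (metis keys_single empty_iff singletonD)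
  with ab have "m' \<in> Poly_Mapping.keys (mpartial (nat j) f)" by simp
  from keys_mpartial_weight[OF this] obtain m where
    m: "m \<in> Poly_Mapping.keys f" "weight m' + nat j = weight m" by blast
  then have "int (weight m') + j = int (weight m)"
    using assms(1) by linarith
  with m show ?thesis by blast
qed

lemma keys_prod_J_weight:
  assumes "\<forall>j\<in>set js. j > 0" "m' \<in> Poly_Mapping.keys (op_prod (map Jop js) f)"
  shows "\<exists>m \<in> Poly_Mapping.keys f. int (weight m') + sum_list js = int (weight m)"
  using assms
proof (induction js arbitrary: m')
  case Nil
  then show ?case by (auto simp: op_prod_def)
next
  case (Cons j js)
  have "m' \<in> Poly_Mapping.keys (Jop j (op_prod (map Jop js) f))"
    using Cons.prems(2) by (simp add: op_prod_def)
  then obtain m1 where m1: "m1 \<in> Poly_Mapping.keys (op_prod (map Jop js) f)"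
    "int (weight m') + j = int (weight m1)"
    using keys_J_weight[of j m'] Cons.prems(1) by auto
  obtain m where m: "m \<in> Poly_Mapping.keys f" "int (weight m1) + sum_list js = int (weight m)"
    using Cons.IH[OF _ m1(1)] Cons.prems(1) by auto
  have "int (weight m') + sum_list (j # js) = int (weight m)"
    using m(2) m1(2) by simp
  with m(1) show ?case by blast
qed

lemma op_prod_append: "op_prod (As @ Bs) = op_prod As \<circ> op_prod Bs"
  by (induction As) (auto simp: op_prod_def)

lemma J_prod_zero: "op_prod (map Jop js) 0 = 0"
  by (induction js) (auto simp: op_prod_def Jop_def mpartial_def)

lemma sum_list_filter_split:
  "sum_list (filter (\<lambda>j. j < 0) js) + sum_list (filter (\<lambda>j. \<not> j < 0) js) = sum_list (js :: int list)"
  by (induction js) auto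

lemma sum_list_abs_split:
  "sum_list (map abs js)
     = sum_list (filter (\<lambda>j. \<not> j < 0) js) - sum_list (filter (\<lambda>j. j < 0) (js :: int list))"
  by (induction js) auto

lemma finite_int_lists_abs_sum:
  "finite {js :: int list. 0 \<notin> set js \<and> sum_list (map abs js) \<le> B}"
proof -
  have bounds: "int (length js) \<le> sum_list (map abs js) \<and> (\<forall>j\<in>set js. \<bar>j\<bar> \<le> sum_list (map abs js))"
    if "0 \<notin> set js" for js :: "int list"
    using that
  proof (induction js)
    case (Cons j js)
    then have "0 \<le> sum_list (map abs js)"
      by (intro sum_list_nonneg) auto
    moreover have "\<bar>j\<bar> \<ge> 1" using Cons.prems by auto
    moreover have "int (length js) \<le> sum_list (map abs js)"
      "\<forall>i\<in>set js. \<bar>i\<bar> \<le> sum_list (map abs js)"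
      using Cons.IH Cons.prems by auto
    ultimately show ?case by fastforce
  qed simp
  have "{js :: int list. 0 \<notin> set js \<and> sum_list (map abs js) \<le> B}
          \<subseteq> {js. set js \<subseteq> {-B..B} \<and> length js \<le> nat B}"
  proof
    fix js :: "int list"
    assume "js \<in> {js. 0 \<notin> set js \<and> sum_list (map abs js) \<le> B}"
    then have *: "0 \<notin> set js" "sum_list (map abs js) \<le> B" by auto
    have "j \<in> {-B..B}" if "j \<in> set js" for j
    proof -
      have "\<bar>j\<bar> \<le> B" using bounds[OF *(1)] *(2) that by (meson order_trans)
      then show ?thesis by auto
    qed
    moreover have "length js \<le> nat B"
      using bounds[OF *(1)] *(2) by linarith
    ultimately show "js \<in> {js. set js \<subseteq> {-B..B} \<and> length js \<le> nat B}" by blast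
  qed
  then show ?thesis
    by (rule finite_subset) (intro finite_lists_length_le, simp)
qed

lemma finite_E_support: "finite {js \<in> E_indices n. normal_ordered js f \<noteq> 0}"
proof -
  define D where "D = Max (insert 0 ((\<lambda>m. int (weight m)) ` Poly_Mapping.keys f))"
  have "{js \<in> E_indices n. normal_ordered js f \<noteq> 0}
      \<subseteq> {js. 0 \<notin> set js \<and> sum_list (map abs js) \<le> 2 * D - n}"
  proof
    fix js assume "js \<in> {js \<in> E_indices n. normal_ordered js f \<noteq> 0}"
    then have js: "0 \<notin> set js" "sum_list js = n" "normal_ordered js f \<noteq> 0"
      by (auto simp: E_indices_def)
    let ?p = "filter (\<lambda>j. \<not> j < 0) js" and ?q = "filter (\<lambda>j. j < 0) js"
    have "op_prod (map Jop ?p) f \<noteq> 0"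
    proof
      assume "op_prod (map Jop ?p) f = 0"
      then have "normal_ordered js f = 0"
        by (simp only: normal_ordered_def map_append op_prod_append o_apply J_prod_zero)
      with js(3) show False by contradiction
    qed
    then obtain m' where "m' \<in> Poly_Mapping.keys (op_prod (map Jop ?p) f)"
      by (meson all_not_in_conv keys_eq_empty)
    moreover have "\<forall>j\<in>set ?p. j > 0"
    proof
      fix j assume "j \<in> set ?p"
      then have "j \<in> set js" "\<not> j < 0" by simp_all
      moreover from this have "j \<noteq> 0" using js(1) by metis
      ultimately show "j > 0" by linarith
    qed
    ultimately obtain m where "m \<in> Poly_Mapping.keys f"
      "int (weight m') + sum_list ?p = int (weight m)"
      using keys_prod_J_weight by blast
    moreover from this have "int (weight m) \<le> D" unfolding D_def by (intro Max_ge) auto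
    ultimately have "sum_list ?p \<le> D" by linarith
    with js show "js \<in> {js. 0 \<notin> set js \<and> sum_list (map abs js) \<le> 2 * D - n}"
      using sum_list_filter_split[of js] by (auto simp: sum_list_abs_split)
  qed
  then show ?thesis by (rule finite_subset) (rule finite_int_lists_abs_sum)
qed


section \<open>Completed cycles leaky Hurwitz numbers\<close>

text \<open>The number is only defined under the genus and balancing conditions of the first two
  lines; it is set to 0 otherwise. For a point of \<open>leaky_lattice\<close> (below) and \<open>r\<close> satisfying the
  genus condition for $n$, they only fail if some $x_i = 0$, that is, on a wall.\<close>

definition leaky_hurwitz :: "nat \<Rightarrow> int list \<Rightarrow> nat list \<Rightarrow> nat list \<Rightarrow> nat list \<Rightarrow> complex" where
  "leaky_hurwitz g ks rs \<mu> \<nu> =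
     (if (\<Sum>r\<leftarrow>rs. int r - 1) = 2 * int g - 2 + int (length \<mu>) + int (length \<nu>)
         \<and> int (sum_list \<mu>) = int (sum_list \<nu>) + sum_list ks
      then connected_expectation
             (map (\<lambda>a. Jop (int a)) \<mu>
              @ map2 (\<lambda>k r. op_scale (1 / of_nat r) (F_op r k)) ks rs
              @ map (\<lambda>b. Jop (- int b)) \<nu>)
           / (of_nat (prod_list \<mu>) * of_nat (prod_list \<nu>))
      else 0)"

text \<open>Tuples of length $n$ and $s$ are vectors whose index types have $n$ and $s$ elements. The
  linear order on the index types fixes the order of the (non-commuting) factors.\<close>

definition vec_list :: "'a ^ 'i::{finite,linorder} \<Rightarrow> 'a list" where
  "vec_list v = map (vec_nth v) (sorted_list_of_set UNIV)"

definition pos_part :: "(int ^ 'n::{finite,linorder}) \<Rightarrow> nat list" where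
  "pos_part x = map nat (filter (\<lambda>a. a > 0) (vec_list x))"

definition neg_part :: "(int ^ 'n::{finite,linorder}) \<Rightarrow> nat list" where
  "neg_part x = map (\<lambda>a. nat (- a)) (filter (\<lambda>a. a < 0) (vec_list x))"

definition hurwitz_map ::
    "nat \<Rightarrow> (nat ^ 's::{finite,linorder}) \<Rightarrow> (int ^ 'n::{finite,linorder}) \<times> (int ^ 's::{finite,linorder}) \<Rightarrow> complex" where
  "hurwitz_map g r = (\<lambda>(x, k). leaky_hurwitz g (vec_list k) (vec_list r) (pos_part x) (neg_part x))"


section \<open>The leaky resonance arrangement\<close>

definition leaky_lattice :: "((int ^ 'n::finite) \<times> (int ^ 's::finite)) set" where
  "leaky_lattice = {(x, k). (\<Sum>i\<in>UNIV. vec_nth x i) = (\<Sum>j\<in>UNIV. vec_nth k j)}"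

definition leaky_hyperplane :: "((real ^ 'n::finite) \<times> (real ^ 's::finite)) set" where
  "leaky_hyperplane = {(x, k). (\<Sum>i\<in>UNIV. vec_nth x i) = (\<Sum>j\<in>UNIV. vec_nth k j)}"

definition leaky_wall ::
    "'n::finite set \<Rightarrow> 's::finite set \<Rightarrow> ((real ^ 'n::finite) \<times> (real ^ 's::finite)) set" where
  "leaky_wall I J =
     {(x, k) \<in> leaky_hyperplane. (\<Sum>i\<in>I. vec_nth x i) = (\<Sum>j\<in>J. vec_nth k j)}"

definition leaky_arrangement :: "((real ^ 'n::finite) \<times> (real ^ 's::finite)) set set" where
  "leaky_arrangement =
     {leaky_wall I J | I J. (I, J) \<noteq> ({}, {}) \<and> (I, J) \<noteq> (UNIV, UNIV)}"

definition leaky_chambers :: "((real ^ 'n::finite) \<times> (real ^ 's::finite)) set set" where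
  "leaky_chambers = components (leaky_hyperplane - \<Union>leaky_arrangement)"

definition integer_points ::
    "((real ^ 'n::finite) \<times> (real ^ 's::finite)) set \<Rightarrow> ((int ^ 'n::finite) \<times> (int ^ 's::finite)) set" where
  "integer_points c =
     {(x, k). ((\<chi> i. real_of_int (vec_nth x i)), (\<chi> j. real_of_int (vec_nth k j))) \<in> c}"

text \<open>Polynomials in $(\mathbf{x}, \underline{k})$: the variable \<open>Inl i\<close> is $x_i$ and \<open>Inr j\<close> is
  $k_j$.\<close>

definition eval_at ::
    "(int ^ 'n::finite) \<times> (int ^ 's::finite) \<Rightarrow> ('n::finite + 's::finite, rat) mpoly \<Rightarrow> rat" where
  "eval_at = (\<lambda>(x, k). meval (case_sum (\<lambda>i. of_int (vec_nth x i)) (\<lambda>j. of_int (vec_nth k j))))"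

definition agrees_on ::
    "('n::finite + 's::finite, rat) mpoly \<Rightarrow> ((int ^ 'n::finite) \<times> (int ^ 's::finite) \<Rightarrow> complex)
       \<Rightarrow> ((int ^ 'n::finite) \<times> (int ^ 's::finite)) set \<Rightarrow> bool" where
  "agrees_on P h S \<longleftrightarrow> (\<forall>p\<in>S. h p = of_rat (eval_at p P))"

end

theory Submission
  imports Defs
begin

text \<open>
  The operators satisfy
  $[\mathcal{E}_a(u), \mathcal{E}_b(w)] = \varsigma(aw - bu)\, \mathcal{E}_{a+b}(u + w)$ and
  $\langle \mathcal{E}_a(u) \mathcal{E}_{-a}(w) \rangle = \varsigma(a(u+w)) / \varsigma(u+w)$ for $a > 0$.
  The commutation relation holds because the difference of both sides is a family of operators whose
  commutators with the $J_l$ are linear combinations of the family and whose vacuum expectations vanish.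

  Since $J_a$ is the coefficient of $u^0$ in $\mathcal{E}_a(u)$, a Hurwitz number is a vacuum expectation
  of a word in coefficients of the $\mathcal{E}_a(u)$. Inside a chamber no proper subset of the factors
  has total energy 0, so disconnected contributions vanish, the energies of merged factors have
  constant signs, and the word is evaluated by repeatedly commuting a factor of positive energy $a$ with an
  adjacent one of negative energy $b$. The coefficients of $\varsigma(aw - bu)$ are then nonnegative
  multiples of $a^j (-b)^i$, and each $J_a$ contributes a divisor $a$ at its first merging. Because of the
  signs the top degree parts of the summands cannot cancel, and a summand whose top degree
  part vanishes at a point vanishes there itself. This gives the exact degree.
\<close>

section \<open>Bosons on Fock space\<close>

text \<open>Two obstacles shape the proof. First, division by varsigma(u) gives E_0(u) a pole. The
  commutator is therefore established for the numerators varsigma(u) E_n(u), vertex operators over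
  any domain of characteristic 0, where e^{ju/2} enters only through T(i + j) = T(i) T(j). The
  factors varsigma(u), varsigma(w) and varsigma(u + w) are cancelled afterwards in
  \<open>complex fps fps\<close>. Inside a chamber E_0 never arises: two adjacent letters have
  opposite energies only if they are the whole word, and then the two-point formula finishes.
  Second, the polynomial on a chamber is not unique, because the integer points lie on a hyperplane,
  so its degree cannot be read off from its monomials. What is unique is its restriction to a ray t
  p with t = 1, 2, ...; a degree bound on the polynomial and a positive coefficient of the expected
  power of t on one ray together fix the degree.\<close>

abbreviation coef :: "('m \<Rightarrow>\<^sub>0 'a::zero) \<Rightarrow> 'm \<Rightarrow> 'a" where
  "coef \<equiv> Poly_Mapping.lookup"

abbreviation expo :: "'v \<Rightarrow> 'v \<Rightarrow>\<^sub>0 nat" where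
  "expo v \<equiv> Poly_Mapping.single v 1"

section \<open>Coefficients of products and partial derivatives\<close>

lemma coef_single_mult:
  "coef (Poly_Mapping.single k c * f) m = c * Sum_any (\<lambda>q. coef f q when m = k + q)"
proof -
  have "coef (Poly_Mapping.single k c * f) m
      = Sum_any (\<lambda>l. (c when k = l) * Sum_any (\<lambda>q. coef f q when m = l + q))"
    by (simp add: lookup_mult lookup_single)
  also have "\<dots> = Sum_any (\<lambda>l. (c * Sum_any (\<lambda>q. coef f q when m = l + q)) when l = k)"
    by (rule Sum_any.cong) (auto simp: when_def)
  finally show ?thesis by simp
qed

lemma coef_mconst_mult [simp]: "coef (mconst c * f) m = c * coef f m"
proof -
  have "Sum_any (\<lambda>q. coef f q when m = 0 + q) = Sum_any (\<lambda>q. coef f q when q = m)"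
    by (rule Sum_any.cong) (auto simp: when_def)
  then show ?thesis by (simp add: mconst_def coef_single_mult)
qed

lemma coef_mult_mconst [simp]: "coef (f * mconst c) m = c * coef f m"
  by (metis coef_mconst_mult mult.commute)

lemma mconst_0 [simp]: "mconst 0 = 0"
  by (simp add: mconst_def)

lemma mconst_1 [simp]: "mconst 1 = 1"
  by (simp add: mconst_def)

lemma mconst_add: "mconst (a + b) = mconst a + mconst b"
  by (simp add: mconst_def single_add)

lemma mconst_mult: "mconst (a * b) = mconst a * mconst b"
  by (simp add: mconst_def mult_single)

lemma mconst_sum: "mconst (sum h S) = (\<Sum>x\<in>S. mconst (h x))"
  by (induction S rule: infinite_finite_induct) (auto simp: mconst_add)

lemma of_int_eq_mconst: "of_int i = mconst (of_int i)"
  by (simp add: mconst_def)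

lemma expo_diff_add:
  assumes "coef m v \<noteq> (0::nat)"
  shows "m - expo v + expo v = m"
  using assms
  by (intro poly_mapping_eqI) (auto simp: lookup_add lookup_minus lookup_single when_def)

lemma coef_mvar_mult:
  "coef (mvar v * f) m = (if coef m v = 0 then 0 else coef f (m - expo v))"
proof (cases "coef m v = 0")
  case True
  then have "m \<noteq> expo v + q" for q
    by (auto simp: lookup_add lookup_single)
  then show ?thesis using True by (simp add: mvar_def coef_single_mult)
next
  case False
  have "m = expo v + q \<longleftrightarrow> q = m - expo v" for q
    using expo_diff_add[OF False] by (metis add_diff_cancel_left' add.commute)
  then show ?thesis using False by (simp add: mvar_def coef_single_mult)
qed

lemma coef_mpartial:
  "coef (mpartial v f) m = of_nat (Suc (coef m v)) * coef f (m + expo v)"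
proof -
  have "coef (mpartial v f) m
      = (\<Sum>m'\<in>Poly_Mapping.keys f. of_nat (coef m' v) * coef f m' when m' - expo v = m)"
    by (simp add: mpartial_def lookup_sum lookup_single)
  also have "\<dots> = (\<Sum>m'\<in>Poly_Mapping.keys f. of_nat (coef m' v) * coef f m' when m' = m + expo v)"
  proof (rule sum.cong)
    fix m'
    show "(of_nat (coef m' v) * coef f m' when m' - expo v = m)
        = (of_nat (coef m' v) * coef f m' when m' = m + expo v)"
    proof (cases "coef m' v = 0")
      case False
      have "m' - expo v = m \<longleftrightarrow> m' = m + expo v"
        using expo_diff_add[OF False] by (metis add_diff_cancel_right')
      then show ?thesis by simp
    qed simp
  qed simp
  also have "\<dots> = of_nat (coef (m + expo v) v) * coef f (m + expo v)"
  proof (cases "m + expo v \<in> Poly_Mapping.keys f")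
    case True
    then show ?thesis by (simp add: when_def)
  next
    case False
    then show ?thesis by (subst sum.neutral) (auto simp: in_keys_iff when_def)
  qed
  finally show ?thesis by (simp add: lookup_add)
qed

text \<open>\<open>Jop\<close> over an arbitrary commutative ring, because the commutation relations
  are proved with two-variable power series as scalars.\<close>

definition bos :: "int \<Rightarrow> (nat, 'a::comm_ring_1) mpoly \<Rightarrow> (nat, 'a) mpoly" where
  "bos j f = (if j < 0 then mvar (nat (- j)) * f else of_int j * mpartial (nat j) f)"

lemma Jop_eq_bos: "Jop = bos"
  by (intro ext) (simp add: Jop_def bos_def)

lemma coef_bos:
  "coef (bos j f) m =
     (if j < 0 then (if coef m (nat (- j)) = 0 then 0 else coef f (m - expo (nat (- j))))
      else of_int j * (of_nat (Suc (coef m (nat j))) * coef f (m + expo (nat j))))"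
  by (simp add: bos_def coef_mvar_mult coef_mpartial of_int_eq_mconst del: of_nat_Suc)

lemma bos_0_left [simp]: "bos 0 f = 0"
  by (simp add: bos_def)

lemma bos_zero [simp]: "bos j 0 = 0"
  by (rule poly_mapping_eqI) (simp add: coef_bos)

lemma bos_add: "bos j (f + g) = bos j f + bos j g"
  by (rule poly_mapping_eqI) (simp add: coef_bos lookup_add algebra_simps)

lemma bos_mconst: "bos j (mconst c * f) = mconst c * bos j f"
  by (rule poly_mapping_eqI) (simp add: coef_bos algebra_simps)

lemma bos_sum: "bos j (sum h S) = (\<Sum>x\<in>S. bos j (h x))"
  by (induction S rule: infinite_finite_induct) (auto simp: bos_add)

text \<open>The Heisenberg relation. A constant arises only between a multiplication and the
  derivative in the same variable, where the product rule yields it; operators of equal sign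
  commute.\<close>

lemma bos_commute:
  "bos a (bos b f) = bos b (bos a f) + (if a + b = 0 then of_int a * f else 0)"
proof -
  have neg: "bos a (bos b f) = bos b (bos a f) + (if a + b = 0 then of_int a * f else 0)"
    if "a \<ge> 0" "b < 0" for a b and f :: "(nat, 'a) mpoly"
  proof (rule poly_mapping_eqI)
    fix m
    show "coef (bos a (bos b f)) m
        = coef (bos b (bos a f) + (if a + b = 0 then of_int a * f else 0)) m"
    proof (cases "a + b = 0")
      case True
      then have nb: "nat (- b) = nat a" by simp
      show ?thesis
      proof (cases "coef m (nat a) = 0")
        case True
        then show ?thesis using that \<open>a + b = 0\<close> nb
          by (simp add: coef_bos lookup_add of_int_eq_mconst)
      next
        case False
        then obtain l where l: "coef m (nat a) = Suc l" by (cases "coef m (nat a)") auto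
        then show ?thesis using that \<open>a + b = 0\<close> nb expo_diff_add[OF False]
          by (simp add: coef_bos lookup_add lookup_minus of_int_eq_mconst algebra_simps)
      qed
    next
      case False
      then have ne: "nat (- b) \<noteq> nat a" using that by auto
      have swap: "m + expo (nat a) - expo (nat (- b)) = m - expo (nat (- b)) + expo (nat a)"
        if "coef m (nat (- b)) \<noteq> 0"
        using that ne
        by (intro poly_mapping_eqI) (auto simp: lookup_minus lookup_add lookup_single when_def)
      have "coef m (nat (- b)) = coef (m + expo (nat a)) (nat (- b))"
           "coef (m - expo (nat (- b))) (nat a) = coef m (nat a)"
        using ne by (auto simp: lookup_add lookup_minus lookup_single when_def)
      then show ?thesis using that False swap by (simp add: coef_bos)
    qed
  qed
  consider "a \<ge> 0" "b < 0" | "a < 0" "b \<ge> 0" | "a \<ge> 0" "b \<ge> 0" | "a < 0" "b < 0" by linarith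
  then show ?thesis
  proof cases
    case 1
    then show ?thesis by (rule neg)
  next
    case 2
    then show ?thesis using neg[OF 2(2,1), of f]
      by (auto simp: add.commute[of b a] of_int_minus eq_neg_iff_add_eq_0)
         (simp add: eq_neg_iff_add_eq_0[symmetric])
  next
    case 3
    have "coef (bos a (bos b f)) m = coef (bos b (bos a f)) m" for m
    proof (cases "nat a = nat b")
      case True
      then show ?thesis using 3 by (simp add: nat_eq_iff)
    next
      case False
      then show ?thesis using 3
        by (simp add: coef_bos lookup_add lookup_single ac_simps del: of_nat_Suc)
    qed
    then have "bos a (bos b f) = bos b (bos a f)" by (rule poly_mapping_eqI)
    moreover have "a = 0" if "a + b = 0" using 3 that by linarith
    then have "(if a + b = 0 then of_int a * f else 0) = 0" by auto
    ultimately show ?thesis by simp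
  next
    case 4
    then show ?thesis by (simp add: bos_def mult.left_commute)
  qed
qed

lemma keys_bos_weight:
  assumes "m' \<in> Poly_Mapping.keys (bos j f)"
  shows "\<exists>m\<in>Poly_Mapping.keys f. int (weight m') + j = int (weight m) \<and> coef m' 0 = coef m 0"
proof -
  have nz: "coef (bos j f) m' \<noteq> 0" using assms by (simp add: in_keys_iff)
  show ?thesis
  proof (cases "j < 0")
    case True
    with nz have 1: "coef m' (nat (- j)) \<noteq> 0" "coef f (m' - expo (nat (- j))) \<noteq> 0"
      by (auto simp: coef_bos split: if_splits)
    have "weight (m' - expo (nat (- j))) + nat (- j) = weight m'"
      by (rule weight_minus_single) (rule 1)
    moreover have "coef (m' - expo (nat (- j))) 0 = coef m' 0"
      using True by (simp add: lookup_minus lookup_single)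
    ultimately show ?thesis using True 1
      by (intro bexI[of _ "m' - expo (nat (- j))"]) (auto simp: in_keys_iff)
  next
    case False
    with nz have 1: "j \<noteq> 0" "coef f (m' + expo (nat j)) \<noteq> 0"
      by (auto simp: coef_bos)
    have "weight (m' + expo (nat j) - expo (nat j)) + nat j = weight (m' + expo (nat j))"
      by (rule weight_minus_single) (simp add: lookup_add)
    moreover have "coef (m' + expo (nat j)) 0 = coef m' 0"
      using False 1 by (simp add: lookup_add lookup_single)
    ultimately show ?thesis using False 1
      by (intro bexI[of _ "m' + expo (nat j)"]) (auto simp: in_keys_iff)
  qed
qed

text \<open>The degree is an integer: an operator of positive energy sends 1 to an element of
  negative degree, which is 0 by \<open>homog_neg\<close>.\<close>

definition homog :: "int \<Rightarrow> (nat, 'a::zero) mpoly \<Rightarrow> bool" where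
  "homog d f \<longleftrightarrow> (\<forall>m\<in>Poly_Mapping.keys f. int (weight m) = d)"

text \<open>Excludes the unused variable $p_0$, on which the operators
  \<open>bos j\<close> do not act.\<close>

definition no_p0 :: "(nat, 'a::zero) mpoly \<Rightarrow> bool" where
  "no_p0 f \<longleftrightarrow> (\<forall>m\<in>Poly_Mapping.keys f. coef m 0 = 0)"

lemma homog_bos: "homog d f \<Longrightarrow> homog (d - j) (bos j f)"
  using keys_bos_weight unfolding homog_def by fastforce

lemma no_p0_bos: "no_p0 f \<Longrightarrow> no_p0 (bos j f)"
  using keys_bos_weight unfolding no_p0_def by fastforce

lemma homog_0 [simp]: "homog d 0" and no_p0_0 [simp]: "no_p0 0"
  by (simp_all add: homog_def no_p0_def)

lemma homog_1 [simp]: "homog 0 1" and no_p0_1 [simp]: "no_p0 1"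
  by (auto simp: homog_def no_p0_def weight_def)

lemma keys_mconst_mult: "Poly_Mapping.keys (mconst c * f) \<subseteq> Poly_Mapping.keys f"
  by (auto simp: in_keys_iff)

lemma homog_mconst: "homog d f \<Longrightarrow> homog d (mconst c * f)"
  and no_p0_mconst: "no_p0 f \<Longrightarrow> no_p0 (mconst c * f)"
  using keys_mconst_mult[of c f] by (auto simp: homog_def no_p0_def)

lemma homog_sum: "(\<And>x. x \<in> S \<Longrightarrow> homog d (h x)) \<Longrightarrow> homog d (sum h S)"
  and no_p0_sum: "(\<And>x. x \<in> S \<Longrightarrow> no_p0 (h x)) \<Longrightarrow> no_p0 (sum h S)"
  unfolding homog_def no_p0_def using keys_sum[of h S] by fastforce+

lemma weight_0 [simp]: "weight 0 = 0"
  by (simp add: weight_def)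

lemma homog_coef_0: "homog d f \<Longrightarrow> d \<noteq> 0 \<Longrightarrow> coef f 0 = 0"
  unfolding homog_def by (metis in_keys_iff of_nat_0 weight_0)

lemma homog_neg: "homog d f \<Longrightarrow> d < 0 \<Longrightarrow> f = 0"
  unfolding homog_def by (metis keys_eq_empty all_not_in_conv not_less of_nat_0_le_iff)

text \<open>A nonnegative entry acts before the rest of the list, so annihilators are applied in the
  opposite order to \<open>normal_ordered\<close>; they commute. The recursion on the list suits the
  inductions below.\<close>

fun NO :: "int list \<Rightarrow> (nat, 'a::comm_ring_1) mpoly \<Rightarrow> (nat, 'a) mpoly" where
  "NO [] f = f"
| "NO (j # js) f = (if j < 0 then bos j (NO js f) else NO js (bos j f))"

lemma foldr_bos_nonneg:
  "\<forall>i\<in>set js. i \<ge> 0 \<Longrightarrow> j \<ge> 0 \<Longrightarrow>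
     foldr bos js (bos j (f :: (nat, 'a::comm_ring_1) mpoly)) = bos j (foldr bos js f)"
proof (induction js)
  case (Cons i js)
  have "i + j = 0 \<Longrightarrow> i = 0" using Cons.prems by auto
  then have "bos i (bos j g) = bos j (bos i g)" for g :: "(nat, 'a) mpoly"
    using bos_commute[of i j g] by (auto split: if_splits)
  then show ?case using Cons by simp
qed simp

lemma normal_ordered_eq_NO: "normal_ordered js = NO js"
proof -
  have op: "op_prod (map Jop ks) f = foldr bos ks f" for ks and f :: fock
    by (induction ks) (auto simp: op_prod_def Jop_eq_bos)
  have "foldr bos (filter (\<lambda>j. j < 0) js) (foldr bos (filter (\<lambda>j. \<not> j < 0) js) f) = NO js f"
    for f :: fock
  proof (induction js arbitrary: f)
    case (Cons j js)
    show ?case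
    proof (cases "j < 0")
      case False
      then have "bos j (foldr bos (filter (\<lambda>j. \<not> j < 0) js) f)
          = foldr bos (filter (\<lambda>j. \<not> j < 0) js) (bos j f)"
        by (intro foldr_bos_nonneg[symmetric]) auto
      then show ?thesis using False Cons by simp
    qed (use Cons in simp)
  qed simp
  then show ?thesis by (intro ext) (simp add: normal_ordered_def op op_prod_append flip: map_append)
qed

lemma NO_zero [simp]: "NO js 0 = 0"
  by (induction js) auto

lemma NO_add: "NO js (f + g) = NO js f + NO js g"
  by (induction js arbitrary: f g) (auto simp: bos_add)

lemma NO_mconst: "NO js (mconst c * f) = mconst c * NO js f"
  by (induction js arbitrary: f) (auto simp: bos_mconst)

lemma NO_homog: "homog d f \<Longrightarrow> homog (d - sum_list js) (NO js f)"
proof (induction js arbitrary: d f)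
  case (Cons j js)
  show ?case
  proof (cases "j < 0")
    case True
    then show ?thesis using homog_bos[OF Cons.IH[OF Cons.prems], of j] by (simp add: algebra_simps)
  next
    case False
    then show ?thesis using Cons.IH[OF homog_bos[OF Cons.prems, of j]] by (simp add: algebra_simps)
  qed
qed simp

lemma NO_no_p0: "no_p0 f \<Longrightarrow> no_p0 (NO js f)"
  by (induction js arbitrary: f) (auto simp: no_p0_bos)

text \<open>Wick's theorem for a single factor: moving J_l through the product contracts it with
  each entry \<open>- l\<close> in turn.\<close>

lemma bos_NO_commute:
  "bos l (NO js f) = NO js (bos l f)
     + (\<Sum>i<length js. if js ! i = - l then of_int l * NO (take i js @ drop (Suc i) js) f else 0)"
proof (induction js arbitrary: f)
  case (Cons j js)
  let ?r = "\<lambda>js f i. if js ! i = - l then of_int l * NO (take i js @ drop (Suc i) js) f else 0"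
  have split: "(\<Sum>i<length (j # js). ?r (j # js) f i)
      = ?r (j # js) f 0 + (\<Sum>i<length js. ?r (j # js) f (Suc i))"
    by (simp only: length_Cons sum.lessThan_Suc_shift)
  have comm: "bos l (bos j g) = bos j (bos l g) + (if j = - l then of_int l * g else 0)"
    for g :: "(nat, 'a) mpoly"
    using bos_commute[of l j g] by (auto simp: eq_neg_iff_add_eq_0 add.commute)
  show ?case
  proof (cases "j < 0")
    case True
    have "bos j (?r js f i) = ?r (j # js) f (Suc i)" for i
      using True by (simp add: bos_mconst of_int_eq_mconst)
    then show ?thesis using True Cons[of f] comm[of "NO js f"]
      by (simp only: split) (simp add: bos_add bos_sum algebra_simps)
  next
    case False
    have "NO js (if j = - l then of_int l * f else 0) = ?r (j # js) f 0"
      by (simp add: of_int_eq_mconst NO_mconst)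
    moreover have "?r js (bos j f) i = ?r (j # js) f (Suc i)" for i
      using False by simp
    ultimately show ?thesis using False Cons[of "bos j f"] comm[of f]
      by (simp only: split) (simp add: NO_add algebra_simps)
  qed
qed simp

text \<open>The nonnegative entries act first and lower the weight by their sum, which cannot exceed
  the largest weight in \<open>f\<close>.\<close>

lemma NO_nonzero_bound:
  assumes "NO js f \<noteq> 0" "\<And>m. m \<in> Poly_Mapping.keys f \<Longrightarrow> int (weight m) \<le> D"
  shows "sum_list (filter (\<lambda>j. \<not> j < 0) js) \<le> D"
  using assms
proof (induction js arbitrary: f D)
  case Nil
  then obtain m where "m \<in> Poly_Mapping.keys f" by (metis NO.simps(1) all_not_in_conv keys_eq_empty)
  with Nil show ?case by fastforce
next
  case (Cons j js)
  show ?case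
  proof (cases "j < 0")
    case True
    with Cons.prems have "NO js f \<noteq> 0" by auto
    with Cons.IH[OF this Cons.prems(2)] True show ?thesis by simp
  next
    case False
    have "int (weight m) \<le> D - j" if "m \<in> Poly_Mapping.keys (bos j f)" for m
      using keys_bos_weight[OF that] Cons.prems(2) by fastforce
    moreover have "NO js (bos j f) \<noteq> 0" using Cons.prems False by simp
    ultimately have "sum_list (filter (\<lambda>j. \<not> j < 0) js) \<le> D - j"
      using Cons.IH by blast
    with False show ?thesis by simp
  qed
qed

section \<open>Vertex operators and their commutators\<close>

lemma coef_mconst_0 [simp]: "coef (mconst c) 0 = c"
  by (simp add: mconst_def)

definition E_lists :: "int \<Rightarrow> int \<Rightarrow> int list set" where
  "E_lists n B = {js \<in> E_indices n. sum_list (map abs js) \<le> B}"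

lemma finite_E_lists [simp]: "finite (E_lists n B)"
  by (rule finite_subset[OF _ finite_int_lists_abs_sum[of B]]) (auto simp: E_lists_def E_indices_def)

text \<open>Both E_n(u), taken coefficientwise, and its numerator varsigma(u) E_n(u) have this
  shape; leaving the weights free allows the scalar ring to change.\<close>

definition Gop :: "(int list \<Rightarrow> 'a::comm_ring_1) \<Rightarrow> int \<Rightarrow> (nat, 'a) mpoly \<Rightarrow> (nat, 'a) mpoly" where
  "Gop w n f = Sum_any (\<lambda>js. if js \<in> E_indices n then mconst (w js) * NO js f else 0)"

lemma Gop_eq_sum:
  assumes "\<And>m. m \<in> Poly_Mapping.keys f \<Longrightarrow> int (weight m) \<le> D" "2 * D - n \<le> B"
  shows "Gop w n f = (\<Sum>js\<in>E_lists n B. mconst (w js) * NO js f)"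
proof -
  have "NO js f = 0" if "js \<in> E_indices n" "js \<notin> E_lists n B" for js
  proof (rule ccontr)
    assume "NO js f \<noteq> 0"
    from NO_nonzero_bound[OF this assms(1)] have "sum_list (filter (\<lambda>j. \<not> j < 0) js) \<le> D" by blast
    \<comment> \<open>The absolute values add up to twice the sum of the nonnegative entries minus
      \<open>n\<close>.\<close>
    then have "sum_list (map abs js) \<le> B"
      using that(1) sum_list_filter_split[of js] assms(2)
      by (auto simp: sum_list_abs_split E_indices_def)
    with that show False by (simp add: E_lists_def)
  qed
  then have "Gop w n f
      = (\<Sum>js\<in>E_lists n B. if js \<in> E_indices n then mconst (w js) * NO js f else 0)"
    unfolding Gop_def
    by (intro Sum_any.expand_superset) (auto split: if_splits, metis mult_zero_right)
  also have "\<dots> = (\<Sum>js\<in>E_lists n B. mconst (w js) * NO js f)"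
    by (rule sum.cong) (auto simp: E_lists_def)
  finally show ?thesis .
qed

text \<open>One truncation works for all weights and may be enlarged, so sums with different
  arguments can be cut off at a common bound.\<close>

lemma Gop_bound: "\<exists>B0. \<forall>B\<ge>B0. \<forall>w. Gop w n f = (\<Sum>js\<in>E_lists n B. mconst (w js) * NO js f)"
proof -
  define D where "D = Max (insert 0 ((\<lambda>m. int (weight m)) ` Poly_Mapping.keys f))"
  have "int (weight m) \<le> D" if "m \<in> Poly_Mapping.keys f" for m
    unfolding D_def using that by (intro Max_ge) auto
  then show ?thesis using Gop_eq_sum[of f D n] by blast
qed

lemma Gop_add: "Gop w n (f + g) = Gop w n f + Gop w n g"
proof -
  obtain B1 where "\<forall>B\<ge>B1. \<forall>w. Gop w n f = (\<Sum>js\<in>E_lists n B. mconst (w js) * NO js f)"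
    using Gop_bound[of n f] ..
  moreover obtain B2 where "\<forall>B\<ge>B2. \<forall>w. Gop w n g = (\<Sum>js\<in>E_lists n B. mconst (w js) * NO js g)"
    using Gop_bound[of n g] ..
  moreover obtain B3 where
    "\<forall>B\<ge>B3. \<forall>w. Gop w n (f + g) = (\<Sum>js\<in>E_lists n B. mconst (w js) * NO js (f + g))"
    using Gop_bound[of n "f + g"] ..
  ultimately have
    "Gop w n f = (\<Sum>js\<in>E_lists n (max B1 (max B2 B3)). mconst (w js) * NO js f)"
    "Gop w n g = (\<Sum>js\<in>E_lists n (max B1 (max B2 B3)). mconst (w js) * NO js g)"
    "Gop w n (f + g) = (\<Sum>js\<in>E_lists n (max B1 (max B2 B3)). mconst (w js) * NO js (f + g))"
    by simp_all
  then show ?thesis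
    by (simp add: NO_add algebra_simps sum.distrib)
qed

lemma Gop_mconst: "Gop w n (mconst c * f) = mconst c * Gop w n f"
proof -
  obtain B1 where "\<forall>B\<ge>B1. \<forall>w. Gop w n f = (\<Sum>js\<in>E_lists n B. mconst (w js) * NO js f)"
    using Gop_bound[of n f] ..
  moreover obtain B2 where "\<forall>B\<ge>B2. \<forall>w. Gop w n (mconst c * f)
      = (\<Sum>js\<in>E_lists n B. mconst (w js) * NO js (mconst c * f))"
    using Gop_bound[of n "mconst c * f"] ..
  ultimately have
    "Gop w n f = (\<Sum>js\<in>E_lists n (max B1 B2). mconst (w js) * NO js f)"
    "Gop w n (mconst c * f) = (\<Sum>js\<in>E_lists n (max B1 B2). mconst (w js) * NO js (mconst c * f))"
    by simp_all
  then show ?thesis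
    by (simp add: NO_mconst sum_distrib_left mult.left_commute)
qed

lemma Gop_0 [simp]: "Gop w n 0 = 0"
  using Gop_mconst[of w n 0 0] by simp

lemma Gop_sum: "Gop w n (sum h S) = (\<Sum>x\<in>S. Gop w n (h x))"
  by (induction S rule: infinite_finite_induct) (auto simp: Gop_add)

lemma Gop_scale: "Gop (\<lambda>js. c * w js) n f = mconst c * Gop w n f"
proof -
  obtain B where "\<forall>w. Gop w n f = (\<Sum>js\<in>E_lists n B. mconst (w js) * NO js f)"
    using Gop_bound[of n f] by blast
  then show ?thesis by (simp add: mconst_mult sum_distrib_left mult.assoc)
qed

lemma Gop_cong: "(\<And>js. js \<in> E_indices n \<Longrightarrow> w js = w' js) \<Longrightarrow> Gop w n f = Gop w' n f"
  unfolding Gop_def by (intro Sum_any.cong) auto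

lemma Gop_homog: "homog d f \<Longrightarrow> homog (d - n) (Gop w n f)"
proof -
  assume f: "homog d f"
  obtain B where B: "\<forall>w. Gop w n f = (\<Sum>js\<in>E_lists n B. mconst (w js) * NO js f)"
    using Gop_bound[of n f] by blast
  have "homog (d - n) (NO js f)" if "js \<in> E_lists n B" for js
    using NO_homog[OF f, of js] that by (auto simp: E_lists_def E_indices_def)
  then show ?thesis unfolding B[rule_format] by (intro homog_sum homog_mconst)
qed

lemma Gop_no_p0: "no_p0 f \<Longrightarrow> no_p0 (Gop w n f)"
proof -
  assume f: "no_p0 f"
  obtain B where B: "\<forall>w. Gop w n f = (\<Sum>js\<in>E_lists n B. mconst (w js) * NO js f)"
    using Gop_bound[of n f] by blast
  show ?thesis unfolding B[rule_format] by (intro no_p0_sum no_p0_mconst NO_no_p0 f)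
qed

lemma Gop_0_1:
  assumes "w [] = 1"
  shows "Gop w 0 1 = 1"
proof -
  have "sum_list (map abs js) > 0" if "0 \<notin> set js" "js \<noteq> []" for js :: "int list"
  proof -
    obtain a b where "js = a # b" using \<open>js \<noteq> []\<close> by (cases js) auto
    moreover have "sum_list (map abs b) \<ge> 0" by (rule sum_list_nonneg) auto
    ultimately show ?thesis using that(1) by auto
  qed
  then have "E_lists 0 0 = {[]}"
    by (fastforce simp: E_lists_def E_indices_def)
  moreover have "Gop w 0 1 = (\<Sum>js\<in>E_lists 0 0. mconst (w js) * NO js 1)"
    by (rule Gop_eq_sum[of _ 0]) auto
  ultimately show ?thesis using assms by simp
qed

lemma Gop_pos_1: "n > 0 \<Longrightarrow> Gop w n 1 = 0"
  using Gop_homog[OF homog_1, of n w] by (intro homog_neg[of "0 - n"]) auto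

text \<open>The weights of the normally ordered products in a vertex operator
  \<open>:exp (\<Sum>j. \<phi> j J_j):\<close> with \<open>l \<phi> (- l) = T l - T (- l)\<close>.\<close>

definition exp_weight :: "(int list \<Rightarrow> 'a::comm_ring_1) \<Rightarrow> (int \<Rightarrow> 'a) \<Rightarrow> bool" where
  "exp_weight w T \<longleftrightarrow> w [] = 1 \<and>
     (\<forall>l js. l \<noteq> 0 \<longrightarrow> of_int l * (\<Sum>i\<le>length js. w (take i js @ - l # drop i js))
        = (T l - T (- l)) * w js)"

text \<open>Removing the entry \<open>- l\<close> at a marked place and inserting it there are
  inverse to each other. Removal raises the sum of the list by \<open>l\<close> and lowers the sum
  of absolute values by |l|, whence the two truncations.\<close>

lemma sum_remove_eq_sum_insert:
  fixes h :: "int list \<Rightarrow> int list \<Rightarrow> 'b::comm_monoid_add"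
  assumes "l \<noteq> 0"
  shows "(\<Sum>js\<in>E_lists n (B + \<bar>l\<bar>). \<Sum>i<length js.
            if js ! i = - l then h js (take i js @ drop (Suc i) js) else 0)
       = (\<Sum>js\<in>E_lists (n + l) B. \<Sum>i\<le>length js. h (take i js @ - l # drop i js) js)"
proof -
  let ?S = "SIGMA js:E_lists n (B + \<bar>l\<bar>). {i. i < length js \<and> js ! i = - l}"
  let ?S' = "SIGMA js:E_lists (n + l) B. {..length js}"
  have del: "(take i js @ drop (Suc i) js, i) \<in> ?S'"
      "take i (take i js @ drop (Suc i) js) @ - l # drop i (take i js @ drop (Suc i) js) = js"
    if "(js, i) \<in> ?S" for js i
  proof -
    from that have i: "i < length js" "js ! i = - l" by auto
    define u v where "u = take i js" and "v = drop (Suc i) js"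
    have js: "js = u @ - l # v" and u: "length u = i"
      using id_take_nth_drop[OF i(1)] i by (simp_all add: u_def v_def)
    show "(take i js @ drop (Suc i) js, i) \<in> ?S'"
      using that assms by (simp add: js u E_lists_def E_indices_def)
    show "take i (take i js @ drop (Suc i) js) @ - l # drop i (take i js @ drop (Suc i) js) = js"
      by (simp add: js u[symmetric])
  qed
  have ins: "(take i js @ - l # drop i js, i) \<in> ?S"
      "take i (take i js @ - l # drop i js) @ drop (Suc i) (take i js @ - l # drop i js) = js"
    if "(js, i) \<in> ?S'" for js i
  proof -
    define u v where "u = take i js" and "v = drop i js"
    have js: "js = u @ v" and u: "length u = i"
      using that by (auto simp: u_def v_def)
    show "(take i js @ - l # drop i js, i) \<in> ?S"
      using that assms by (auto simp: js u[symmetric] E_lists_def E_indices_def)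
    show "take i (take i js @ - l # drop i js) @ drop (Suc i) (take i js @ - l # drop i js) = js"
      by (simp add: js u[symmetric])
  qed
  have "(\<Sum>js\<in>E_lists n (B + \<bar>l\<bar>). \<Sum>i<length js.
            if js ! i = - l then h js (take i js @ drop (Suc i) js) else 0)
      = (\<Sum>js\<in>E_lists n (B + \<bar>l\<bar>). \<Sum>i | i < length js \<and> js ! i = - l.
            h js (take i js @ drop (Suc i) js))"
    by (intro sum.cong refl sum.mono_neutral_cong_right) auto
  also have "\<dots> = (\<Sum>(js, i)\<in>?S. h js (take i js @ drop (Suc i) js))"
    by (rule sum.Sigma) auto
  also have "\<dots> = (\<Sum>(js, i)\<in>?S'. h (take i js @ - l # drop i js) js)"
  proof (rule sum.reindex_bij_witness[of _
      "\<lambda>(js, i). (take i js @ - l # drop i js, i)" "\<lambda>(js, i). (take i js @ drop (Suc i) js, i)"],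
      goal_cases)
    case (1 a) then show ?case using del(2) by (cases a) (simp only: prod.case)
  next
    case (2 a) then show ?case using del(1) by (cases a) (simp only: prod.case)
  next
    case (3 b) then show ?case using ins(2) by (cases b) (simp only: prod.case)
  next
    case (4 b) then show ?case using ins(1) by (cases b) (simp only: prod.case)
  next
    case (5 a) then show ?case using del(2) by (cases a) (simp only: prod.case)
  qed
  also have "\<dots> = (\<Sum>js\<in>E_lists (n + l) B. \<Sum>i\<le>length js. h (take i js @ - l # drop i js) js)"
    by (rule sum.Sigma[symmetric]) auto
  finally show ?thesis .
qed

text \<open>The contractions with J_l, resummed over all ways of inserting \<open>- l\<close> into a
  shorter list, are exactly what \<open>exp_weight\<close> evaluates. So the family over
  \<open>n\<close> is closed under commutators with J_l.\<close>

lemma bos_Gop: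
  assumes "exp_weight w T" "l \<noteq> 0"
  shows "bos l (Gop w n f) = Gop w n (bos l f) + mconst (T l - T (- l)) * Gop w (n + l) f"
proof -
  obtain B1 where "\<forall>B\<ge>B1. \<forall>w. Gop w n f = (\<Sum>js\<in>E_lists n B. mconst (w js) * NO js f)"
    using Gop_bound[of n f] ..
  moreover obtain B2 where
    "\<forall>B\<ge>B2. \<forall>w. Gop w n (bos l f) = (\<Sum>js\<in>E_lists n B. mconst (w js) * NO js (bos l f))"
    using Gop_bound[of n "bos l f"] ..
  moreover obtain B3 where
    "\<forall>B\<ge>B3. \<forall>w. Gop w (n + l) f = (\<Sum>js\<in>E_lists (n + l) B. mconst (w js) * NO js f)"
    using Gop_bound[of "n + l" f] ..
  moreover define B where "B = max B1 (max B2 B3)"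
  ultimately have B:
    "Gop w n f = (\<Sum>js\<in>E_lists n (B + \<bar>l\<bar>). mconst (w js) * NO js f)"
    "Gop w n (bos l f) = (\<Sum>js\<in>E_lists n (B + \<bar>l\<bar>). mconst (w js) * NO js (bos l f))"
    "Gop w (n + l) f = (\<Sum>js\<in>E_lists (n + l) B. mconst (w js) * NO js f)"
    by auto
  define h where "h = (\<lambda>js js'. mconst (w js) * (of_int l * NO js' f))"
  have hsum: "(\<Sum>i\<le>length js. h (take i js @ - l # drop i js) js)
      = mconst (T l - T (- l)) * (mconst (w js) * NO js f)" for js
  proof -
    have "(\<Sum>i\<le>length js. h (take i js @ - l # drop i js) js)
        = mconst (of_int l * (\<Sum>i\<le>length js. w (take i js @ - l # drop i js))) * NO js f"
      by (simp add: h_def mconst_mult mconst_sum of_int_eq_mconst sum_distrib_left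
          sum_distrib_right algebra_simps)
    also have "of_int l * (\<Sum>i\<le>length js. w (take i js @ - l # drop i js)) = (T l - T (- l)) * w js"
      using assms by (simp add: exp_weight_def)
    finally show ?thesis by (simp add: mconst_mult mult.assoc)
  qed
  have "bos l (Gop w n f) = (\<Sum>js\<in>E_lists n (B + \<bar>l\<bar>). mconst (w js) * bos l (NO js f))"
    by (simp add: B bos_sum bos_mconst)
  also have "\<dots> = (\<Sum>js\<in>E_lists n (B + \<bar>l\<bar>). mconst (w js) * NO js (bos l f)
        + (\<Sum>i<length js. if js ! i = - l then h js (take i js @ drop (Suc i) js) else 0))"
    by (intro sum.cong refl)
       (auto simp: bos_NO_commute distrib_left sum_distrib_left h_def intro!: sum.cong)
  also have "\<dots> = Gop w n (bos l f)
        + (\<Sum>js\<in>E_lists (n + l) B. \<Sum>i\<le>length js. h (take i js @ - l # drop i js) js)"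
    by (simp add: sum.distrib sum_remove_eq_sum_insert[OF assms(2)] B)
  finally show ?thesis by (simp add: hsum B sum_distrib_left)
qed

lemma bos_nonneg_1: "l \<ge> 0 \<Longrightarrow> bos l 1 = 0"
proof (cases "l = 0")
  case False
  assume "l \<ge> 0"
  with False show ?thesis using homog_bos[OF homog_1, of l] by (intro homog_neg[of "0 - l"]) auto
qed simp

lemma poly_mapping_sum_singles: "(\<Sum>m\<in>Poly_Mapping.keys f. Poly_Mapping.single m (coef f m)) = f"
proof (rule poly_mapping_eqI)
  fix k
  show "coef (\<Sum>m\<in>Poly_Mapping.keys f. Poly_Mapping.single m (coef f m)) k = coef f k"
    by (cases "k \<in> Poly_Mapping.keys f") (auto simp: lookup_sum lookup_single when_def in_keys_iff)
qed

text \<open>This is the irreducibility of Fock space under the \<open>bos l\<close>.\<close>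

lemma operator_family_zero:
  fixes C :: "int \<Rightarrow> int \<Rightarrow> (nat, 'a::{idom,semiring_char_0}) mpoly \<Rightarrow> (nat, 'a) mpoly"
  assumes add: "\<And>a b f g. C a b (f + g) = C a b f + C a b g"
    and scale: "\<And>a b c f. C a b (mconst c * f) = mconst c * C a b f"
    and comm: "\<And>a b l f. l \<noteq> 0 \<Longrightarrow> bos l (C a b f)
        = C a b (bos l f) + mconst (\<alpha> l) * C (a + l) b f + mconst (\<beta> l) * C a (b + l) f"
    and no_p0: "\<And>a b. no_p0 (C a b 1)"
    and vev: "\<And>a b. coef (C a b 1) 0 = 0"
    and f: "no_p0 f"
  shows "C a b f = 0"
proof -
  have C0: "C a b 0 = 0" for a b using scale[of a b 0 0] by simp
  have C_sum: "C a b (sum h S) = (\<Sum>x\<in>S. C a b (h x))" for a b S and h :: "(nat \<Rightarrow>\<^sub>0 nat) \<Rightarrow> _"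
    by (induction S rule: infinite_finite_induct) (auto simp: add C0)
  have "coef (C a b 1) m = 0" for m a b
  proof (induction "weight m" arbitrary: m a b rule: less_induct)
    case less
    show ?case
    proof (cases "m = 0 \<or> coef m 0 \<noteq> 0")
      case True
      then show ?thesis using vev no_p0 by (metis in_keys_iff no_p0_def)
    next
      case False
      then obtain v where v: "coef m v \<noteq> 0" "v \<noteq> 0"
        by (metis poly_mapping_eqI lookup_zero)
      have w: "weight (m - expo v) < weight m"
        using weight_minus_single[OF v(1)] v(2) by linarith
      \<comment> \<open>The annihilator kills 1, so applying it to \<open>C a b 1\<close> gives
        members of the family at 1, whose coefficients in smaller weight vanish by induction. On the
        left it strips one p_v from the monomial \<open>m\<close>.\<close>
      have "bos (int v) (C a b 1) = mconst (\<alpha> (int v)) * C (a + int v) b 1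
          + mconst (\<beta> (int v)) * C a (b + int v) 1"
        using comm[of "int v" a b 1] v(2) by (simp add: bos_nonneg_1 C0)
      then have "coef (bos (int v) (C a b 1)) (m - expo v) = 0"
        by (simp add: lookup_add less[OF w] del: One_nat_def)
      then have "of_nat v * (of_nat (coef m v) * coef (C a b 1) m) = 0"
        using v expo_diff_add[OF v(1)] by (simp add: coef_bos lookup_minus del: of_nat_Suc)
      then show ?thesis using v by simp
    qed
  qed
  then have C1: "C a b 1 = 0" for a b by (intro poly_mapping_eqI) simp
  have single: "C a b (Poly_Mapping.single m c) = 0" if "coef m 0 = 0" for a b m c
    using that
  proof (induction "weight m" arbitrary: m a b rule: less_induct)
    case less
    show ?case
    proof (cases "m = 0")
      case True
      then show ?thesis using scale[of a b c 1] by (simp add: C1 mconst_def)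
    next
      case False
      then obtain v where v: "coef m v \<noteq> 0" "v \<noteq> 0"
        using less.prems by (metis poly_mapping_eqI lookup_zero)
      let ?g = "Poly_Mapping.single (m - expo v) c"
      have w: "weight (m - expo v) < weight m"
        using weight_minus_single[OF v(1)] v(2) by linarith
      have g: "C a b ?g = 0" for a b
        using less.prems by (intro less.hyps w) (simp add: lookup_minus)
      \<comment> \<open>A creation operator builds the monomial from a smaller one; commuted to the
        left of \<open>C\<close>, it leaves only members of the family at the smaller
        monomial.\<close>
      have "Poly_Mapping.single m c = bos (- int v) ?g"
        using v expo_diff_add[OF v(1)] by (simp add: bos_def mvar_def mult_single add.commute)
      moreover have "C a b (bos (- int v) ?g) = 0"
        using comm[of "- int v" a b ?g] v by (simp add: g del: One_nat_def)
      ultimately show ?thesis by simp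
    qed
  qed
  have "C a b f = (\<Sum>m\<in>Poly_Mapping.keys f. C a b (Poly_Mapping.single m (coef f m)))"
    by (subst poly_mapping_sum_singles[of f, symmetric]) (rule C_sum)
  also have "\<dots> = 0" using f by (intro sum.neutral) (auto simp: no_p0_def intro: single)
  finally show ?thesis .
qed

section \<open>Two-point functions of vertex operators\<close>

lemma of_nat_eq_mconst: "of_nat n = mconst (of_nat n)"
  by (simp add: mconst_def)

text \<open>The sum of j p_j d/dp_j multiplies a monomial by its weight; in weight \<open>a\<close>
  no variable beyond p_a occurs, so the sum may stop there.\<close>

lemma euler_homog:
  assumes g: "homog (int a) g" "no_p0 g"
  shows "(\<Sum>j=1..a. bos (- int j) (bos (int j) g)) = of_nat a * g"
proof (rule poly_mapping_eqI)
  fix m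
  have "coef (bos (- int j) (bos (int j) g)) m = of_nat (j * coef m j) * coef g m"
    if "j \<ge> 1" for j
  proof (cases "coef m j = 0")
    case False
    then show ?thesis using that expo_diff_add[OF False]
      by (simp add: coef_bos lookup_minus del: of_nat_Suc)
  qed (use that in \<open>simp add: coef_bos\<close>)
  then have "coef (\<Sum>j=1..a. bos (- int j) (bos (int j) g)) m
      = of_nat (\<Sum>j=1..a. j * coef m j) * coef g m"
    by (simp add: lookup_sum sum_distrib_right)
  also have "\<dots> = of_nat a * coef g m"
  proof (cases "m \<in> Poly_Mapping.keys g")
    case True
    then have wm: "weight m = a" and m0: "coef m 0 = 0" using g by (auto simp: homog_def no_p0_def)
    have "v \<le> a" if "v \<in> Poly_Mapping.keys m" for v
      using weight_minus_single[of m v] that wm by (auto simp: in_keys_iff)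
    moreover have "v \<ge> 1" if "v \<in> Poly_Mapping.keys m" for v
      using that m0 by (cases v) (auto simp: in_keys_iff)
    ultimately have "weight m = (\<Sum>j=1..a. j * coef m j)" by (intro weight_superset) auto
    with wm show ?thesis by simp
  qed (simp add: in_keys_iff)
  finally show "coef (\<Sum>j=1..a. bos (- int j) (bos (int j) g)) m = coef (of_nat a * g) m"
    by (simp add: of_nat_eq_mconst)
qed

text \<open>The algebraic substitute for the function e^{ju/2} of j: the hyperbolic identities among
  \<open>T j - T (- j)\<close> and \<open>T j + T (- j)\<close> follow from it over any
  ring.\<close>

definition exp_hom :: "(int \<Rightarrow> 'a::comm_ring_1) \<Rightarrow> bool" where
  "exp_hom T \<longleftrightarrow> T 0 = 1 \<and> (\<forall>i j. T (i + j) = T i * T j)"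

lemma exp_homD: "exp_hom T \<Longrightarrow> T 0 = 1" "exp_hom T \<Longrightarrow> T (i + j) = T i * T j"
  by (auto simp: exp_hom_def)

lemma exp_hom_inverse: "exp_hom T \<Longrightarrow> T i * T (- i) = 1"
  using exp_homD[of T] by (metis add.right_inverse)

text \<open>Both sides satisfy the same three-term recurrence in \<open>a\<close>.\<close>

lemma chebyshev_sum:
  fixes Q Y :: "int \<Rightarrow> 'a::comm_ring_1" and a :: nat
  assumes Q: "exp_hom Q" and Y: "exp_hom Y"
  defines "s \<equiv> \<lambda>j. Q j - Q (- j)" and "c \<equiv> \<lambda>j. Q j + Q (- j)" and "d \<equiv> \<lambda>j. Y j + Y (- j)"
  shows "(c 1 - d 1) * (s (int a) + (\<Sum>j=1..<a. d (int j) * s (int a - int j)))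
       = s 1 * (c (int a) - d (int a))"
proof -
  have rec: "s (k + 1) = c 1 * s k - s (k - 1)" "c (k + 1) = c 1 * c k - c (k - 1)" for k
    using exp_homD(2)[OF Q, of k 1] exp_homD(2)[OF Q, of k "-1"]
      exp_homD(2)[OF Q, of "- k" 1] exp_homD(2)[OF Q, of "- k" "-1"]
    by (simp_all add: s_def c_def algebra_simps)
  have recd: "d (k + 1) = d 1 * d k - d (k - 1)" for k
    using exp_homD(2)[OF Y, of k 1] exp_homD(2)[OF Y, of k "-1"]
      exp_homD(2)[OF Y, of "- k" 1] exp_homD(2)[OF Y, of "- k" "-1"]
    by (simp_all add: d_def algebra_simps)
  have s0: "s 0 = 0" and c0: "c 0 = d 0"
    by (simp_all add: s_def c_def d_def exp_homD(1)[OF Q] exp_homD(1)[OF Y])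
  define Z where "Z = (\<lambda>a::nat. \<Sum>j=1..<a. d (int j) * s (int a - int j))"
  have Zrec: "Z (Suc (Suc n)) = c 1 * Z (Suc n) - Z n + s 1 * d (int n + 1)" for n
  proof -
    have "Z (Suc (Suc n)) = (\<Sum>j=1..<Suc n. d (int j) * s (int (Suc (Suc n)) - int j)) + d (int n + 1) * s 1"
      by (simp add: Z_def algebra_simps)
    also have "(\<Sum>j=1..<Suc n. d (int j) * s (int (Suc (Suc n)) - int j))
       = (\<Sum>j=1..<Suc n. c 1 * (d (int j) * s (int (Suc n) - int j)) - d (int j) * s (int n - int j))"
    proof (rule sum.cong)
      fix j
      have "s (int (Suc (Suc n)) - int j) = c 1 * s (int (Suc n) - int j) - s (int n - int j)"
        using rec(1)[of "int (Suc n) - int j"] by (simp add: algebra_simps)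
      then show "d (int j) * s (int (Suc (Suc n)) - int j)
        = c 1 * (d (int j) * s (int (Suc n) - int j)) - d (int j) * s (int n - int j)"
        by (simp only:) (simp only: right_diff_distrib mult_ac)
    qed simp
    also have "\<dots> = c 1 * Z (Suc n) - (\<Sum>j=1..<Suc n. d (int j) * s (int n - int j))"
      by (simp only: sum_subtractf sum_distrib_left Z_def)
    \<comment> \<open>The extra term \<open>j = n\<close> vanishes because
      \<open>s 0 = 0\<close>.\<close>
    also have "(\<Sum>j=1..<Suc n. d (int j) * s (int n - int j)) = Z n"
      by (cases n) (simp_all add: Z_def s0)
    finally show ?thesis by (simp add: algebra_simps)
  qed
  \<comment> \<open>The recurrences have order two, so the induction carries two consecutive
    values.\<close>
  have "(c 1 - d 1) * (s (int a) + Z a) = s 1 * (c (int a) - d (int a)) \<and>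
        (c 1 - d 1) * (s (int (Suc a)) + Z (Suc a)) = s 1 * (c (int (Suc a)) - d (int (Suc a)))"
  proof (induction a)
    case 0
    then show ?case by (simp add: Z_def s0 c0 mult.commute)
  next
    case (Suc n)
    define k where "k = int n + 1"
    have ints: "int (Suc (Suc n)) = k + 1" "int (Suc n) = k" "int n = k - 1"
      by (simp_all add: k_def)
    have IH: "(c 1 - d 1) * (s (k - 1) + Z n) = s 1 * (c (k - 1) - d (k - 1))"
        "(c 1 - d 1) * (s k + Z (Suc n)) = s 1 * (c k - d k)"
      using Suc.IH by (simp_all add: ints[symmetric])
    have "(c 1 - d 1) * (s (k + 1) + Z (Suc (Suc n)))
        = c 1 * ((c 1 - d 1) * (s k + Z (Suc n))) - (c 1 - d 1) * (s (k - 1) + Z n)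
          + (c 1 - d 1) * (s 1 * d k)"
      by (simp only: rec(1)[of k] Zrec k_def[symmetric]) (simp add: algebra_simps)
    also have "\<dots> = s 1 * (c (k + 1) - d (k + 1))"
      by (simp only: IH rec(2)[of k] recd[of k]) (simp add: algebra_simps)
    finally show ?case using Suc.IH by (simp only: ints)
  qed
  then show ?thesis by (simp add: Z_def)
qed

text \<open>With T(j) = e^{ju/2} and S(j) = e^{jw/2} this is the two-point function of the
  numerators. Inserting the energy operator of \<open>euler_homog\<close> between the factors, and
  moving J_j to the right and J_{-j} to the left, yields a recurrence for \<open>F\<close>, which is
  solved by induction.\<close>

lemma vev_Gop_pair:
  fixes T S :: "int \<Rightarrow> 'a::{idom,semiring_char_0}"
  assumes w1: "exp_weight w1 T" "exp_hom T" and w2: "exp_weight w2 S" "exp_hom S" and "a > 0"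
  defines "F \<equiv> \<lambda>n. coef (Gop w1 (int n) (Gop w2 (- int n) 1)) 0"
  shows "(T 1 * S 1 - T (- 1) * S (- 1)) * F a
       = (T 1 - T (- 1)) * (S 1 - S (- 1)) * (T (int a) * S (int a) - T (- int a) * S (- int a))"
proof -
  define Q Y where "Q = (\<lambda>j. T j * S j)" and "Y = (\<lambda>j. T j * S (- j))"
  have Q: "exp_hom Q"
    using w1(2) w2(2) by (auto simp: exp_hom_def Q_def ac_simps)
  have Y: "exp_hom Y"
    unfolding exp_hom_def
  proof (intro conjI allI)
    fix i j
    show "Y (i + j) = Y i * Y j"
      using exp_homD(2)[OF w1(2), of i j] exp_homD(2)[OF w2(2), of "- i" "- j"]
      by (simp add: Y_def mult_ac)
  qed (use w1(2) w2(2) in \<open>simp add: Y_def exp_hom_def\<close>)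
  define s c d where "s = (\<lambda>j. Q j - Q (- j))" and "c = (\<lambda>j. Q j + Q (- j))"
    and "d = (\<lambda>j. Y j + Y (- j))"
  have cd: "(T j - T (- j)) * (S j - S (- j)) = c j - d j" for j
    by (simp add: c_def d_def Q_def Y_def algebra_simps)
  have F0: "F 0 = 1"
    using w1(1) w2(1) by (simp add: F_def exp_weight_def Gop_0_1)
  have Frec: "of_nat n * F n = (\<Sum>j=1..n. (c (int j) - d (int j)) * F (n - j))" for n
  proof -
    define g where "g = Gop w2 (- int n) 1"
    have "homog (int n) g" "no_p0 g"
      using Gop_homog[OF homog_1, of "- int n" w2] Gop_no_p0[OF no_p0_1] by (simp_all add: g_def)
    then have "of_nat n * g = (\<Sum>j=1..n. bos (- int j) (bos (int j) g))"
      by (rule euler_homog[symmetric])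
    also have "\<dots> = (\<Sum>j=1..n. mconst (S (int j) - S (- int j)) * bos (- int j) (Gop w2 (- int (n - j)) 1))"
    proof (rule sum.cong)
      fix j assume j: "j \<in> {1..n}"
      then have "bos (int j) g = mconst (S (int j) - S (- int j)) * Gop w2 (- int n + int j) 1"
        using bos_Gop[OF w2(1), of "int j" "- int n" 1] by (simp add: g_def bos_nonneg_1)
      moreover have "- int n + int j = - int (n - j)" using j by auto
      ultimately show "bos (- int j) (bos (int j) g)
          = mconst (S (int j) - S (- int j)) * bos (- int j) (Gop w2 (- int (n - j)) 1)"
        by (simp only: bos_mconst)
    qed simp
    finally have "coef (Gop w1 (int n) (of_nat n * g)) 0
        = (\<Sum>j=1..n. (S (int j) - S (- int j))
              * coef (Gop w1 (int n) (bos (- int j) (Gop w2 (- int (n - j)) 1))) 0)"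
      by (simp add: Gop_sum Gop_mconst lookup_sum)
    also have "\<dots> = (\<Sum>j=1..n. (c (int j) - d (int j)) * F (n - j))"
    proof (rule sum.cong)
      fix j assume j: "j \<in> {1..n}"
      then have jn: "- int j \<noteq> 0" by auto
      have "coef (bos (- int j) (Gop w1 (int n) h)) 0 = 0" for h
        using j by (simp add: coef_bos)
      moreover have "int n + - int j = int (n - j)" using j by auto
      ultimately have "0 = coef (Gop w1 (int n) (bos (- int j) (Gop w2 (- int (n - j)) 1))) 0
          + (T (- int j) - T (int j)) * F (n - j)"
        using arg_cong[OF bos_Gop[OF w1(1) jn, of "int n" "Gop w2 (- int (n - j)) 1"],
            of "\<lambda>g. coef g 0"] j
        by (simp only: F_def lookup_add coef_mconst_mult minus_minus)
      then have "coef (Gop w1 (int n) (bos (- int j) (Gop w2 (- int (n - j)) 1))) 0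
          = (T (int j) - T (- int j)) * F (n - j)"
        by (simp add: algebra_simps eq_neg_iff_add_eq_0)
      then show "(S (int j) - S (- int j))
              * coef (Gop w1 (int n) (bos (- int j) (Gop w2 (- int (n - j)) 1))) 0
          = (c (int j) - d (int j)) * F (n - j)"
        by (simp add: cd[symmetric] mult_ac)
    qed simp
    finally show ?thesis
      by (simp add: of_nat_eq_mconst Gop_mconst F_def g_def)
  qed
  have main: "s 1 * F n = (c 1 - d 1) * s (int n)" if "n > 0" for n
    using that
  proof (induction n rule: less_induct)
    case (less n)
    \<comment> \<open>The product-to-sum formula for hyperbolic cosine and sine.\<close>
    have cs: "c i * s (int n - i) = s (int n) + s (int n - 2 * i)" for i
      using exp_homD(2)[OF Q, of i "int n - i"] exp_homD(2)[OF Q, of i "i - int n"]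
        exp_homD(2)[OF Q, of "- i" "int n - i"] exp_homD(2)[OF Q, of "- i" "i - int n"]
      by (simp add: c_def s_def algebra_simps)
    \<comment> \<open>Replacing j by n - j changes the sign of every summand, and 2 can be
      cancelled.\<close>
    have sym: "(\<Sum>j=1..<n. s (int n - 2 * int j)) = 0"
    proof -
      have "(\<Sum>j=1..<n. s (int n - 2 * int j)) = (\<Sum>j=1..<n. s (int n - 2 * int (n - j)))"
        by (rule sum.reindex_bij_witness[of _ "\<lambda>j. n - j" "\<lambda>j. n - j"]) auto
      also have "\<dots> = (\<Sum>j=1..<n. - s (int n - 2 * int j))"
        by (rule sum.cong) (auto simp: s_def of_nat_diff)
      finally have "2 * (\<Sum>j=1..<n. s (int n - 2 * int j)) = 0"
        by (simp add: sum_negf)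
      then show ?thesis by (metis mult_eq_0_iff zero_neq_numeral)
    qed
    have "of_nat n * (s 1 * F n) = s 1 * (of_nat n * F n)" by (simp add: mult_ac)
    also have "\<dots> = (\<Sum>j=1..n. (c (int j) - d (int j)) * (s 1 * F (n - j)))"
      unfolding Frec sum_distrib_left by (rule sum.cong) (simp_all add: mult_ac)
    \<comment> \<open>\<open>F 0 = 1\<close> does not fit the formula being proved, so the term
      \<open>j = n\<close> is split off. By \<open>chebyshev_sum\<close> it then cancels the sum
      over \<open>d\<close> and supplies the missing copy of \<open>s (int n)\<close>.\<close>
    also have "\<dots> = (\<Sum>j=1..<n. (c (int j) - d (int j)) * (s 1 * F (n - j)))
         + (c (int n) - d (int n)) * s 1"
      using less.prems F0 by (simp add: sum.last_plus[of 1 n] ac_simps atLeastLessThanSuc_atLeastAtMost[symmetric])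
    also have "(\<Sum>j=1..<n. (c (int j) - d (int j)) * (s 1 * F (n - j)))
        = (\<Sum>j=1..<n. (c (int j) - d (int j)) * ((c 1 - d 1) * s (int n - int j)))"
      by (rule sum.cong) (auto simp: less.IH of_nat_diff)
    also have "\<dots> = (c 1 - d 1) * ((\<Sum>j=1..<n. c (int j) * s (int n - int j))
          - (\<Sum>j=1..<n. d (int j) * s (int n - int j)))"
      unfolding sum_subtractf[symmetric] sum_distrib_left
      by (rule sum.cong) (simp_all add: algebra_simps)
    also have "(\<Sum>j=1..<n. c (int j) * s (int n - int j)) = of_nat (n - 1) * s (int n)"
      by (simp only: cs sum.distrib sym) simp
    also have "(c (int n) - d (int n)) * s 1 = (c 1 - d 1) * (s (int n)
        + (\<Sum>j=1..<n. d (int j) * s (int n - int j)))"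
      using chebyshev_sum[OF Q Y, of n] by (simp add: s_def c_def d_def mult.commute)
    also have "(c 1 - d 1) * (of_nat (n - 1) * s (int n) - (\<Sum>j=1..<n. d (int j) * s (int n - int j)))
        + (c 1 - d 1) * (s (int n) + (\<Sum>j=1..<n. d (int j) * s (int n - int j)))
        = (c 1 - d 1) * ((of_nat (n - 1) + 1) * s (int n))"
      by (simp add: algebra_simps)
    also have "of_nat (n - 1) + 1 = (of_nat n :: 'a)"
      using less.prems by (cases n) auto
    finally have "of_nat n * (s 1 * F n) = of_nat n * ((c 1 - d 1) * s (int n))"
      by (simp add: mult_ac)
    then show ?case using less.prems by simp
  qed
  show ?thesis using main[of a] \<open>a > 0\<close> cd[of 1] by (simp add: s_def Q_def)
qed

text \<open>The scalar \<open>S a * T (- b) - S (- a) * T b\<close> specialises to varsigma(aw -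
  bu). Multiplied by the third operator it obeys the same shift rule under commutators with J_l as
  the products on the left, so \<open>operator_family_zero\<close> leaves only vacuum expectations
  to compare.\<close>

lemma Gop_commutator:
  fixes T S :: "int \<Rightarrow> 'a::{idom,semiring_char_0}"
  assumes w1: "exp_weight w1 T" "exp_hom T" and w2: "exp_weight w2 S" "exp_hom S"
    and w3: "exp_weight w3 (\<lambda>j. T j * S j)" and f: "no_p0 f"
  shows "mconst (T 1 * S 1 - T (- 1) * S (- 1)) * (Gop w1 a (Gop w2 b f) - Gop w2 b (Gop w1 a f))
       = mconst ((T 1 - T (- 1)) * (S 1 - S (- 1)) * (S a * T (- b) - S (- a) * T b)) * Gop w3 (a + b) f"
proof -
  define q where "q = T 1 * S 1 - T (- 1) * S (- 1)"
  define p where "p = (T 1 - T (- 1)) * (S 1 - S (- 1))"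
  define D where "D = (\<lambda>a b. S a * T (- b) - S (- a) * T b)"
  define C where "C = (\<lambda>a b f. mconst q * (Gop w1 a (Gop w2 b f) - Gop w2 b (Gop w1 a f))
      - mconst (p * D a b) * Gop w3 (a + b) f)"
  \<comment> \<open>An addition formula: it splits the shift of \<open>a + b\<close> by
    \<open>l\<close> into a shift of \<open>a\<close> and one of \<open>b\<close>.\<close>
  have D: "(T l * S l - T (- l) * S (- l)) * D a b
      = (T l - T (- l)) * D (a + l) b + (S l - S (- l)) * D a (b + l)" for a b l
    using exp_homD(2)[OF w1(2), of "- b" "- l"] exp_homD(2)[OF w1(2), of b l]
      exp_homD(2)[OF w2(2), of "- a" "- l"] exp_homD(2)[OF w2(2), of a l]
      exp_hom_inverse[OF w1(2), of l] exp_hom_inverse[OF w2(2), of l]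
    by (simp add: D_def algebra_simps)
  have "C a b f = 0"
  proof (rule operator_family_zero[where C = C and \<alpha> = "\<lambda>l. T l - T (- l)" and \<beta> = "\<lambda>l. S l - S (- l)"])
    fix a b l :: int and f :: "(nat, 'a) mpoly"
    assume l: "l \<noteq> 0"
    note [simp] = bos_Gop[OF w1(1) l] bos_Gop[OF w2(1) l] bos_Gop[OF w3 l]
    have bos_diff: "bos l (g - h) = bos l g - bos l h" for g h :: "(nat, 'a) mpoly"
      using bos_add[of l "g - h" h] by simp
    have 1: "bos l (Gop w1 a (Gop w2 b f)) = Gop w1 a (Gop w2 b (bos l f))
        + mconst (S l - S (- l)) * Gop w1 a (Gop w2 (b + l) f)
        + mconst (T l - T (- l)) * Gop w1 (a + l) (Gop w2 b f)"
      by (simp add: Gop_add Gop_mconst)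
    have 2: "bos l (Gop w2 b (Gop w1 a f)) = Gop w2 b (Gop w1 a (bos l f))
        + mconst (T l - T (- l)) * Gop w2 b (Gop w1 (a + l) f)
        + mconst (S l - S (- l)) * Gop w2 (b + l) (Gop w1 a f)"
      by (simp add: Gop_add Gop_mconst)
    have 3: "mconst (p * D a b) * bos l (Gop w3 (a + b) f)
        = mconst (p * D a b) * Gop w3 (a + b) (bos l f)
          + mconst (T l - T (- l)) * (mconst (p * D (a + l) b) * Gop w3 (a + b + l) f)
          + mconst (S l - S (- l)) * (mconst (p * D a (b + l)) * Gop w3 (a + b + l) f)"
    proof -
      have "mconst (p * D a b) * bos l (Gop w3 (a + b) f)
        = mconst (p * D a b) * Gop w3 (a + b) (bos l f)
          + mconst (p * ((T l * S l - T (- l) * S (- l)) * D a b)) * Gop w3 (a + b + l) f"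
        by (simp add: distrib_left mconst_mult mult_ac)
      then show ?thesis unfolding D
        by (simp add: mconst_mult mconst_add distrib_left distrib_right mult_ac)
    qed
    show "bos l (C a b f) = C a b (bos l f) + mconst (T l - T (- l)) * C (a + l) b f
        + mconst (S l - S (- l)) * C a (b + l) f"
      unfolding C_def bos_diff bos_mconst 1 2 3
      by (simp add: algebra_simps)
  next
    fix a b
    show "no_p0 (C a b 1)"
    proof -
      have diff: "no_p0 (g - h)" if "no_p0 g" "no_p0 h" for g h :: "(nat, 'a) mpoly"
        using that by (auto simp: no_p0_def in_keys_iff lookup_minus)
      then show ?thesis unfolding C_def by (intro diff no_p0_mconst Gop_no_p0 no_p0_1)
    qed
  next
    fix a b
    show "coef (C a b 1) 0 = 0"
    proof (cases "a + b = 0")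
      case False
      have e: "0 - b - a = - (a + b)" "0 - a - b = - (a + b)" "0 - (a + b) = - (a + b)"
        by simp_all
      have "homog (- (a + b)) (Gop w1 a (Gop w2 b 1))" "homog (- (a + b)) (Gop w2 b (Gop w1 a 1))"
        "homog (- (a + b)) (Gop w3 (a + b) 1)"
        using Gop_homog[OF Gop_homog[OF homog_1, where n = b and w = w2], where n = a and w = w1]
          Gop_homog[OF Gop_homog[OF homog_1, where n = a and w = w1], where n = b and w = w2]
          Gop_homog[OF homog_1, where n = "a + b" and w = w3] e
        by (simp_all only:)
      then show ?thesis using False by (simp add: C_def lookup_minus homog_coef_0[of "- (a + b)"])
    next
      case True
      have w30: "Gop w3 0 1 = 1" using w3 by (simp add: Gop_0_1 exp_weight_def)
      \<comment> \<open>For opposite nonzero energies one of the two products annihilates 1, and the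
        other is a two-point function.\<close>
      consider "a = 0" | "a > 0" | "a < 0" by linarith
      then show ?thesis
      proof cases
        case 1
        with True w1(1) w2(1) show ?thesis
          by (simp add: C_def lookup_minus Gop_0_1 exp_weight_def D_def mult.commute)
      next
        case 2
        have b: "b = - a" using True by simp
        have "coef (C a b 1) 0 = q * coef (Gop w1 a (Gop w2 b 1)) 0 - p * D a b"
          using 2 True by (simp add: C_def lookup_minus Gop_pos_1 w30)
        then show ?thesis using vev_Gop_pair[OF w1 w2, of "nat a"] 2
          by (simp add: b q_def p_def D_def algebra_simps)
      next
        case 3
        have a: "a = - b" using True by simp
        have "coef (C a b 1) 0 = - (q * coef (Gop w2 b (Gop w1 a 1)) 0) - p * D a b"
          using 3 True by (simp add: C_def lookup_minus Gop_pos_1 w30)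
        then show ?thesis using vev_Gop_pair[OF w2 w1, of "nat b"] 3
          by (simp add: a q_def p_def D_def algebra_simps)
      qed
    qed
  next
    fix a b f g
    show "C a b (f + g) = C a b f + C a b g"
      by (simp add: C_def Gop_add algebra_simps)
  next
    fix a b c f
    show "C a b (mconst c * f) = mconst c * C a b f"
      by (simp add: C_def Gop_mconst right_diff_distrib mult.left_commute)
  qed (rule f)
  then show ?thesis by (simp add: C_def q_def p_def D_def)
qed

section \<open>The completed cycles operators\<close>

text \<open>The substitutions of u, w and u + w enter as ring homomorphisms, which transport
  \<open>exp_weight\<close> and \<open>exp_hom\<close> to two-variable series.\<close>

definition rhom :: "('a::comm_ring_1 \<Rightarrow> 'b::comm_ring_1) \<Rightarrow> bool" where
  "rhom e \<longleftrightarrow> e 1 = 1 \<and> (\<forall>x y. e (x + y) = e x + e y) \<and> (\<forall>x y. e (x * y) = e x * e y)"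

lemma rhomD:
  assumes "rhom e"
  shows "e 1 = 1" "e (x + y) = e x + e y" "e (x * y) = e x * e y" "e 0 = 0" "e (- x) = - e x"
    "e (x - y) = e x - e y" "e (sum h S) = (\<Sum>s\<in>S. e (h s))" "e (of_nat n) = of_nat n"
    "e (of_int i) = of_int i"
proof -
  show 1: "e 1 = 1" "\<And>x y. e (x + y) = e x + e y" "\<And>x y. e (x * y) = e x * e y"
    using assms by (auto simp: rhom_def)
  show 0: "e 0 = 0" using 1(2)[of 0 0] by simp
  show m: "e (- x) = - e x" for x using 1(2)[of x "- x"] 0 by (simp add: eq_neg_iff_add_eq_0 add.commute)
  show "e (x - y) = e x - e y" using 1(2)[of x "- y"] m by simp
  show "e (sum h S) = (\<Sum>s\<in>S. e (h s))"
    by (induction S rule: infinite_finite_induct) (auto simp: 0 1)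
  show n: "e (of_nat n) = of_nat n" for n by (induction n) (auto simp: 0 1)
  show "e (of_int i) = of_int i" by (cases i rule: int_cases2) (auto simp: n m)
qed

lemma exp_weight_rhom:
  assumes "rhom e" "exp_weight w T"
  shows "exp_weight (\<lambda>js. e (w js)) (\<lambda>j. e (T j))"
  unfolding exp_weight_def
proof (intro conjI allI impI)
  show "e (w []) = 1" using assms by (simp add: exp_weight_def rhomD)
  fix l js assume "l \<noteq> (0::int)"
  then have "of_int l * (\<Sum>i\<le>length js. w (take i js @ - l # drop i js)) = (T l - T (- l)) * w js"
    using assms(2) by (auto simp: exp_weight_def)
  from arg_cong[OF this, of e]
  show "of_int l * (\<Sum>i\<le>length js. e (w (take i js @ - l # drop i js))) = (e (T l) - e (T (- l))) * e (w js)"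
    by (simp add: rhomD[OF assms(1)])
qed

lemma exp_hom_rhom: "rhom e \<Longrightarrow> exp_hom T \<Longrightarrow> exp_hom (\<lambda>j. e (T j))"
  by (simp add: exp_hom_def rhomD)

text \<open>The numerator of \<open>E_weight\<close>, that is, the weight of varsigma(u) E_n(u). It
  is a power series for every list, the empty one included.\<close>

definition wt :: "int list \<Rightarrow> complex fps" where
  "wt js = fps_const (1 / fact (length js)) * (\<Prod>j\<leftarrow>js. fps_const (1 / of_int j) * varsigma j)"

definition half_exp :: "int \<Rightarrow> complex fps" where
  "half_exp j = fps_exp (of_int j / 2)"

lemma varsigma_eq: "varsigma j = half_exp j - half_exp (- j)"
  by (simp add: varsigma_def half_exp_def)

lemma varsigma_uminus: "varsigma (- j) = - varsigma j"
  by (simp add: varsigma_eq)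

lemma exp_hom_half_exp: "exp_hom half_exp"
  by (simp add: exp_hom_def half_exp_def add_divide_distrib fps_exp_add_mult)

text \<open>The weight does not depend on the order of the entries, so all
  \<open>length js + 1\<close> insertions of \<open>- l\<close> contribute equally, and their number
  cancels against the factorial.\<close>

lemma exp_weight_wt: "exp_weight wt half_exp"
  unfolding exp_weight_def
proof (intro conjI allI impI)
  show "wt [] = 1" by (simp add: wt_def)
  fix l js assume l: "l \<noteq> (0::int)"
  let ?P = "\<lambda>js. (\<Prod>j\<leftarrow>js. fps_const (1 / of_int j :: complex) * varsigma j)"
  have ins: "wt (take i js @ - l # drop i js)
      = fps_const (1 / (fact (Suc (length js)) * of_int l)) * varsigma l * ?P js"
    if "i \<le> length js" for i
  proof -
    have "?P js = ?P (take i js @ drop i js)" by simp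
    then have "?P js = ?P (take i js) * ?P (drop i js)"
      by (simp only: map_append prod_list.append)
    then show ?thesis
      using that by (simp add: wt_def varsigma_uminus mult_ac fps_const_mult[symmetric]
          del: fps_const_mult fact_Suc)
        (simp add: fps_const_neg[symmetric] del: fps_const_neg fact_Suc)
  qed
  have "(\<Sum>i\<le>length js. wt (take i js @ - l # drop i js))
      = (\<Sum>i\<le>length js. fps_const (1 / (fact (Suc (length js)) * of_int l)) * varsigma l * ?P js)"
    by (intro sum.cong refl ins) simp
  also have "\<dots> = of_nat (Suc (length js))
       * (fps_const (1 / (fact (Suc (length js)) * of_int l)) * varsigma l * ?P js)"
    by simp
  finally have "of_int l * (\<Sum>i\<le>length js. wt (take i js @ - l # drop i js))
      = fps_const (of_int l * (of_nat (Suc (length js)) * (1 / (fact (Suc (length js)) * of_int l))))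
         * varsigma l * ?P js"
    by (simp add: fps_of_nat[symmetric] fps_of_int[symmetric] mult.assoc[symmetric] del: of_nat_Suc fact_Suc)
  also have "of_int l * (of_nat (Suc (length js)) * (1 / (fact (Suc (length js)) * of_int l)))
      = (1 / fact (length js) :: complex)"
    using l by (simp add: field_simps del: of_nat_Suc)
  finally show "of_int l * (\<Sum>i\<le>length js. wt (take i js @ - l # drop i js))
      = (half_exp l - half_exp (- l)) * wt js"
    by (simp add: wt_def varsigma_eq mult_ac)
qed

section \<open>Division by the series varsigma(u)\<close>

lemma varsigma_nth_0 [simp]: "fps_nth (varsigma j) 0 = 0"
  and varsigma_nth_1: "fps_nth (varsigma j) (Suc 0) = of_int j"
  by (simp_all add: varsigma_def field_simps)

text \<open>The power series 2 sinh(u/2)/u, the unit part of varsigma(u).\<close>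

definition sinhc :: "complex fps" where
  "sinhc = fps_shift 1 (varsigma 1)"

lemma varsigma_1_eq: "varsigma 1 = fps_X * sinhc"
  by (rule fps_ext) (simp add: sinhc_def)

lemma sinhc_nth_0 [simp]: "fps_nth sinhc 0 = 1"
  by (simp add: sinhc_def varsigma_nth_1)

lemma varsigma_1_nonzero: "varsigma 1 \<noteq> 0"
  using varsigma_nth_1[of 1] by (metis fps_zero_nth of_int_1 zero_neq_one)

text \<open>The quotient by varsigma(u) within power series; it is the true quotient when the
  constant term of \<open>P\<close> vanishes.\<close>

definition div_varsigma :: "complex fps \<Rightarrow> complex fps" where
  "div_varsigma P = fps_shift 1 (P * inverse sinhc)"

lemma div_varsigma:
  assumes "fps_nth P 0 = 0"
  shows "varsigma 1 * div_varsigma P = P"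
proof -
  have "fps_X * div_varsigma P = P * inverse sinhc"
    unfolding div_varsigma_def using assms by (intro fps_ext) simp
  then have "varsigma 1 * div_varsigma P = sinhc * (P * inverse sinhc)"
    by (metis mult.assoc mult.commute varsigma_1_eq)
  then show ?thesis by (simp add: mult.left_commute inverse_mult_eq_1')
qed

text \<open>On nonempty lists this is \<open>E_weight\<close> as a power series. A list with nonzero
  sum is nonempty, so E_n(u) has no pole for nonzero n.\<close>

definition wq :: "int list \<Rightarrow> complex fps" where
  "wq js = div_varsigma (wt js)"

lemma wt_nth_0: "js \<noteq> [] \<Longrightarrow> fps_nth (wt js) 0 = 0"
  by (cases js) (simp_all add: wt_def)

lemma wt_eq: "js \<noteq> [] \<Longrightarrow> wt js = varsigma 1 * wq js"
  by (simp add: wq_def div_varsigma wt_nth_0)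

lemma E_weight_eq: "js \<noteq> [] \<Longrightarrow> E_weight js = fps_to_fls (wq js)"
proof -
  assume "js \<noteq> []"
  then have "E_weight js = fps_to_fls (varsigma 1 * wq js) / fps_to_fls (varsigma 1)"
    by (simp add: E_weight_def wt_def flip: wt_eq)
  then show ?thesis using varsigma_1_nonzero by (simp add: fls_times_fps_to_fls)
qed

lemma E_coeff_eq_Gop: "E_coeff n m = Gop (\<lambda>js. fls_nth (E_weight js) m) n"
  unfolding E_coeff_def[abs_def] Gop_def[abs_def] normal_ordered_eq_NO ..

lemma E_coeff_eq_Gop_wq:
  assumes "n \<noteq> 0"
  shows "E_coeff n (int m) f = Gop (\<lambda>js. fps_nth (wq js) m) n f"
  unfolding E_coeff_eq_Gop
proof (rule Gop_cong)
  fix js assume "js \<in> E_indices n"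
  with assms have "js \<noteq> []" by (auto simp: E_indices_def)
  then show "fls_nth (E_weight js) (int m) = fps_nth (wq js) m"
    by (simp add: E_weight_eq)
qed

text \<open>Every factor varsigma(ju) vanishes at u = 0, so after division by varsigma(u) a list of
  length N contributes from u^(N-1) on. At u^0 only the one-element list survives.\<close>

lemma E_coeff_0_eq_bos:
  assumes "a \<noteq> 0"
  shows "E_coeff a 0 f = bos a f"
proof -
  have nth1: "fps_nth (wq js) 0 = (if js = [a] then 1 else 0)" if "js \<in> E_indices a" for js
  proof -
    from that assms have ne: "js \<noteq> []" by (auto simp: E_indices_def)
    have "fps_nth (wq js) 0 = fps_nth (wt js) 1"
      using wt_nth_0[OF ne] by (simp add: wq_def div_varsigma_def fps_mult_nth_1)
    also have "\<dots> = (if js = [a] then 1 else 0)"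
    proof (cases "tl js")
      case Nil
      then obtain j where "js = [j]" using ne by (cases js) auto
      with that have "js = [a]" by (simp add: E_indices_def)
      then show ?thesis using assms by (simp add: wt_def varsigma_nth_1)
    next
      case (Cons i r)
      then obtain j where "js = j # i # r" using ne by (cases js) auto
      then show ?thesis by (simp add: wt_def fps_mult_nth_1)
    qed
    finally show ?thesis .
  qed
  have "E_coeff a 0 f = Gop (\<lambda>js. fps_nth (wq js) 0) a f"
    using E_coeff_eq_Gop_wq[OF assms, of 0] by simp
  also have "\<dots> = Sum_any (\<lambda>js. if js = [a] then bos a f else 0)"
    unfolding Gop_def using assms
    by (intro Sum_any.cong) (auto simp: nth1 E_indices_def)
  also have "\<dots> = (\<Sum>js\<in>{[a]}. if js = [a] then bos a f else 0)"
    by (rule Sum_any.expand_superset) auto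
  finally show ?thesis by simp
qed

lemma E_coeff_add: "E_coeff n m (f + g) = E_coeff n m f + E_coeff n m g"
  and E_coeff_mconst: "E_coeff n m (mconst c * f) = mconst c * E_coeff n m f"
  and E_coeff_zero [simp]: "E_coeff n m 0 = 0"
  and E_coeff_homog: "homog d f \<Longrightarrow> homog (d - n) (E_coeff n m f)"
  and E_coeff_no_p0: "no_p0 f \<Longrightarrow> no_p0 (E_coeff n m f)"
  by (simp_all add: E_coeff_eq_Gop Gop_add Gop_mconst Gop_homog Gop_no_p0)

text \<open>In \<open>complex fps fps\<close> the outer variable is $w$ and the inner one is $u$. The embeddings
  \<open>fps_const\<close>, \<open>fps_outer\<close> and \<open>fps_plus\<close> send a series in $x$ to its values at $u$, $w$ and
  $u + w$.\<close>

definition fps_outer :: "complex fps \<Rightarrow> complex fps fps" where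
  "fps_outer A = Abs_fps (\<lambda>j. fps_const (fps_nth A j))"

definition fps_plus :: "complex fps \<Rightarrow> complex fps fps" where
  "fps_plus A = Abs_fps (\<lambda>j. Abs_fps (\<lambda>i. of_nat ((i + j) choose i) * fps_nth A (i + j)))"

section \<open>Substitutions into two-variable series\<close>

lemma rhom_fps_const: "rhom fps_const"
  by (simp add: rhom_def)

lemma rhom_fps_outer: "rhom fps_outer"
  unfolding rhom_def
proof (intro conjI allI)
  show "fps_outer 1 = 1" by (rule fps_ext) (simp add: fps_outer_def)
  fix A B
  show "fps_outer (A + B) = fps_outer A + fps_outer B"
    by (rule fps_ext) (simp add: fps_outer_def)
  show "fps_outer (A * B) = fps_outer A * fps_outer B"
  proof (rule fps_ext)
    fix n
    have "fps_const (\<Sum>i=0..n. fps_nth A i * fps_nth B (n - i))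
        = (\<Sum>i=0..n. fps_const (fps_nth A i * fps_nth B (n - i)))"
      by (rule rhomD(7)) (rule rhom_fps_const)
    then show "fps_nth (fps_outer (A * B)) n = fps_nth (fps_outer A * fps_outer B) n"
      by (simp add: fps_outer_def fps_mult_nth)
  qed
qed

lemma nth_nth_mult:
  "fps_nth (fps_nth (X * Y) m') m
     = (\<Sum>j\<le>m'. \<Sum>i\<le>m. fps_nth (fps_nth X j) i * fps_nth (fps_nth Y (m' - j)) (m - i))"
  by (simp add: fps_mult_nth fps_sum_nth atLeast0AtMost)

text \<open>Multiplicativity of the substitution u + w is Vandermonde's convolution, applied for
  each fixed index \<open>t\<close> of a coefficient of the first factor.\<close>

lemma rhom_fps_plus: "rhom fps_plus"
  unfolding rhom_def
proof (intro conjI allI)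
  show "fps_plus 1 = 1" by (intro fps_ext) (simp add: fps_plus_def fps_one_nth)
  fix A B
  show "fps_plus (A + B) = fps_plus A + fps_plus B"
    by (intro fps_ext) (simp add: fps_plus_def distrib_left)
  show "fps_plus (A * B) = fps_plus A * fps_plus B"
  proof (intro fps_ext)
    fix m' m
    let ?M = "m + m' :: nat"
    define h :: "nat \<Rightarrow> nat \<Rightarrow> complex" where
      "h = (\<lambda>t i. of_nat (t choose i) * of_nat ((?M - t) choose (m - i)) * (fps_nth A t * fps_nth B (?M - t)))"
    have "fps_nth (fps_nth (fps_plus A * fps_plus B) m') m = (\<Sum>j\<le>m'. \<Sum>i\<le>m. h (i + j) i)"
      unfolding nth_nth_mult
    proof (intro sum.cong refl)
      fix j i assume "j \<in> {..m'}" "i \<in> {..m}"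
      then have "m - i + (m' - j) = ?M - (i + j)" by auto
      then show "fps_nth (fps_nth (fps_plus A) j) i * fps_nth (fps_nth (fps_plus B) (m' - j)) (m - i)
          = h (i + j) i"
        by (simp add: fps_plus_def h_def)
    qed
    also have "\<dots> = (\<Sum>(j, i)\<in>{..m'} \<times> {..m}. h (i + j) i)"
      by (rule sum.cartesian_product)
    also have "\<dots> = (\<Sum>(t, i)\<in>{(t, i). t \<le> ?M \<and> i \<le> m \<and> i \<le> t \<and> t - i \<le> m'}. h t i)"
      by (rule sum.reindex_bij_witness[of _ "\<lambda>(t, i). (t - i, i)" "\<lambda>(j, i). (i + j, i)"]) auto
    \<comment> \<open>In every added term one of the two binomial coefficients vanishes.\<close>
    also have "\<dots> = (\<Sum>(t, i)\<in>{..?M} \<times> {..m}. h t i)"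
      by (rule sum.mono_neutral_left) (auto simp: h_def)
    also have "\<dots> = (\<Sum>t\<le>?M. \<Sum>i\<le>m. h t i)"
      by (rule sum.cartesian_product[symmetric])
    also have "\<dots> = (\<Sum>t\<le>?M. of_nat (?M choose m) * (fps_nth A t * fps_nth B (?M - t)))"
    proof (rule sum.cong)
      fix t assume "t \<in> {..?M}"
      then have "(\<Sum>i\<le>m. (t choose i) * ((?M - t) choose (m - i))) = ?M choose m"
        using vandermonde[of t "?M - t" m] by simp
      then have "(\<Sum>i\<le>m. of_nat (t choose i) * of_nat ((?M - t) choose (m - i))) = (of_nat (?M choose m) :: complex)"
        by (metis (no_types, lifting) of_nat_mult of_nat_sum sum.cong)
      then show "(\<Sum>i\<le>m. h t i) = of_nat (?M choose m) * (fps_nth A t * fps_nth B (?M - t))"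
        by (simp add: h_def flip: sum_distrib_right)
    qed simp
    finally show "fps_nth (fps_nth (fps_plus (A * B)) m') m = fps_nth (fps_nth (fps_plus A * fps_plus B) m') m"
      by (simp add: fps_plus_def fps_mult_nth atLeast0AtMost sum_distrib_left)
  qed
qed

lemma fps_plus_exp: "fps_plus (fps_exp c) = fps_const (fps_exp c) * fps_outer (fps_exp c)"
proof (intro fps_ext)
  fix j i
  have "of_nat ((i + j) choose i) = (fact (i + j) / (fact i * fact j) :: complex)"
    using binomial_fact[of i "i + j", where ?'a = complex] by simp
  then show "fps_nth (fps_nth (fps_plus (fps_exp c)) j) i
      = fps_nth (fps_nth (fps_const (fps_exp c) * fps_outer (fps_exp c)) j) i"
    by (simp add: fps_plus_def fps_outer_def power_add)
qed

definition const2 :: "complex \<Rightarrow> complex fps fps" where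
  "const2 c = fps_const (fps_const c)"

lemma rhom_const2: "rhom const2"
  by (simp add: rhom_def const2_def)

text \<open>Extension of scalars, so that operators with two-variable weights can act on an ordinary
  Fock space element.\<close>

definition fock_lift :: "fock \<Rightarrow> (nat, complex fps fps) mpoly" where
  "fock_lift f = Poly_Mapping.map const2 f"

lemma coef_fock_lift [simp]: "coef (fock_lift f) m = const2 (coef f m)"
  by (simp add: fock_lift_def Poly_Mapping.map.rep_eq when_def rhomD(4)[OF rhom_const2])

lemma bos_fock_lift: "bos j (fock_lift f) = fock_lift (bos j f)"
  by (rule poly_mapping_eqI) (simp add: coef_bos rhomD[OF rhom_const2] del: of_nat_Suc)

lemma NO_fock_lift: "NO js (fock_lift f) = fock_lift (NO js f)"
  by (induction js arbitrary: f) (auto simp: bos_fock_lift)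

lemma fock_lift_1: "fock_lift 1 = 1"
  by (rule poly_mapping_eqI) (simp add: lookup_one when_def rhomD[OF rhom_const2])

lemma no_p0_fock_lift: "no_p0 f \<Longrightarrow> no_p0 (fock_lift f)"
  by (auto simp: no_p0_def in_keys_iff rhomD(4)[OF rhom_const2])

lemma Gop_fock_lift_bound:
  "\<exists>L. finite L \<and> (\<forall>w. Gop w n (fock_lift f) = (\<Sum>js\<in>L. mconst (w js) * fock_lift (NO js f)))
     \<and> (\<forall>w. Gop w n f = (\<Sum>js\<in>L. mconst (w js) * NO js f))"
proof -
  obtain B1 where B1: "\<forall>B\<ge>B1. \<forall>w. Gop w n f = (\<Sum>js\<in>E_lists n B. mconst (w js) * NO js f)"
    using Gop_bound[of n f] ..
  obtain B2 where B2: "\<forall>B\<ge>B2. \<forall>w. Gop w n (fock_lift f)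
      = (\<Sum>js\<in>E_lists n B. mconst (w js) * NO js (fock_lift f))"
    using Gop_bound[of n "fock_lift f"] ..
  show ?thesis
    using B1[rule_format, of "max B1 B2"] B2[rule_format, of "max B1 B2"]
    by (intro exI[of _ "E_lists n (max B1 B2)"]) (simp add: NO_fock_lift)
qed

text \<open>Coefficient extraction passes through both operators by linearity. \<open>ext\<close>
  states which coefficients of the one-variable weights are selected by \<open>p\<close> and
  \<open>q\<close>, so that the lemma covers both assignments of u and w to the two factors.\<close>

lemma extract_product:
  fixes e e' :: "complex fps \<Rightarrow> complex fps fps"
  assumes ext: "\<And>A B c. fps_nth (fps_nth (e' B * (e A * const2 c)) p) q = fps_nth B m' * (fps_nth A m * c)"
    and ab: "a \<noteq> 0" "b \<noteq> 0"
  shows "fps_nth (fps_nth (coef (Gop (\<lambda>js. e (wq js)) a (Gop (\<lambda>js. e' (wq js)) b (fock_lift f))) x) p) q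
       = coef (E_coeff a (int m) (E_coeff b (int m') f)) x"
proof -
  obtain L where L: "finite L"
    "\<And>w. Gop w b (fock_lift f) = (\<Sum>js\<in>L. mconst (w js) * fock_lift (NO js f))"
    "\<And>w. Gop w b f = (\<Sum>js\<in>L. mconst (w js) * NO js f)"
    using Gop_fock_lift_bound[of b f] by blast
  have "\<forall>js. \<exists>M. finite M \<and>
      (\<forall>w. Gop w a (fock_lift (NO js f)) = (\<Sum>is\<in>M. mconst (w is) * fock_lift (NO is (NO js f)))) \<and>
      (\<forall>w. Gop w a (NO js f) = (\<Sum>is\<in>M. mconst (w is) * NO is (NO js f)))"
    using Gop_fock_lift_bound by blast
  from choice[OF this] obtain M where M: "\<And>js. finite (M js)"
    "\<And>js w. Gop w a (fock_lift (NO js f)) = (\<Sum>is\<in>M js. mconst (w is) * fock_lift (NO is (NO js f)))"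
    "\<And>js w. Gop w a (NO js f) = (\<Sum>is\<in>M js. mconst (w is) * NO is (NO js f))"
    by blast
  have "fps_nth (fps_nth (coef (Gop (\<lambda>js. e (wq js)) a (Gop (\<lambda>js. e' (wq js)) b (fock_lift f))) x) p) q
     = (\<Sum>js\<in>L. \<Sum>is\<in>M js. fps_nth (wq js) m' * (fps_nth (wq is) m * coef (NO is (NO js f)) x))"
    by (simp add: L(2) M(2) Gop_sum Gop_mconst lookup_sum sum_distrib_left fps_sum_nth ext)
  also have "\<dots> = coef (E_coeff a (int m) (E_coeff b (int m') f)) x"
    by (simp add: E_coeff_eq_Gop_wq ab L(3) M(3) Gop_sum Gop_mconst lookup_sum sum_distrib_left)
  finally show ?thesis .
qed

lemma Gop_wt_eq:
  assumes "rhom e" "n \<noteq> 0"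
  shows "Gop (\<lambda>js. e (wt js)) n f = mconst (e (varsigma 1)) * Gop (\<lambda>js. e (wq js)) n f"
proof -
  have "e (wt js) = e (varsigma 1) * e (wq js)" if "js \<in> E_indices n" for js
  proof -
    have "js \<noteq> []" using that assms(2) by (auto simp: E_indices_def)
    then show ?thesis by (simp add: wt_eq rhomD(3)[OF assms(1)])
  qed
  then have "Gop (\<lambda>js. e (wt js)) n f = Gop (\<lambda>js. e (varsigma 1) * e (wq js)) n f"
    by (rule Gop_cong)
  then show ?thesis by (simp add: Gop_scale)
qed

lemma fps_const_varsigma_nonzero: "fps_const (varsigma 1) \<noteq> 0"
  by (simp add: varsigma_1_nonzero)

lemma fps_outer_varsigma_nonzero: "fps_outer (varsigma 1) \<noteq> 0"
proof
  assume "fps_outer (varsigma 1) = 0"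
  then have "fps_nth (fps_nth (fps_outer (varsigma 1)) (Suc 0)) 0 = 0" by simp
  then show False by (simp add: fps_outer_def varsigma_nth_1)
qed

lemma fps_plus_varsigma_nonzero: "fps_plus (varsigma 1) \<noteq> 0"
proof
  assume "fps_plus (varsigma 1) = 0"
  then have "fps_nth (fps_nth (fps_plus (varsigma 1)) (Suc 0)) 0 = 0" by simp
  then show False by (simp add: fps_plus_def varsigma_nth_1)
qed

lemma fps_plus_half_exp: "fps_plus (half_exp j) = fps_const (half_exp j) * fps_outer (half_exp j)"
  by (simp add: half_exp_def fps_plus_exp)

text \<open>The coefficient of $u^i w^j$ in $\varsigma(aw - bu)$.\<close>

definition kappa :: "complex \<Rightarrow> complex \<Rightarrow> nat \<Rightarrow> nat \<Rightarrow> complex" where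
  "kappa a b i j = ((a / 2) ^ j * (- b / 2) ^ i - (- a / 2) ^ j * (b / 2) ^ i) / (fact i * fact j)"

text \<open>The nonzero indices exclude the empty list, the source of the pole of E_0, from all
  three operators; hence \<open>wt\<close> can be replaced by varsigma times \<open>wq\<close>
  throughout.\<close>

lemma E_commutator:
  assumes ab: "a \<noteq> 0" "b \<noteq> 0" "a + b \<noteq> 0" and f: "no_p0 f"
  shows "E_coeff a (int m) (E_coeff b (int m') f) = E_coeff b (int m') (E_coeff a (int m) f)
     + (\<Sum>i\<le>m. \<Sum>j\<le>m'. mconst (kappa (of_int a) (of_int b) i j
            * of_nat ((m - i + (m' - j)) choose (m - i))) * E_coeff (a + b) (int (m - i + (m' - j))) f)"
proof -
  define D where "D = fps_outer (half_exp a) * fps_const (half_exp (- b))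
      - fps_outer (half_exp (- a)) * fps_const (half_exp b)"
  define G1 where "G1 = Gop (\<lambda>js. fps_const (wq js))"
  define G2 where "G2 = Gop (\<lambda>js. fps_outer (wq js))"
  define G3 where "G3 = Gop (\<lambda>js. fps_plus (wq js))"
  let ?F = "fock_lift f"
  let ?c1 = "fps_const (varsigma 1)" and ?c2 = "fps_outer (varsigma 1)" and ?c3 = "fps_plus (varsigma 1)"
  have c: "?c1 = fps_const (half_exp 1) - fps_const (half_exp (- 1))"
      "?c2 = fps_outer (half_exp 1) - fps_outer (half_exp (- 1))"
      "?c3 = fps_const (half_exp 1) * fps_outer (half_exp 1)
        - fps_const (half_exp (- 1)) * fps_outer (half_exp (- 1))"
    by (simp_all only: varsigma_eq rhomD(6)[OF rhom_fps_const] rhomD(6)[OF rhom_fps_outer]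
        rhomD(6)[OF rhom_fps_plus] fps_plus_half_exp)
  have w3: "exp_weight (\<lambda>js. fps_plus (wt js)) (\<lambda>j. fps_const (half_exp j) * fps_outer (half_exp j))"
    using exp_weight_rhom[OF rhom_fps_plus exp_weight_wt] by (simp only: fps_plus_half_exp)
  note gw = Gop_wt_eq[OF rhom_fps_const] Gop_wt_eq[OF rhom_fps_outer] Gop_wt_eq[OF rhom_fps_plus]
  \<comment> \<open>Both sides carry the same scalar. On the left varsigma(u + w) stems from
    \<open>Gop_commutator\<close> and the other two factors from the passage from \<open>wt\<close>
    to \<open>wq\<close>; on the right the origins are exchanged.\<close>
  have "mconst ?c3 * (mconst (?c1 * ?c2) * (G1 a (G2 b ?F) - G2 b (G1 a ?F)))
      = mconst (?c1 * ?c2 * D) * (mconst ?c3 * G3 (a + b) ?F)"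
    using Gop_commutator[OF exp_weight_rhom[OF rhom_fps_const exp_weight_wt]
        exp_hom_rhom[OF rhom_fps_const exp_hom_half_exp]
        exp_weight_rhom[OF rhom_fps_outer exp_weight_wt]
        exp_hom_rhom[OF rhom_fps_outer exp_hom_half_exp] w3 no_p0_fock_lift[OF f], of a b]
    unfolding c[symmetric] D_def[symmetric]
    by (simp add: gw ab G1_def G2_def G3_def Gop_mconst mconst_mult right_diff_distrib mult_ac)
  then have "?c3 * (?c1 * ?c2 * coef (G1 a (G2 b ?F) - G2 b (G1 a ?F)) x)
      = ?c1 * ?c2 * D * (?c3 * coef (G3 (a + b) ?F) x)" for x
    by (metis coef_mconst_mult)
  then have "(?c3 * (?c1 * ?c2)) * coef (G1 a (G2 b ?F) - G2 b (G1 a ?F)) x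
      = (?c3 * (?c1 * ?c2)) * (D * coef (G3 (a + b) ?F) x)" for x
    by (simp add: mult_ac)
  then have eq: "coef (G1 a (G2 b ?F)) x - coef (G2 b (G1 a ?F)) x = D * coef (G3 (a + b) ?F) x" for x
    using fps_const_varsigma_nonzero fps_outer_varsigma_nonzero fps_plus_varsigma_nonzero
    by (metis lookup_minus mult_cancel_left mult_eq_0_iff)
  have D_nth: "fps_nth (fps_nth D j) i = kappa (of_int a) (of_int b) i j" for i j
    by (simp add: D_def fps_outer_def half_exp_def kappa_def diff_divide_distrib mult_ac)
  obtain L where L: "finite L"
    "\<And>w. Gop w (a + b) ?F = (\<Sum>js\<in>L. mconst (w js) * fock_lift (NO js f))"
    "\<And>w. Gop w (a + b) f = (\<Sum>js\<in>L. mconst (w js) * NO js f)"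
    using Gop_fock_lift_bound[of "a + b" f] by blast
  have G3_nth: "fps_nth (fps_nth (coef (G3 (a + b) ?F) x) j) i
      = of_nat ((i + j) choose i) * coef (E_coeff (a + b) (int (i + j)) f) x" for x i j
    by (simp only: E_coeff_eq_Gop_wq[OF ab(3)] L(3) G3_def L(2))
       (simp add: lookup_sum fps_sum_nth const2_def fps_plus_def sum_distrib_left mult_ac)
  have 1: "fps_nth (fps_nth (coef (G1 a (G2 b ?F)) x) m') m
      = coef (E_coeff a (int m) (E_coeff b (int m') f)) x" for x
    unfolding G1_def G2_def by (rule extract_product) (simp_all add: ab fps_outer_def const2_def)
  have 2: "fps_nth (fps_nth (coef (G2 b (G1 a ?F)) x) m') m
      = coef (E_coeff b (int m') (E_coeff a (int m) f)) x" for x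
    unfolding G1_def G2_def by (rule extract_product) (simp_all add: ab fps_outer_def const2_def)
  show ?thesis
  proof (rule poly_mapping_eqI)
    fix x
    have "coef (E_coeff a (int m) (E_coeff b (int m') f)) x - coef (E_coeff b (int m') (E_coeff a (int m) f)) x
        = fps_nth (fps_nth (D * coef (G3 (a + b) ?F) x) m') m"
      by (simp only: 1[symmetric] 2[symmetric] eq[symmetric] fps_sub_nth)
    also have "\<dots> = (\<Sum>j\<le>m'. \<Sum>i\<le>m. kappa (of_int a) (of_int b) i j
            * (of_nat ((m - i + (m' - j)) choose (m - i)) * coef (E_coeff (a + b) (int (m - i + (m' - j))) f) x))"
      by (simp only: nth_nth_mult D_nth G3_nth)
    also have "\<dots> = coef (\<Sum>i\<le>m. \<Sum>j\<le>m'. mconst (kappa (of_int a) (of_int b) i j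
            * of_nat ((m - i + (m' - j)) choose (m - i))) * E_coeff (a + b) (int (m - i + (m' - j))) f) x"
      by (subst sum.swap) (simp add: lookup_sum mult.assoc)
    finally show "coef (E_coeff a (int m) (E_coeff b (int m') f)) x
      = coef (E_coeff b (int m') (E_coeff a (int m) f) + (\<Sum>i\<le>m. \<Sum>j\<le>m'. mconst (kappa (of_int a) (of_int b) i j
            * of_nat ((m - i + (m' - j)) choose (m - i))) * E_coeff (a + b) (int (m - i + (m' - j))) f)) x"
      by (simp add: lookup_add algebra_simps)
  qed
qed

text \<open>The coefficient of $u^m w^{m'}$ in $\varsigma(a(u+w))/\varsigma(u+w)$.\<close>

lemma E_pair:
  assumes "a > 0"
  shows "coef (E_coeff a (int m) (E_coeff (- a) (int m') 1)) 0
    = of_nat ((m + m') choose m) * fps_nth (div_varsigma (varsigma a)) (m + m')"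
proof -
  define Y where "Y = coef (Gop (\<lambda>js. fps_const (wq js)) a
      (Gop (\<lambda>js. fps_outer (wq js)) (- a) (fock_lift 1))) 0"
  let ?c1 = "fps_const (varsigma 1)" and ?c2 = "fps_outer (varsigma 1)" and ?c3 = "fps_plus (varsigma 1)"
  have c: "?c1 = fps_const (half_exp 1) - fps_const (half_exp (- 1))"
      "?c2 = fps_outer (half_exp 1) - fps_outer (half_exp (- 1))"
    by (simp_all only: varsigma_eq rhomD(6)[OF rhom_fps_const] rhomD(6)[OF rhom_fps_outer])
  have c3: "fps_plus (varsigma l) = fps_const (half_exp l) * fps_outer (half_exp l)
        - fps_const (half_exp (- l)) * fps_outer (half_exp (- l))" for l
    by (simp only: varsigma_eq rhomD(6)[OF rhom_fps_plus] fps_plus_half_exp)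
  have "?c3 * (?c1 * ?c2 * Y) = ?c1 * ?c2 * fps_plus (varsigma a)"
    using vev_Gop_pair[OF exp_weight_rhom[OF rhom_fps_const exp_weight_wt]
        exp_hom_rhom[OF rhom_fps_const exp_hom_half_exp]
        exp_weight_rhom[OF rhom_fps_outer exp_weight_wt]
        exp_hom_rhom[OF rhom_fps_outer exp_hom_half_exp], of "nat a"] assms
    unfolding c[symmetric] Y_def fock_lift_1
    by (simp add: Gop_wt_eq[OF rhom_fps_const] Gop_wt_eq[OF rhom_fps_outer] Gop_mconst c3 mult_ac)
  \<comment> \<open>The division takes place in one variable, before u + w is substituted; it is
    exact because varsigma(au) has no constant term.\<close>
  also have "fps_plus (varsigma a) = ?c3 * fps_plus (div_varsigma (varsigma a))"
    by (simp add: div_varsigma flip: rhomD(3)[OF rhom_fps_plus])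
  finally have "(?c3 * (?c1 * ?c2)) * Y = (?c3 * (?c1 * ?c2)) * fps_plus (div_varsigma (varsigma a))"
    by (simp add: mult_ac)
  then have "Y = fps_plus (div_varsigma (varsigma a))"
    using fps_const_varsigma_nonzero fps_outer_varsigma_nonzero fps_plus_varsigma_nonzero
    by (metis mult_cancel_left mult_eq_0_iff)
  moreover have "fps_nth (fps_nth Y m') m = coef (E_coeff a (int m) (E_coeff (- a) (int m') 1)) 0"
    unfolding Y_def using assms
    by (intro extract_product) (simp_all add: fps_outer_def const2_def)
  ultimately show ?thesis by (simp add: fps_plus_def)
qed

section \<open>Polynomials with positive leading coefficients along rays\<close>

abbreviation mon :: "('v \<Rightarrow> 'a::comm_ring_1) \<Rightarrow> ('v \<Rightarrow>\<^sub>0 nat) \<Rightarrow> 'a" where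
  "mon a m \<equiv> (\<Prod>v\<in>Poly_Mapping.keys m. a v ^ coef m v)"

section \<open>Evaluation and degree of multivariate polynomials\<close>

lemma mon_add: "mon a (k + l) = mon a k * mon a l"
proof -
  let ?X = "Poly_Mapping.keys k \<union> Poly_Mapping.keys l"
  have superset: "mon a m = (\<Prod>v\<in>?X. a v ^ coef m v)" if "Poly_Mapping.keys m \<subseteq> ?X" for m
    by (rule prod.mono_neutral_left) (use that in \<open>auto simp: in_keys_iff\<close>)
  have "mon a (k + l) = (\<Prod>v\<in>?X. a v ^ coef (k + l) v)"
    by (rule superset) (rule keys_add)
  also have "\<dots> = (\<Prod>v\<in>?X. a v ^ coef k v) * (\<Prod>v\<in>?X. a v ^ coef l v)"
    by (simp add: lookup_add power_add prod.distrib)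
  finally show ?thesis by (simp add: superset)
qed

lemma monom_degree_add: "monom_degree (k + l) = monom_degree k + monom_degree l"
proof -
  let ?X = "Poly_Mapping.keys k \<union> Poly_Mapping.keys l"
  have superset: "monom_degree m = (\<Sum>v\<in>?X. coef m v)" if "Poly_Mapping.keys m \<subseteq> ?X" for m
    unfolding monom_degree_def by (rule sum.mono_neutral_left) (use that in \<open>auto simp: in_keys_iff\<close>)
  have "monom_degree (k + l) = (\<Sum>v\<in>?X. coef (k + l) v)"
    by (rule superset) (rule keys_add)
  also have "\<dots> = (\<Sum>v\<in>?X. coef k v) + (\<Sum>v\<in>?X. coef l v)"
    by (simp add: lookup_add sum.distrib)
  finally show ?thesis by (simp add: superset)
qed

lemma meval_superset:
  assumes "finite X" "Poly_Mapping.keys f \<subseteq> X"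
  shows "meval a f = (\<Sum>m\<in>X. coef f m * mon a m)"
  unfolding meval_def by (rule sum.mono_neutral_left) (use assms in \<open>auto simp: in_keys_iff\<close>)

lemma meval_0 [simp]: "meval a 0 = 0"
  by (simp add: meval_def)

lemma meval_add: "meval a (f + g) = meval a f + meval a g"
proof -
  let ?X = "Poly_Mapping.keys f \<union> Poly_Mapping.keys g"
  have "meval a (f + g) = (\<Sum>m\<in>?X. coef (f + g) m * mon a m)"
    by (rule meval_superset) (simp_all add: keys_add)
  also have "\<dots> = (\<Sum>m\<in>?X. coef f m * mon a m) + (\<Sum>m\<in>?X. coef g m * mon a m)"
    by (simp add: lookup_add distrib_right sum.distrib)
  finally show ?thesis by (simp add: meval_superset[of ?X])
qed

lemma meval_sum: "meval a (sum h S) = (\<Sum>x\<in>S. meval a (h x))"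
  by (induction S rule: infinite_finite_induct) (auto simp: meval_add)

lemma meval_single: "meval a (Poly_Mapping.single m c) = c * mon a m"
  using meval_superset[of "{m}" "Poly_Mapping.single m c" a] by simp

lemma meval_mconst [simp]: "meval a (mconst c) = c"
  by (simp add: mconst_def meval_single)

lemma meval_mvar [simp]: "meval a (mvar v) = a v"
  by (simp add: mvar_def meval_single)

lemma meval_mult: "meval a (f * g) = meval a f * meval a g"
proof -
  have "f * g = (\<Sum>k\<in>Poly_Mapping.keys f. \<Sum>l\<in>Poly_Mapping.keys g.
      Poly_Mapping.single (k + l) (coef f k * coef g l))"
    by (subst (1 2) poly_mapping_sum_singles[symmetric]) (simp add: sum_product mult_single)
  then have "meval a (f * g) = (\<Sum>k\<in>Poly_Mapping.keys f. \<Sum>l\<in>Poly_Mapping.keys g.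
      (coef f k * coef g l) * (mon a k * mon a l))"
    by (simp only: meval_sum meval_single mon_add)
  also have "\<dots> = meval a f * meval a g"
    by (simp add: meval_def sum_product mult_ac)
  finally show ?thesis .
qed

lemma meval_power: "meval a (f ^ n) = meval a f ^ n"
  using meval_mconst[of a 1] by (induction n) (auto simp: meval_mult simp del: meval_mconst)

text \<open>An integer bound, since degrees are computed with subtractions for the divisors of the J
  factors; a negative bound forces \<open>P = 0\<close>.\<close>

definition deg_le :: "int \<Rightarrow> ('v, 'a::comm_ring_1) mpoly \<Rightarrow> bool" where
  "deg_le d P \<longleftrightarrow> (\<forall>m\<in>Poly_Mapping.keys P. int (monom_degree m) \<le> d)"

lemma deg_le_0 [simp]: "deg_le d 0"
  by (simp add: deg_le_def)

lemma deg_le_add: "deg_le d P \<Longrightarrow> deg_le d Q \<Longrightarrow> deg_le d (P + Q)"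
  using keys_add[of P Q] by (auto simp: deg_le_def)

lemma deg_le_sum: "(\<And>x. x \<in> X \<Longrightarrow> deg_le d (h x)) \<Longrightarrow> deg_le d (sum h X)"
  by (induction X rule: infinite_finite_induct) (auto simp: deg_le_add)

lemma deg_le_mono: "deg_le d P \<Longrightarrow> d \<le> e \<Longrightarrow> deg_le e P"
  by (auto simp: deg_le_def)

lemma deg_le_mult: "deg_le d P \<Longrightarrow> deg_le e Q \<Longrightarrow> deg_le (d + e) (P * Q)"
  using keys_mult[of P Q] by (fastforce simp: deg_le_def monom_degree_add)

lemma deg_le_mconst [simp]: "deg_le 0 (mconst c)"
  by (auto simp: deg_le_def mconst_def monom_degree_def split: if_splits)

lemma deg_le_mvar: "deg_le 1 (mvar v)"
  by (auto simp: deg_le_def mvar_def monom_degree_def split: if_splits)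

lemma deg_le_power: "deg_le d P \<Longrightarrow> deg_le (int n * d) (P ^ n)"
proof (induction n)
  case 0
  then show ?case using deg_le_mconst[of 1] by simp
next
  case (Suc n)
  then show ?case using deg_le_mult[of d P "int n * d" "P ^ n"] by (simp add: algebra_simps)
qed

text \<open>The condition on the leading coefficients along rays makes the class closed under sums and
  products without any loss of degree.\<close>

definition adm :: "('v \<Rightarrow> int) set \<Rightarrow> int \<Rightarrow> (('v \<Rightarrow> int) \<Rightarrow> complex) \<Rightarrow> bool" where
  "adm S d h \<longleftrightarrow>
     (\<exists>P :: ('v, rat) mpoly. deg_le d P \<and> (\<forall>p\<in>S. h p = of_rat (meval (\<lambda>v. of_int (p v)) P))) \<and>
     (\<forall>p\<in>S. \<exists>R :: rat poly. (\<forall>i. coeff R i \<noteq> 0 \<longrightarrow> int i \<le> d)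
        \<and> (\<forall>t::nat. t > 0 \<longrightarrow> h (\<lambda>v. int t * p v) = of_rat (poly R (of_nat t)))
        \<and> 0 \<le> coeff R (nat d) \<and> (h p \<noteq> 0 \<longrightarrow> 0 < coeff R (nat d)))"

definition cone :: "('v \<Rightarrow> int) set \<Rightarrow> bool" where
  "cone S \<longleftrightarrow> (\<forall>p\<in>S. \<forall>t::nat. t > 0 \<longrightarrow> (\<lambda>v. int t * p v) \<in> S)"

lemma adm_cong:
  assumes "cone S" "adm S d h" "\<And>p. p \<in> S \<Longrightarrow> h p = h' p"
  shows "adm S d h'"
proof -
  have "h (\<lambda>v. int t * p v) = h' (\<lambda>v. int t * p v)" if "p \<in> S" "t > 0" for p and t :: nat
    using assms(1,3) that by (auto simp: cone_def)
  note scaled = this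
  show ?thesis
    unfolding adm_def
  proof (intro conjI ballI)
    show "\<exists>P. deg_le d P \<and> (\<forall>p\<in>S. h' p = of_rat (meval (\<lambda>v. of_int (p v)) P))"
      using assms(2,3) unfolding adm_def by auto
    fix p assume p: "p \<in> S"
    with assms(2) obtain R where R: "\<forall>i. coeff R i \<noteq> 0 \<longrightarrow> int i \<le> d"
      "\<forall>t::nat. t > 0 \<longrightarrow> h (\<lambda>v. int t * p v) = of_rat (poly R (of_nat t))"
      "0 \<le> coeff R (nat d)" "h p \<noteq> 0 \<longrightarrow> 0 < coeff R (nat d)"
      unfolding adm_def by blast
    show "\<exists>R. (\<forall>i. coeff R i \<noteq> 0 \<longrightarrow> int i \<le> d)
        \<and> (\<forall>t::nat. t > 0 \<longrightarrow> h' (\<lambda>v. int t * p v) = of_rat (poly R (of_nat t)))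
        \<and> 0 \<le> coeff R (nat d) \<and> (h' p \<noteq> 0 \<longrightarrow> 0 < coeff R (nat d))"
      using R scaled[OF p] assms(3)[OF p] by (intro exI[of _ R]) simp
  qed
qed

lemma adm_zero: "adm S d (\<lambda>_. 0)"
  unfolding adm_def by (auto intro!: exI[of _ 0])

lemma adm_const: "c \<ge> 0 \<Longrightarrow> adm S 0 (\<lambda>_. of_rat c)"
  unfolding adm_def
  by (auto intro!: exI[of _ "mconst c"] exI[of _ "[:c:]"] simp: coeff_pCons split: nat.splits)

lemma adm_add:
  assumes "adm S d h" "adm S d h'"
  shows "adm S d (\<lambda>p. h p + h' p)"
  unfolding adm_def
proof (intro conjI ballI)
  obtain P P' where "deg_le d P" "deg_le d P'" "\<forall>p\<in>S. h p = of_rat (meval (\<lambda>v. of_int (p v)) P)"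
    "\<forall>p\<in>S. h' p = of_rat (meval (\<lambda>v. of_int (p v)) P')"
    using assms unfolding adm_def by blast
  then show "\<exists>P. deg_le d P \<and> (\<forall>p\<in>S. h p + h' p = of_rat (meval (\<lambda>v. of_int (p v)) P))"
    by (intro exI[of _ "P + P'"]) (auto simp: deg_le_add meval_add of_rat_add)
  fix p assume p: "p \<in> S"
  from p assms(1) obtain R where R: "\<forall>i. coeff R i \<noteq> 0 \<longrightarrow> int i \<le> d"
    "\<forall>t::nat. t > 0 \<longrightarrow> h (\<lambda>v. int t * p v) = of_rat (poly R (of_nat t))"
    "0 \<le> coeff R (nat d)" "h p \<noteq> 0 \<longrightarrow> 0 < coeff R (nat d)" unfolding adm_def by blast
  from p assms(2) obtain R' where R': "\<forall>i. coeff R' i \<noteq> 0 \<longrightarrow> int i \<le> d"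
    "\<forall>t::nat. t > 0 \<longrightarrow> h' (\<lambda>v. int t * p v) = of_rat (poly R' (of_nat t))"
    "0 \<le> coeff R' (nat d)" "h' p \<noteq> 0 \<longrightarrow> 0 < coeff R' (nat d)" unfolding adm_def by blast
  show "\<exists>R. (\<forall>i. coeff R i \<noteq> 0 \<longrightarrow> int i \<le> d)
        \<and> (\<forall>t::nat. t > 0 \<longrightarrow> h (\<lambda>v. int t * p v) + h' (\<lambda>v. int t * p v) = of_rat (poly R (of_nat t)))
        \<and> 0 \<le> coeff R (nat d) \<and> (h p + h' p \<noteq> 0 \<longrightarrow> 0 < coeff R (nat d))"
  proof (intro exI[of _ "R + R'"] conjI allI impI)
    fix i assume "coeff (R + R') i \<noteq> 0"
    then have "coeff R i \<noteq> 0 \<or> coeff R' i \<noteq> 0" by auto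
    with R(1) R'(1) show "int i \<le> d" by blast
  next
    \<comment> \<open>Both coefficients at \<open>d\<close> are nonnegative and one of them is
      positive, so they do not cancel.\<close>
    assume "h p + h' p \<noteq> 0"
    then have "h p \<noteq> 0 \<or> h' p \<noteq> 0" by auto
    with R(3,4) R'(3,4) show "0 < coeff (R + R') (nat d)" by fastforce
  qed (use R R' in \<open>auto simp: of_rat_add\<close>)
qed

lemma adm_sum: "(\<And>x. x \<in> X \<Longrightarrow> adm S d (h x)) \<Longrightarrow> adm S d (\<lambda>p. \<Sum>x\<in>X. h x p)"
  by (induction X rule: infinite_finite_induct) (auto intro: adm_zero adm_add)

text \<open>The coefficient of t^(d+e) is the product of the coefficients at the two bounds, also
  where these exceed the actual degrees.\<close>

lemma adm_mult:
  assumes "adm S d h" "adm S e h'"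
  shows "adm S (d + e) (\<lambda>p. h p * h' p)"
  unfolding adm_def
proof (intro conjI ballI)
  obtain P P' where "deg_le d P" "deg_le e P'" "\<forall>p\<in>S. h p = of_rat (meval (\<lambda>v. of_int (p v)) P)"
    "\<forall>p\<in>S. h' p = of_rat (meval (\<lambda>v. of_int (p v)) P')"
    using assms unfolding adm_def by blast
  then show "\<exists>P. deg_le (d + e) P \<and> (\<forall>p\<in>S. h p * h' p = of_rat (meval (\<lambda>v. of_int (p v)) P))"
    by (intro exI[of _ "P * P'"]) (auto simp: deg_le_mult meval_mult of_rat_mult)
  fix p assume p: "p \<in> S"
  from p assms(1) obtain R where R: "\<And>i. coeff R i \<noteq> 0 \<Longrightarrow> int i \<le> d"
    "\<And>t::nat. t > 0 \<Longrightarrow> h (\<lambda>v. int t * p v) = of_rat (poly R (of_nat t))"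
    "0 \<le> coeff R (nat d)" "h p \<noteq> 0 \<longrightarrow> 0 < coeff R (nat d)" unfolding adm_def by blast
  from p assms(2) obtain R' where R': "\<And>i. coeff R' i \<noteq> 0 \<Longrightarrow> int i \<le> e"
    "\<And>t::nat. t > 0 \<Longrightarrow> h' (\<lambda>v. int t * p v) = of_rat (poly R' (of_nat t))"
    "0 \<le> coeff R' (nat e)" "h' p \<noteq> 0 \<longrightarrow> 0 < coeff R' (nat e)" unfolding adm_def by blast
  have deg: "i \<le> nat d" if "coeff R i \<noteq> 0" for i using R(1)[OF that] by linarith
  have deg': "i \<le> nat e" if "coeff R' i \<noteq> 0" for i using R'(1)[OF that] by linarith
  have hp: "h p = of_rat (poly R 1)" "h' p = of_rat (poly R' 1)" using R(2)[of 1] R'(2)[of 1] by simp_all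
  show "\<exists>R. (\<forall>i. coeff R i \<noteq> 0 \<longrightarrow> int i \<le> d + e)
        \<and> (\<forall>t::nat. t > 0 \<longrightarrow> h (\<lambda>v. int t * p v) * h' (\<lambda>v. int t * p v) = of_rat (poly R (of_nat t)))
        \<and> 0 \<le> coeff R (nat (d + e)) \<and> (h p * h' p \<noteq> 0 \<longrightarrow> 0 < coeff R (nat (d + e)))"
  \<comment> \<open>If neither polynomial is zero, both bounds are nonnegative and
    \<open>nat\<close> is additive on them.\<close>
  proof (cases "R = 0 \<or> R' = 0")
    case True
    then show ?thesis using R(2) R'(2) hp by (intro exI[of _ 0]) auto
  next
    case False
    then have de: "d \<ge> 0" "e \<ge> 0"
      using R(1)[of "degree R"] R'(1)[of "degree R'"] leading_coeff_0_iff by fastforce+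
    have top: "coeff (R * R') (nat (d + e)) = coeff R (nat d) * coeff R' (nat e)"
    proof -
      have "coeff (R * R') (nat d + nat e)
          = (\<Sum>i\<le>nat d + nat e. coeff R i * coeff R' (nat d + nat e - i))"
        by (rule coeff_mult)
      also have "\<dots> = (\<Sum>i\<in>{nat d}. coeff R i * coeff R' (nat d + nat e - i))"
      proof (rule sum.mono_neutral_right)
        show "\<forall>i\<in>{..nat d + nat e} - {nat d}. coeff R i * coeff R' (nat d + nat e - i) = 0"
        proof
          fix i assume "i \<in> {..nat d + nat e} - {nat d}"
          then have "i > nat d \<or> nat d + nat e - i > nat e" by auto
          then show "coeff R i * coeff R' (nat d + nat e - i) = 0"
            using deg[of i] deg'[of "nat d + nat e - i"] by fastforce
        qed
      qed auto
      finally show ?thesis using de by (simp add: nat_add_distrib)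
    qed
    show ?thesis
    proof (intro exI[of _ "R * R'"] conjI allI impI)
      fix i assume "coeff (R * R') i \<noteq> 0"
      then obtain j where "j \<in> {..i}" "coeff R j * coeff R' (i - j) \<noteq> 0"
        unfolding coeff_mult by (rule sum.not_neutral_contains_not_neutral)
      then have "coeff R j \<noteq> 0" "coeff R' (i - j) \<noteq> 0" "j \<le> i" by auto
      with R(1)[of j] R'(1)[of "i - j"] show "int i \<le> d + e" by auto
    qed (use R R' top in \<open>auto simp: of_rat_mult\<close>)
  qed
qed

lemma adm_power: "adm S d h \<Longrightarrow> adm S (int n * d) (\<lambda>p. h p ^ n)"
proof (induction n)
  case 0
  then show ?case using adm_const[of 1] by simp
next
  case (Suc n)
  then show ?case using adm_mult[of S d h "int n * d" "\<lambda>p. h p ^ n"] by (simp add: algebra_simps)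
qed

lemma adm_linear:
  fixes c :: "'v::finite \<Rightarrow> int"
  assumes "\<And>p. p \<in> S \<Longrightarrow> 0 < (\<Sum>v\<in>UNIV. c v * p v)"
  shows "adm S 1 (\<lambda>p. of_int (\<Sum>v\<in>UNIV. c v * p v))"
  unfolding adm_def
proof (intro conjI ballI)
  have "deg_le 1 (\<Sum>v\<in>UNIV. mconst (of_int (c v)) * mvar v)"
    using deg_le_mult[OF deg_le_mconst deg_le_mvar] by (intro deg_le_sum) auto
  then show "\<exists>P. deg_le 1 P \<and> (\<forall>p\<in>S. of_int (\<Sum>v\<in>UNIV. c v * p v) = of_rat (meval (\<lambda>v. of_int (p v)) P))"
    by (intro exI[of _ "\<Sum>v\<in>UNIV. mconst (of_int (c v)) * mvar v"])
       (simp add: meval_sum meval_mult of_rat_sum of_rat_mult)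
  fix p assume "p \<in> S"
  then have "0 < (\<Sum>v\<in>UNIV. c v * p v)" by (rule assms)
  moreover have "(\<Sum>v\<in>UNIV. c v * (int t * p v)) = int t * (\<Sum>v\<in>UNIV. c v * p v)" for t
    by (simp add: sum_distrib_left mult_ac)
  ultimately show "\<exists>R. (\<forall>i. coeff R i \<noteq> 0 \<longrightarrow> int i \<le> 1)
     \<and> (\<forall>t::nat. t > 0 \<longrightarrow> of_int (\<Sum>v\<in>UNIV. c v * (int t * p v)) = of_rat (poly R (of_nat t)))
     \<and> 0 \<le> coeff R (nat 1) \<and> (of_int (\<Sum>v\<in>UNIV. c v * p v) \<noteq> (0::complex) \<longrightarrow> 0 < coeff R (nat 1))"
    by (intro exI[of _ "[:0, of_int (\<Sum>v\<in>UNIV. c v * p v):]"])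
       (auto simp: coeff_pCons of_rat_mult simp del: of_int_sum split: nat.splits)
qed

text \<open>The lower coefficients of \<open>f\<close> may have any sign. As \<open>e\<close> does
  not vanish on \<open>S\<close>, it has degree exactly 1 with positive slope along each ray, so
  composition keeps the degree of \<open>f\<close> and the sign of its leading coefficient.\<close>

lemma adm_poly:
  assumes e: "adm S 1 e" "\<And>p. p \<in> S \<Longrightarrow> e p \<noteq> 0" and f: "lead_coeff f > 0"
  shows "adm S (int (degree f)) (\<lambda>p. \<Sum>i\<le>degree f. of_rat (coeff f i) * e p ^ i)"
  unfolding adm_def
proof (intro conjI ballI)
  obtain P where P: "deg_le 1 P" "\<And>p. p \<in> S \<Longrightarrow> e p = of_rat (meval (\<lambda>v. of_int (p v)) P)"
    using e unfolding adm_def by blast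
  have "deg_le (int (degree f)) (\<Sum>i\<le>degree f. mconst (coeff f i) * P ^ i)"
  proof (rule deg_le_sum)
    fix i assume "i \<in> {..degree f}"
    then show "deg_le (int (degree f)) (mconst (coeff f i) * P ^ i)"
      using deg_le_mult[OF deg_le_mconst[of "coeff f i"] deg_le_power[OF P(1), of i]]
      by (auto intro: deg_le_mono)
  qed
  then show "\<exists>P. deg_le (int (degree f)) P \<and>
      (\<forall>p\<in>S. (\<Sum>i\<le>degree f. of_rat (coeff f i) * e p ^ i) = of_rat (meval (\<lambda>v. of_int (p v)) P))"
    by (intro exI[of _ "\<Sum>i\<le>degree f. mconst (coeff f i) * P ^ i"])
       (simp add: meval_sum meval_mult meval_power of_rat_sum of_rat_mult of_rat_power P(2))
  fix p assume p: "p \<in> S"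
  from p e obtain R where R: "\<And>i. coeff R i \<noteq> 0 \<Longrightarrow> int i \<le> 1"
    "\<And>t::nat. t > 0 \<Longrightarrow> e (\<lambda>v. int t * p v) = of_rat (poly R (of_nat t))"
    "0 < coeff R (nat 1)" unfolding adm_def by blast
  have deg: "degree R = 1"
    using R(1)[of "degree R"] R(3) le_degree[of R 1] leading_coeff_0_iff[of R] by force
  have degc: "degree (f \<circ>\<^sub>p R) = degree f" by (simp add: degree_pcompose deg)
  have top: "coeff (f \<circ>\<^sub>p R) (degree f) > 0"
    using lead_coeff_comp[of R f] f R(3) deg by (simp add: degc)
  show "\<exists>R. (\<forall>i. coeff R i \<noteq> 0 \<longrightarrow> int i \<le> int (degree f))
      \<and> (\<forall>t::nat. t > 0 \<longrightarrow> (\<Sum>i\<le>degree f. of_rat (coeff f i) * e (\<lambda>v. int t * p v) ^ i)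
           = of_rat (poly R (of_nat t)))
      \<and> 0 \<le> coeff R (nat (int (degree f)))
      \<and> ((\<Sum>i\<le>degree f. of_rat (coeff f i) * e p ^ i) \<noteq> 0 \<longrightarrow> 0 < coeff R (nat (int (degree f))))"
  proof (intro exI[of _ "f \<circ>\<^sub>p R"] conjI allI impI)
    fix i assume "coeff (f \<circ>\<^sub>p R) i \<noteq> 0"
    then show "int i \<le> int (degree f)" using le_degree degc by fastforce
  next
    fix t :: nat assume "t > 0"
    then show "(\<Sum>i\<le>degree f. of_rat (coeff f i) * e (\<lambda>v. int t * p v) ^ i)
           = of_rat (poly (f \<circ>\<^sub>p R) (of_nat t))"
      by (simp add: poly_pcompose R(2) poly_altdef[of f] of_rat_sum of_rat_mult of_rat_power)
  qed (use top in auto)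
qed

section \<open>Coefficients of varsigma(au)/varsigma(u) as polynomials in a\<close>

lemma fps_inverse_rec:
  fixes v :: "'a::field fps"
  assumes "fps_nth v 0 = 1"
  shows "fps_nth (inverse v) n = (if n = 0 then 1 else - (\<Sum>i=1..n. fps_nth v i * fps_nth (inverse v) (n - i)))"
proof -
  have "v * inverse v = 1" using assms by (simp add: inverse_mult_eq_1')
  then have "fps_nth (v * inverse v) n = (if n = 0 then 1 else 0)" by simp
  moreover have "fps_nth (v * inverse v) n
      = fps_nth (inverse v) n + (\<Sum>i=1..n. fps_nth v i * fps_nth (inverse v) (n - i))"
    using assms by (simp add: fps_mult_nth sum.atLeast_Suc_atMost)
  ultimately show ?thesis
    using assms by (cases "n = 0") (simp_all add: eq_neg_iff_add_eq_0 del: fps_mult_nth)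
qed

lemma of_rat_fact [simp]: "of_rat (fact n) = fact n"
  by (metis of_nat_fact of_rat_of_nat_eq)

lemma varsigma_nth: "fps_nth (varsigma a) i = (if odd i then 2 / (2 ^ i * fact i) * of_int a ^ i else 0)"
  by (simp add: varsigma_def power_minus_odd power_divide)

lemma sinhc_nth: "fps_nth sinhc i = (if even i then 2 / (2 ^ Suc i * fact (Suc i)) else 0)"
  by (simp add: sinhc_def varsigma_nth)

lemma inverse_sinhc_rational: "fps_nth (inverse sinhc) n \<in> \<rat>"
proof (induction n rule: less_induct)
  case (less n)
  have "2 / (2 ^ Suc i * fact (Suc i)) = (of_rat (2 / (2 ^ Suc i * fact (Suc i))) :: complex)" for i
    by (simp add: of_rat_divide of_rat_mult of_rat_power del: fact_Suc power_Suc)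
  then have "fps_nth sinhc i \<in> \<rat>" for i
    by (simp add: sinhc_nth del: fact_Suc power_Suc)
  then have "fps_nth sinhc i * fps_nth (inverse sinhc) (n - i) \<in> \<rat>" if "i \<in> {1..n}" for i
    using that by (intro Rats_mult less) auto
  then show ?case by (subst fps_inverse_rec) (auto intro!: Rats_sum)
qed

lemma inverse_sinhc_odd: "odd n \<Longrightarrow> fps_nth (inverse sinhc) n = 0"
proof (induction n rule: less_induct)
  case (less n)
  have "fps_nth sinhc i * fps_nth (inverse sinhc) (n - i) = 0" if "i \<in> {1..n}" for i
  proof (cases "even i")
    case True
    then have "odd (n - i)" "n - i < n" using less.prems that by auto
    then show ?thesis using less.IH by simp
  qed (simp add: sinhc_nth)
  then show ?case using less.prems by (subst fps_inverse_rec) (auto simp: sum.neutral odd_pos)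
qed

text \<open>The coefficient of $u^M$ in $\varsigma(au)/\varsigma(u)$, divided by $a^\delta$.\<close>

lemma div_varsigma_coeff_poly:
  assumes "\<delta> \<le> 1"
  shows "\<exists>f :: rat poly. (even M \<longrightarrow> lead_coeff f > 0 \<and> degree f = M + 1 - \<delta>) \<and> (odd M \<longrightarrow> f = 0) \<and>
    (\<forall>a. a \<noteq> 0 \<longrightarrow> fps_nth (div_varsigma (varsigma a)) M / of_int a ^ \<delta>
        = (\<Sum>i\<le>degree f. of_rat (coeff f i) * of_int a ^ i))"
proof -
  define vr where "vr n = (SOME x. fps_nth (inverse sinhc) n = of_rat x)" for n
  have vr: "fps_nth (inverse sinhc) n = of_rat (vr n)" for n
    unfolding vr_def by (rule someI_ex) (use inverse_sinhc_rational[of n] in \<open>auto elim: Rats_cases\<close>)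
  \<comment> \<open>The coefficient of a^i before the division by a^\<delta>: varsigma(au) supplies
    the odd powers of a, and the inverse of \<open>sinhc\<close> the remaining power of u.\<close>
  define c :: "nat \<Rightarrow> rat" where
    "c i = (if odd i then 2 / (2 ^ i * fact i) * vr (M + 1 - i) else 0)" for i
  define f where "f = (\<Sum>i=1..M+1. monom (c i) (i - \<delta>))"
  have val: "fps_nth (div_varsigma (varsigma a)) M / of_int a ^ \<delta>
      = (\<Sum>i=1..M+1. of_rat (c i) * of_int a ^ (i - \<delta>))" if "a \<noteq> 0" for a
  proof -
    have "fps_nth (div_varsigma (varsigma a)) M
        = (\<Sum>i=0..M+1. fps_nth (varsigma a) i * fps_nth (inverse sinhc) (M + 1 - i))"
      by (simp add: div_varsigma_def fps_mult_nth)
    also have "\<dots> = (\<Sum>i=1..M+1. fps_nth (varsigma a) i * fps_nth (inverse sinhc) (M + 1 - i))"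
      by (rule sum.mono_neutral_right) (auto simp: not_le)
    also have "\<dots> = (\<Sum>i=1..M+1. of_rat (c i) * of_int a ^ i)"
      by (intro sum.cong) (auto simp: varsigma_nth vr c_def of_rat_mult of_rat_divide of_rat_power mult_ac simp del: fact_Suc power_Suc)
    also have "\<dots> / of_int a ^ \<delta> = (\<Sum>i=1..M+1. of_rat (c i) * of_int a ^ (i - \<delta>))"
      unfolding sum_divide_distrib
      by (rule sum.cong) (use that assms in \<open>auto simp: power_diff\<close>)
    finally show ?thesis .
  qed
  have coeff: "coeff f j = (\<Sum>i=1..M+1. if i - \<delta> = j then c i else 0)" for j
    by (simp add: f_def coeff_sum)
  \<comment> \<open>The truncated subtraction is exact here because the sum starts at 1 and \<delta>
    is at most 1.\<close>
  have inj: "i - \<delta> = j \<longleftrightarrow> i = j + \<delta>" if "i \<ge> 1" for i j using that assms by auto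
  have coeff': "coeff f j = (if j + \<delta> \<in> {1..M+1} then c (j + \<delta>) else 0)" for j
  proof -
    have "coeff f j = (\<Sum>i=1..M+1. if i = j + \<delta> then c i else 0)"
      unfolding coeff by (rule sum.cong) (auto simp: inj)
    then show ?thesis by simp
  qed
  have deg: "degree f \<le> M + 1 - \<delta>"
    by (rule degree_le) (auto simp: coeff')
  have top: "coeff f (M + 1 - \<delta>) = c (M + 1)" using assms by (simp add: coeff')
  have "fps_nth (inverse sinhc) 0 = 1" by (subst fps_inverse_rec) auto
  then have vr0: "vr 0 = 1" using vr[of 0] by simp
  \<comment> \<open>The top power of a meets the constant term 1 of the inverse of
    \<open>sinhc\<close>, which makes its coefficient positive.\<close>
  have 1: "lead_coeff f > 0 \<and> degree f = M + 1 - \<delta>" if "even M"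
  proof -
    have "c (M + 1) > 0" using that by (simp add: c_def vr0)
    moreover from this have "degree f = M + 1 - \<delta>"
      using deg top le_degree[of f "M + 1 - \<delta>"] by fastforce
    ultimately show ?thesis using top by simp
  qed
  \<comment> \<open>If \<open>i\<close> and \<open>M\<close> are odd, so is
    \<open>M + 1 - i\<close>, while the inverse of \<open>sinhc\<close> is even.\<close>
  have 2: "f = 0" if "odd M"
  proof -
    have "c i = 0" if "i \<in> {1..M+1}" for i
    proof (cases "odd i")
      case True
      then have "odd (M + 1 - i)" using \<open>odd M\<close> that by auto
      then show ?thesis using inverse_sinhc_odd vr[of "M + 1 - i"] by (simp add: c_def)
    qed (simp add: c_def)
    then show ?thesis by (simp add: f_def)
  qed
  have 3: "(\<Sum>i=1..M+1. of_rat (c i) * x ^ (i - \<delta>)) = (\<Sum>i\<le>degree f. of_rat (coeff f i) * x ^ i)"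
    for x :: complex
  proof -
    have "(\<Sum>i\<le>degree f. of_rat (coeff f i) * x ^ i) = (\<Sum>j\<le>M+1. of_rat (coeff f j) * x ^ j)"
      by (rule sum.mono_neutral_left) (use deg in \<open>auto simp: coeff_eq_0\<close>)
    also have "\<dots> = (\<Sum>j\<le>M+1. \<Sum>i=1..M+1. if i - \<delta> = j then of_rat (c i) * x ^ j else 0)"
      unfolding coeff of_rat_sum sum_distrib_right by (intro sum.cong) auto
    also have "\<dots> = (\<Sum>i=1..M+1. \<Sum>j\<le>M+1. if i - \<delta> = j then of_rat (c i) * x ^ j else 0)"
      by (rule sum.swap)
    also have "\<dots> = (\<Sum>i=1..M+1. of_rat (c i) * x ^ (i - \<delta>))"
      by (rule sum.cong) auto
    finally show ?thesis by simp
  qed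
  show ?thesis by (rule exI[of _ f]) (use 1 2 3 val in auto)
qed

section \<open>Evaluation of words inside a chamber\<close>

definition energy :: "('v \<Rightarrow> int) \<Rightarrow> 'v set \<Rightarrow> ('v \<Rightarrow> int) \<Rightarrow> int" where
  "energy \<epsilon> A p = (\<Sum>v\<in>A. \<epsilon> v * p v)"

lemma energy_Un: "finite A \<Longrightarrow> finite B \<Longrightarrow> A \<inter> B = {} \<Longrightarrow> energy \<epsilon> (A \<union> B) p = energy \<epsilon> A p + energy \<epsilon> B p"
  unfolding energy_def by (rule sum.union_disjoint)

text \<open>A letter \<open>(A, m, b)\<close> stands for the coefficient of $u^m$ in $\mathcal{E}_a(u)$, where \<open>a\<close> is the
  energy of \<open>A\<close>; the flag \<open>b\<close> records that a factor $J_a$ is to be divided by \<open>\<bar>a\<bar>\<close>.\<close>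

type_synonym 'v letter = "'v set \<times> nat \<times> bool"

definition word_op :: "('v \<Rightarrow> int) \<Rightarrow> ('v \<Rightarrow> int) \<Rightarrow> 'v letter list \<Rightarrow> fock_op" where
  "word_op \<epsilon> p w = foldr (\<lambda>(A, m, b). E_coeff (energy \<epsilon> A p) (int m)) w"

definition word_vev :: "('v \<Rightarrow> int) \<Rightarrow> ('v \<Rightarrow> int) \<Rightarrow> 'v letter list \<Rightarrow> complex" where
  "word_vev \<epsilon> p w = coef (word_op \<epsilon> p w 1) 0"

definition denom :: "('v \<Rightarrow> int) \<Rightarrow> ('v \<Rightarrow> int) \<Rightarrow> 'v letter list \<Rightarrow> complex" where
  "denom \<epsilon> p w = (\<Prod>(A, m, b)\<leftarrow>w. if b then of_int \<bar>energy \<epsilon> A p\<bar> else 1)"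

text \<open>A merging contributes degree i + j and lowers the total of the exponents
  \<open>m\<close> by i + j, so this number is conserved. The summand 1 comes from the last two
  letters: the coefficient of u^m w^m' in varsigma(a(u+w))/varsigma(u+w) has degree at most m + m' +
  1 in a.\<close>

definition word_deg :: "'v letter list \<Rightarrow> int" where
  "word_deg w = (\<Sum>(A, m, b)\<leftarrow>w. int m - of_bool b) + 1"

text \<open>The letters partition the set of all factors. The unflagged letter ensures that the last
  pair is divided by its energy at most once, as its value is in general divisible only
  once.\<close>

definition good_word :: "'v letter list \<Rightarrow> bool" where
  "good_word w \<longleftrightarrow> sorted_wrt (\<lambda>x y. fst x \<inter> fst y = {}) w \<and> (\<forall>x\<in>set w. fst x \<noteq> {})
     \<and> (\<Union>x\<in>set w. fst x) = UNIV \<and> (\<forall>(A, m, b)\<in>set w. b \<longrightarrow> m = 0) \<and> (\<exists>(A, m, b)\<in>set w. \<not> b)"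

lemma denom_Nil: "denom \<epsilon> p [] = 1"
  by (simp add: denom_def)

lemma word_op_append: "word_op \<epsilon> p (w @ w') f = word_op \<epsilon> p w (word_op \<epsilon> p w' f)"
  by (simp add: word_op_def)

lemma word_op_Cons: "word_op \<epsilon> p ((A, m, b) # w) f = E_coeff (energy \<epsilon> A p) (int m) (word_op \<epsilon> p w f)"
  by (simp add: word_op_def)

lemma word_op_add: "word_op \<epsilon> p w (f + g) = word_op \<epsilon> p w f + word_op \<epsilon> p w g"
  by (induction w) (auto simp: word_op_def E_coeff_add)

lemma word_op_mconst: "word_op \<epsilon> p w (mconst c * f) = mconst c * word_op \<epsilon> p w f"
  by (induction w) (auto simp: word_op_def E_coeff_mconst)

lemma word_op_zero [simp]: "word_op \<epsilon> p w 0 = 0"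
  by (induction w) (auto simp: word_op_def)

lemma word_op_sum: "word_op \<epsilon> p w (sum h S) = (\<Sum>x\<in>S. word_op \<epsilon> p w (h x))"
  by (induction S rule: infinite_finite_induct) (auto simp: word_op_add)

lemma word_op_no_p0: "no_p0 f \<Longrightarrow> no_p0 (word_op \<epsilon> p w f)"
  by (induction w) (auto simp: word_op_def E_coeff_no_p0)

lemma word_op_homog:
  "homog d f \<Longrightarrow> homog (d - (\<Sum>x\<leftarrow>w. energy \<epsilon> (fst x) p)) (word_op \<epsilon> p w f)"
proof (induction w)
  case (Cons x w)
  obtain A m b where "x = (A, m, b)" by (cases x)
  with E_coeff_homog[OF Cons.IH[OF Cons.prems], of "energy \<epsilon> A p" "int m"] show ?case
    by (simp add: word_op_Cons algebra_simps)
qed (simp add: word_op_def)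

lemma sum_energies:
  fixes w :: "('v::finite) letter list"
  assumes "sorted_wrt (\<lambda>x y. fst x \<inter> fst y = {}) w"
  shows "(\<Sum>x\<leftarrow>w. energy \<epsilon> (fst x) p) = energy \<epsilon> (\<Union>x\<in>set w. fst x) p"
  using assms
proof (induction w)
  case (Cons x w)
  have "energy \<epsilon> (fst x \<union> (\<Union>y\<in>set w. fst y)) p = energy \<epsilon> (fst x) p + energy \<epsilon> (\<Union>y\<in>set w. fst y) p"
    using Cons.prems by (intro energy_Un) auto
  with Cons show ?case by simp
qed (simp add: energy_def)

lemma word_vev_commute:
  fixes A B :: "('v::finite) set"
  assumes "energy \<epsilon> A p \<noteq> 0" "energy \<epsilon> B p \<noteq> 0" "energy \<epsilon> (A \<union> B) p \<noteq> 0" "A \<inter> B = {}"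
  shows "word_vev \<epsilon> p (w1 @ (A, m, b) # (B, m', b') # w2)
    = word_vev \<epsilon> p (w1 @ (B, m', b') # (A, m, b) # w2)
      + (\<Sum>i\<le>m. \<Sum>j\<le>m'. kappa (of_int (energy \<epsilon> A p)) (of_int (energy \<epsilon> B p)) i j
            * of_nat ((m - i + (m' - j)) choose (m - i))
            * word_vev \<epsilon> p (w1 @ (A \<union> B, m - i + (m' - j), False) # w2))"
proof -
  have "energy \<epsilon> A p + energy \<epsilon> B p = energy \<epsilon> (A \<union> B) p"
    using assms(4) by (simp add: energy_Un)
  then show ?thesis
    using E_commutator[OF assms(1,2), of "word_op \<epsilon> p w2 1" m m'] assms(3)
      word_op_no_p0[OF no_p0_1, of \<epsilon> p w2]
    by (simp add: word_vev_def word_op_append word_op_Cons word_op_add word_op_sum word_op_mconst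
        lookup_add lookup_sum)
qed

lemma kappa_eq:
  "kappa a b i j = (if odd (i + j) then 2 / (2 ^ i * 2 ^ j * fact i * fact j) * a ^ j * (- b) ^ i else 0)"
  by (cases "even i"; cases "even j") (simp_all add: kappa_def power_divide field_simps)

section \<open>Inversions, swaps and merges of letters\<close>

fun inversions :: "('a \<Rightarrow> bool) \<Rightarrow> 'a list \<Rightarrow> nat" where
  "inversions P [] = 0"
| "inversions P (x # w) = (if P x then length (filter (\<lambda>y. \<not> P y) w) else 0) + inversions P w"

lemma inversions_swap:
  "P x \<Longrightarrow> \<not> P y \<Longrightarrow> inversions P (w1 @ y # x # w2) < inversions P (w1 @ x # y # w2)"
  by (induction w1) auto

lemma adjacent_inversion:
  assumes "w \<noteq> []" "P (hd w)" "\<not> P (last w)"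
  shows "\<exists>w1 x y w2. w = w1 @ x # y # w2 \<and> P x \<and> \<not> P y"
  using assms
proof (induction w)
  case (Cons x w)
  then have w: "w \<noteq> []" by auto
  show ?case
  proof (cases "P (hd w)")
    case True
    with Cons w obtain w1 x' y w2 where "w = w1 @ x' # y # w2" "P x'" "\<not> P y" by auto
    then show ?thesis by (intro exI[of _ "x # w1"]) auto
  next
    case False
    with Cons.prems w show ?thesis
      by (intro exI[of _ "[]"] exI[of _ x] exI[of _ "hd w"] exI[of _ "tl w"]) auto
  qed
qed simp

lemma sorted_wrt_swap:
  assumes "\<And>x y. R x y \<Longrightarrow> R y x" "sorted_wrt R (w1 @ x # y # w2)"
  shows "sorted_wrt R (w1 @ y # x # w2)"
  using assms by (auto simp: sorted_wrt_append)

lemma sorted_wrt_merge: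
  assumes "\<And>u. R u x \<Longrightarrow> R u y \<Longrightarrow> R u z" "\<And>u. R x u \<Longrightarrow> R y u \<Longrightarrow> R z u"
    "sorted_wrt R (w1 @ x # y # w2)"
  shows "sorted_wrt R (w1 @ z # w2)"
  using assms by (auto simp: sorted_wrt_append)

lemma good_word_merge:
  assumes "good_word (w1 @ (A, m, b) # (B, m', b') # w2)"
  shows "good_word (w1 @ (A \<union> B, m'', False) # w2)"
  unfolding good_word_def
proof (intro conjI)
  show "sorted_wrt (\<lambda>x y. fst x \<inter> fst y = {}) (w1 @ (A \<union> B, m'', False) # w2)"
  proof (rule sorted_wrt_merge)
    show "sorted_wrt (\<lambda>x y. fst x \<inter> fst y = {}) (w1 @ (A, m, b) # (B, m', b') # w2)"
      using assms by (simp only: good_word_def)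
  qed (simp_all add: Int_Un_distrib Int_Un_distrib2)
  have "(\<Union>x\<in>set (w1 @ (A, m, b) # (B, m', b') # w2). fst x) = UNIV"
    using assms by (simp only: good_word_def)
  then show "(\<Union>x\<in>set (w1 @ (A \<union> B, m'', False) # w2). fst x) = UNIV"
    by (simp add: Un_assoc)
qed (use assms in \<open>auto simp: good_word_def\<close>)

text \<open>The only facts about a chamber that enter the evaluation: \<open>S\<close> stands for
  its integer points, and the energies of proper nonempty subsets are, up to sign, the linear forms
  that define the walls.\<close>

locale resonance_chamber =
  fixes S :: "('v::finite \<Rightarrow> int) set" and \<epsilon> :: "'v \<Rightarrow> int"
  assumes cone: "cone S"
    and total: "\<And>p. p \<in> S \<Longrightarrow> energy \<epsilon> UNIV p = 0"
    and sign: "\<And>A. A \<noteq> {} \<Longrightarrow> A \<noteq> UNIV \<Longrightarrow> (\<forall>p\<in>S. energy \<epsilon> A p > 0) \<or> (\<forall>p\<in>S. energy \<epsilon> A p < 0)"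
begin

lemma adm_energy:
  assumes "\<And>p. p \<in> S \<Longrightarrow> c * energy \<epsilon> A p > 0"
  shows "adm S 1 (\<lambda>p. of_int (c * energy \<epsilon> A p))"
proof -
  have eq: "c * energy \<epsilon> A p = (\<Sum>v\<in>UNIV. (if v \<in> A then c * \<epsilon> v else 0) * p v)" for p
  proof -
    have "(\<Sum>v\<in>UNIV. (if v \<in> A then c * \<epsilon> v else 0) * p v) = (\<Sum>v\<in>A. c * \<epsilon> v * p v)"
      by (rule sum.mono_neutral_cong_right) auto
    then show ?thesis by (simp add: energy_def sum_distrib_left mult.assoc)
  qed
  show ?thesis unfolding eq by (rule adm_linear) (use assms eq in metis)
qed

text \<open>\<open>kappa\<close> vanishes unless i + j is odd. For a flagged first letter i = 0,
  hence j is odd and positive, and a^j absorbs the division by \<open>a\<close>; the second letter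
  is symmetric. Both energies enter through their absolute values, so the coefficients are
  nonnegative.\<close>

lemma adm_kappa:
  assumes A: "\<And>p. p \<in> S \<Longrightarrow> energy \<epsilon> A p > 0" and B: "\<And>p. p \<in> S \<Longrightarrow> energy \<epsilon> B p < 0"
    and "b \<Longrightarrow> i = 0" "b' \<Longrightarrow> j = 0"
  shows "adm S (int i + int j - of_bool b - of_bool b')
     (\<lambda>p. kappa (of_int (energy \<epsilon> A p)) (of_int (energy \<epsilon> B p)) i j * of_nat c
        / ((if b then of_int \<bar>energy \<epsilon> A p\<bar> else 1) * (if b' then of_int \<bar>energy \<epsilon> B p\<bar> else 1)))"
proof (cases "odd (i + j)")
  case False
  then show ?thesis by (simp add: kappa_eq adm_zero)
next
  case True
  have pos: "odd j" if b using assms(3)[OF that] True by simp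
  have pos': "odd i" if b' using assms(4)[OF that] True by simp
  let ?c = "2 * of_nat c / (2 ^ i * 2 ^ j * fact i * fact j) :: rat"
  let ?h = "\<lambda>p. of_rat ?c * (of_int (1 * energy \<epsilon> A p) ^ (j - of_bool b)
      * of_int (- 1 * energy \<epsilon> B p) ^ (i - of_bool b')) :: complex"
  have "adm S (0 + (int (j - of_bool b) * 1 + int (i - of_bool b') * 1)) ?h"
    by (intro adm_mult adm_power adm_energy adm_const) (use A B in auto)
  moreover have "0 + (int (j - of_bool b) * 1 + int (i - of_bool b') * 1)
      = int i + int j - of_bool b - of_bool b'"
    using pos pos' by (auto simp: of_bool_def of_nat_diff Suc_leI odd_pos)
  ultimately have "adm S (int i + int j - of_bool b - of_bool b') ?h" by simp
  then show ?thesis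
  proof (rule adm_cong[OF cone])
    fix p assume p: "p \<in> S"
    define x y where "x = (of_int (energy \<epsilon> A p) :: complex)" and "y = (of_int (- energy \<epsilon> B p) :: complex)"
    have nz: "x \<noteq> 0" "y \<noteq> 0" using A[OF p] B[OF p] by (auto simp: x_def y_def)
    have abs: "of_int \<bar>energy \<epsilon> A p\<bar> = x" "of_int \<bar>energy \<epsilon> B p\<bar> = y"
      using A[OF p] B[OF p] by (simp_all add: x_def y_def)
    have By: "of_int (energy \<epsilon> B p) = - y" "of_int (energy \<epsilon> A p) = x" by (simp_all add: x_def y_def)
    have pw: "x ^ j / (if b then x else 1) = x ^ (j - of_bool b)"
        "y ^ i / (if b' then y else 1) = y ^ (i - of_bool b')"
      using pos pos' nz by (auto simp: power_diff Suc_leI odd_pos)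
    have c: "of_rat ?c = (2 * of_nat c / (2 ^ i * 2 ^ j * fact i * fact j) :: complex)"
      by (simp add: of_rat_divide of_rat_mult of_rat_power)
    have "?h p = of_rat ?c * (x ^ (j - of_bool b) * y ^ (i - of_bool b'))"
      by (simp add: By)
    also have "\<dots> = of_rat ?c * (x ^ j / (if b then x else 1) * (y ^ i / (if b' then y else 1)))"
      by (simp only: pw)
    also have "\<dots> = kappa (of_int (energy \<epsilon> A p)) (of_int (energy \<epsilon> B p)) i j * of_nat c
        / ((if b then of_int \<bar>energy \<epsilon> A p\<bar> else 1) * (if b' then of_int \<bar>energy \<epsilon> B p\<bar> else 1))"
      using True unfolding c by (simp add: kappa_eq abs By del: of_int_abs)
    finally show "?h p = kappa (of_int (energy \<epsilon> A p)) (of_int (energy \<epsilon> B p)) i j * of_nat c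
        / ((if b then of_int \<bar>energy \<epsilon> A p\<bar> else 1) * (if b' then of_int \<bar>energy \<epsilon> B p\<bar> else 1))" .
  qed
qed

lemma adm_pair:
  assumes A: "\<And>p. p \<in> S \<Longrightarrow> energy \<epsilon> A p > 0" and "\<delta> \<le> 1"
  shows "adm S (int M + 1 - int \<delta>)
     (\<lambda>p. fps_nth (div_varsigma (varsigma (energy \<epsilon> A p))) M / of_int (energy \<epsilon> A p) ^ \<delta>)"
proof -
  obtain f :: "rat poly" where "(even M \<longrightarrow> lead_coeff f > 0 \<and> degree f = M + 1 - \<delta>) \<and> (odd M \<longrightarrow> f = 0) \<and>
    (\<forall>a. a \<noteq> 0 \<longrightarrow> fps_nth (div_varsigma (varsigma a)) M / of_int a ^ \<delta>
        = (\<Sum>i\<le>degree f. of_rat (coeff f i) * of_int a ^ i))"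
    using div_varsigma_coeff_poly[OF assms(2), of M] ..
  note f = this[THEN conjunct1, rule_format] this[THEN conjunct2, THEN conjunct1, rule_format]
    this[THEN conjunct2, THEN conjunct2, rule_format]
  have "adm S (int M + 1 - int \<delta>) (\<lambda>p. \<Sum>i\<le>degree f. of_rat (coeff f i) * of_int (1 * energy \<epsilon> A p) ^ i)"
  proof (cases "even M")
    case True
    have "adm S (int (degree f)) (\<lambda>p. \<Sum>i\<le>degree f. of_rat (coeff f i) * of_int (1 * energy \<epsilon> A p) ^ i)"
      by (rule adm_poly, rule adm_energy) (use A f(1)[OF True] in force)+
    moreover have "int (degree f) = int M + 1 - int \<delta>"
      using f(1)[OF True] assms(2) by (simp add: of_nat_diff)
    ultimately show ?thesis by simp
  qed (use f(2) in \<open>simp add: adm_zero\<close>)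
  then show ?thesis
  proof (rule adm_cong[OF cone])
    fix p assume "p \<in> S"
    from A[OF this] show "(\<Sum>i\<le>degree f. of_rat (coeff f i) * of_int (1 * energy \<epsilon> A p) ^ i)
        = fps_nth (div_varsigma (varsigma (energy \<epsilon> A p))) M / of_int (energy \<epsilon> A p) ^ \<delta>"
      by (subst f(3)) auto
  qed
qed

definition positive :: "'v letter \<Rightarrow> bool" where
  "positive x \<longleftrightarrow> (\<forall>p\<in>S. energy \<epsilon> (fst x) p > 0)"

lemma good_word_proper:
  assumes "good_word w" "length w \<ge> 2" "x \<in> set w"
  shows "fst x \<noteq> {}" "fst x \<noteq> UNIV"
proof -
  show "fst x \<noteq> {}" using assms by (auto simp: good_word_def)
  show "fst x \<noteq> UNIV"
  proof
    assume U: "fst x = UNIV"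
    obtain w1 w2 where w: "w = w1 @ x # w2" using assms(3) by (meson split_list)
    with assms(2) obtain y where y: "y \<in> set w1 \<union> set w2"
      by (cases w1; cases w2) auto
    with assms(1) w have "fst y \<inter> fst x = {}" "fst y \<noteq> {}"
      by (auto simp: good_word_def sorted_wrt_append)
    with U show False by simp
  qed
qed

lemma not_positive:
  assumes "good_word w" "length w \<ge> 2" "x \<in> set w" "\<not> positive x" "p \<in> S"
  shows "energy \<epsilon> (fst x) p < 0"
  using sign[OF good_word_proper[OF assms(1-3)]] assms(4,5) by (auto simp: positive_def)

text \<open>Outer induction on the length, inner induction on the number of positive letters
  standing before a negative one. Commuting such a neighbouring pair gives a word with fewer
  inversions and words that are shorter by one letter.\<close>

lemma adm_word:
  assumes "good_word w" "length w \<ge> 2"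
  shows "adm S (word_deg w) (\<lambda>p. word_vev \<epsilon> p w / denom \<epsilon> p w)"
  using assms
proof (induction "length w" arbitrary: w)
  case (Suc n)
  from Suc.prems Suc.hyps(2) show ?case
  proof (induction "inversions positive w" arbitrary: w rule: less_induct)
    case less
    have ne: "w \<noteq> []" using less.prems(2) by auto
    have tot: "(\<Sum>x\<leftarrow>w. energy \<epsilon> (fst x) p) = 0" if "p \<in> S" for p
      using less.prems(1) total[OF that] by (simp add: good_word_def sum_energies)
    consider "\<not> positive (hd w)" | "positive (last w)" | "positive (hd w)" "\<not> positive (last w)"
      by blast
    then show ?case
    proof cases
      case 1
      \<comment> \<open>The letters after a negative first letter have positive total energy and
        therefore send 1 to 0.\<close>
      have "word_vev \<epsilon> p w = 0" if p: "p \<in> S" for p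
      proof -
        obtain A m b where hd: "hd w = (A, m, b)" by (cases "hd w")
        then have w: "w = (A, m, b) # tl w" using ne by (metis list.collapse)
        have "energy \<epsilon> A p < 0"
          using not_positive[OF less.prems(1,2) hd_in_set[OF ne] 1 p] hd by simp
        moreover have "energy \<epsilon> A p = 0 - (\<Sum>x\<leftarrow>tl w. energy \<epsilon> (fst x) p)"
          using tot[OF p] by (subst (asm) w) simp
        then have "homog (energy \<epsilon> A p) (word_op \<epsilon> p (tl w) 1)"
          using word_op_homog[OF homog_1, where w = "tl w" and \<epsilon> = \<epsilon> and p = p] by simp
        ultimately have "word_op \<epsilon> p (tl w) 1 = 0" by (rule homog_neg[rotated])
        then show ?thesis by (subst w) (simp add: word_vev_def word_op_Cons)
      qed
      then show ?thesis using adm_cong[OF cone adm_zero] by force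
    next
      case 2
      \<comment> \<open>A positive last letter acts on 1 first and annihilates it.\<close>
      have "word_vev \<epsilon> p w = 0" if p: "p \<in> S" for p
      proof -
        obtain A m b where la: "last w = (A, m, b)" by (cases "last w")
        then have w: "w = butlast w @ [(A, m, b)]" using ne by (metis append_butlast_last_id)
        have "energy \<epsilon> A p > 0" using 2 la p by (simp add: positive_def)
        then have "E_coeff (energy \<epsilon> A p) (int m) 1 = 0"
          using E_coeff_homog[OF homog_1, of "energy \<epsilon> A p" "int m"]
          by (intro homog_neg[of "0 - energy \<epsilon> A p"]) auto
        then have "word_op \<epsilon> p [(A, m, b)] 1 = 0" by (simp add: word_op_def)
        then show ?thesis by (subst w) (simp add: word_vev_def word_op_append)
      qed
      then show ?thesis using adm_cong[OF cone adm_zero] by force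
    next
      case 3
      from adjacent_inversion[OF ne 3] obtain w1 x y w2 where
        w: "w = w1 @ x # y # w2" and xy: "positive x" "\<not> positive y" by blast
      obtain A m b where x: "x = (A, m, b)" by (cases x)
      obtain B m' b' where y: "y = (B, m', b')" by (cases y)
      have gx: "A \<inter> B = {}" "b \<Longrightarrow> m = 0" "b' \<Longrightarrow> m' = 0"
        using less.prems(1) by (auto simp: good_word_def w x y sorted_wrt_append)
      have A: "energy \<epsilon> A p > 0" if "p \<in> S" for p
        using xy(1) that by (simp add: positive_def x)
      have B: "energy \<epsilon> B p < 0" if "p \<in> S" for p
        using not_positive[OF less.prems(1,2) _ xy(2) that] by (simp add: w y)
      define da db where "da p = (if b then of_int \<bar>energy \<epsilon> A p\<bar> else 1 :: complex)"
        and "db p = (if b' then of_int \<bar>energy \<epsilon> B p\<bar> else 1 :: complex)" for p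
      have den: "denom \<epsilon> p w = da p * db p * (denom \<epsilon> p w1 * denom \<epsilon> p w2)" for p
        by (simp add: denom_def w x y da_def db_def)
      show ?thesis
      proof (cases "w1 = [] \<and> w2 = []")
        case True
        have U: "A \<union> B = UNIV" using less.prems(1) True by (simp add: good_word_def w x y)
        have nb: "\<not> (b \<and> b')" using less.prems(1) True by (auto simp: good_word_def w x y)
        \<comment> \<open>The two energies are opposite, so either flag divides by the same number;
          by \<open>nb\<close> at most one flag is set.\<close>
        define \<delta> :: nat where "\<delta> = of_bool b + of_bool b'"
        have "adm S (0 + (int (m + m') + 1 - int \<delta>)) (\<lambda>p. of_rat (of_nat ((m + m') choose m))
            * (fps_nth (div_varsigma (varsigma (energy \<epsilon> A p))) (m + m') / of_int (energy \<epsilon> A p) ^ \<delta>))"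
          by (intro adm_mult adm_const adm_pair A) (use nb in \<open>auto simp: \<delta>_def\<close>)
        moreover have "0 + (int (m + m') + 1 - int \<delta>) = word_deg w"
          using True by (simp add: word_deg_def w x y \<delta>_def)
        ultimately have "adm S (word_deg w) (\<lambda>p. of_rat (of_nat ((m + m') choose m))
            * (fps_nth (div_varsigma (varsigma (energy \<epsilon> A p))) (m + m') / of_int (energy \<epsilon> A p) ^ \<delta>))"
          by simp
        then show ?thesis
        proof (rule adm_cong[OF cone])
          fix p assume p: "p \<in> S"
          have "energy \<epsilon> A p + energy \<epsilon> B p = 0"
            using total[OF p] energy_Un[OF _ _ gx(1), of \<epsilon> p] U by simp
          then have BA: "energy \<epsilon> B p = - energy \<epsilon> A p" by simp
          have "word_vev \<epsilon> p w = of_nat ((m + m') choose m)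
              * fps_nth (div_varsigma (varsigma (energy \<epsilon> A p))) (m + m')"
            using E_pair[OF A[OF p], of m m'] True by (simp add: word_vev_def word_op_def w x y BA)
          moreover have "denom \<epsilon> p w = of_int (energy \<epsilon> A p) ^ \<delta>"
            using True nb A[OF p] by (auto simp: den da_def db_def \<delta>_def BA denom_Nil)
          ultimately show "of_rat (of_nat ((m + m') choose m))
            * (fps_nth (div_varsigma (varsigma (energy \<epsilon> A p))) (m + m') / of_int (energy \<epsilon> A p) ^ \<delta>)
            = word_vev \<epsilon> p w / denom \<epsilon> p w" by simp
        qed
      next
        case False
        define ws where "ws = w1 @ y # x # w2"
        define wm where "wm i j = w1 @ (A \<union> B, m - i + (m' - j), False) # w2" for i j
        have "length w \<ge> 3" using False by (cases w1; cases w2) (auto simp: w)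
        then have n: "n \<ge> 2" using less.prems(3) by simp
        have good_s: "good_word ws"
        proof -
          have "set ws = set w" by (auto simp: ws_def w)
          moreover have "sorted_wrt (\<lambda>x y. fst x \<inter> fst y = {}) ws"
            unfolding ws_def
          proof (rule sorted_wrt_swap)
            show "sorted_wrt (\<lambda>x y. fst x \<inter> fst y = {}) (w1 @ x # y # w2)"
              using less.prems(1) by (simp only: good_word_def w)
          qed blast
          ultimately show ?thesis using less.prems(1) unfolding good_word_def by metis
        qed
        have good_m: "good_word (wm i j)" for i j
          using less.prems(1) unfolding w wm_def x y by (rule good_word_merge)
        \<comment> \<open>A merged word still has at least two letters, so the merged set is proper
          and its energy does not vanish on \<open>S\<close>. This is what
          \<open>word_vev_commute\<close> needs.\<close>
        have AB: "A \<union> B \<noteq> UNIV" "A \<union> B \<noteq> {}"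
        proof -
          have "length (wm 0 0) \<ge> 2" using False by (cases w1; cases w2) (auto simp: wm_def)
          from good_word_proper[OF good_m this, of "(A \<union> B, m - 0 + (m' - 0), False)"]
          show "A \<union> B \<noteq> UNIV" "A \<union> B \<noteq> {}" by (auto simp: wm_def)
        qed
        have adm_s: "adm S (word_deg w) (\<lambda>p. word_vev \<epsilon> p ws / denom \<epsilon> p w)"
        proof -
          have "adm S (word_deg ws) (\<lambda>p. word_vev \<epsilon> p ws / denom \<epsilon> p ws)"
            using inversions_swap[of positive x y w1 w2] xy less.prems(2,3) good_s
            by (intro less.hyps) (simp_all add: w ws_def)
          moreover have "word_deg ws = word_deg w" by (simp add: word_deg_def w ws_def x y)
          moreover have "denom \<epsilon> p ws = denom \<epsilon> p w" for p by (simp add: denom_def w ws_def x y)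
          ultimately show ?thesis by simp
        qed
        \<comment> \<open>The divisors of the two merged letters are spent here; the merged letter
          is unflagged.\<close>
        define K where "K i j p = kappa (of_int (energy \<epsilon> A p)) (of_int (energy \<epsilon> B p)) i j
            * of_nat ((m - i + (m' - j)) choose (m - i)) / (da p * db p)" for i j p
        have adm_m: "adm S (word_deg w) (\<lambda>p. K i j p * (word_vev \<epsilon> p (wm i j) / denom \<epsilon> p (wm i j)))"
          if "i \<le> m" "j \<le> m'" for i j
        proof -
          have "adm S (word_deg (wm i j)) (\<lambda>p. word_vev \<epsilon> p (wm i j) / denom \<epsilon> p (wm i j))"
            using n less.prems(3) by (intro Suc.hyps(1) good_m) (simp_all add: w wm_def)
          moreover have "adm S (int i + int j - of_bool b - of_bool b') (K i j)"
            unfolding K_def[abs_def] da_def db_def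
            by (rule adm_kappa) (use A B gx that in auto)
          ultimately have "adm S (int i + int j - of_bool b - of_bool b' + word_deg (wm i j))
              (\<lambda>p. K i j p * (word_vev \<epsilon> p (wm i j) / denom \<epsilon> p (wm i j)))"
            by (intro adm_mult)
          moreover have "int i + int j - of_bool b - of_bool b' + word_deg (wm i j) = word_deg w"
            using that by (simp add: word_deg_def w wm_def x y of_nat_diff)
          ultimately show ?thesis by simp
        qed
        have "adm S (word_deg w) (\<lambda>p. word_vev \<epsilon> p ws / denom \<epsilon> p w
            + (\<Sum>i\<le>m. \<Sum>j\<le>m'. K i j p * (word_vev \<epsilon> p (wm i j) / denom \<epsilon> p (wm i j))))"
          by (intro adm_add adm_sum adm_s adm_m) auto
        then show ?thesis
        proof (rule adm_cong[OF cone])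
          fix p assume p: "p \<in> S"
          have nz: "energy \<epsilon> (A \<union> B) p \<noteq> 0" using sign[OF AB(2,1)] p by force
          have "word_vev \<epsilon> p w = word_vev \<epsilon> p ws
              + (\<Sum>i\<le>m. \<Sum>j\<le>m'. kappa (of_int (energy \<epsilon> A p)) (of_int (energy \<epsilon> B p)) i j
            * of_nat ((m - i + (m' - j)) choose (m - i)) * word_vev \<epsilon> p (wm i j))"
            unfolding w x y ws_def wm_def
            by (rule word_vev_commute) (use A[OF p] B[OF p] nz gx(1) in auto)
          moreover have "denom \<epsilon> p (wm i j) = denom \<epsilon> p w1 * denom \<epsilon> p w2" for i j
            by (simp add: denom_def wm_def)
          ultimately show "word_vev \<epsilon> p ws / denom \<epsilon> p w
            + (\<Sum>i\<le>m. \<Sum>j\<le>m'. K i j p * (word_vev \<epsilon> p (wm i j) / denom \<epsilon> p (wm i j)))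
            = word_vev \<epsilon> p w / denom \<epsilon> p w"
            by (simp add: add_divide_distrib sum_divide_distrib den K_def)
        qed
      qed
    qed
  qed
qed simp

end

section \<open>Rationality\<close>

definition rational_coeffs :: "('m \<Rightarrow>\<^sub>0 complex) \<Rightarrow> bool" where
  "rational_coeffs f \<longleftrightarrow> (\<forall>m. coef f m \<in> \<rat>)"

lemma rational_coeffs_bos: "rational_coeffs f \<Longrightarrow> rational_coeffs (bos j f)"
  by (simp add: rational_coeffs_def coef_bos del: of_nat_Suc)

lemma rational_coeffs_NO: "rational_coeffs f \<Longrightarrow> rational_coeffs (NO js f)"
  by (induction js arbitrary: f) (simp_all add: rational_coeffs_bos)

lemma rational_coeffs_mconst: "c \<in> \<rat> \<Longrightarrow> rational_coeffs f \<Longrightarrow> rational_coeffs (mconst c * f)"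
  by (simp add: rational_coeffs_def)

lemma rational_coeffs_Gop:
  assumes "\<And>js. w js \<in> \<rat>" "rational_coeffs f"
  shows "rational_coeffs (Gop w n f)"
proof -
  obtain B where B: "\<forall>w. Gop w n f = (\<Sum>js\<in>E_lists n B. mconst (w js) * NO js f)"
    using Gop_bound[of n f] by blast
  have "coef (NO js f) m \<in> \<rat>" for js m
    using rational_coeffs_NO[OF assms(2)] by (simp add: rational_coeffs_def)
  then show ?thesis
    using assms(1) by (auto simp: rational_coeffs_def B[rule_format] lookup_sum intro!: Rats_sum)
qed

lemma rational_fps_mult:
  assumes "\<And>n. fps_nth A n \<in> \<rat>" "\<And>n. fps_nth B n \<in> \<rat>"
  shows "fps_nth (A * B) n \<in> (\<rat> :: complex set)"
  using assms by (auto simp: fps_mult_nth intro!: Rats_sum)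

lemma Rats_fact [simp]: "fact n \<in> \<rat>"
  by (metis Rats_of_nat of_nat_fact)

lemma wt_rational: "fps_nth (wt js) n \<in> \<rat>"
proof -
  have "fps_nth (\<Prod>j\<leftarrow>js. fps_const (1 / of_int j) * varsigma j) n \<in> \<rat>" for n
  proof (induction js arbitrary: n)
    case (Cons j js)
    have "fps_nth (varsigma j) n \<in> \<rat>" for n by (simp add: varsigma_nth)
    then have "fps_nth (fps_const (1 / of_int j) * varsigma j) n \<in> \<rat>" for n by simp
    then show ?case using rational_fps_mult[OF _ Cons.IH] by simp
  qed (simp add: fps_one_nth)
  then show ?thesis by (simp add: wt_def)
qed

text \<open>This includes the empty list and all integer exponents, since some k_j may be 0 on a
  wall and then E_0 occurs.\<close>

lemma E_weight_rational: "fls_nth (E_weight js) m \<in> \<rat>"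
proof -
  have "fps_to_fls (varsigma 1) = fls_X * fps_to_fls sinhc"
    by (simp add: varsigma_1_eq fls_times_fps_to_fls)
  moreover have "fps_to_fls sinhc * fps_to_fls (inverse sinhc) = 1"
    by (simp add: inverse_mult_eq_1' flip: fls_times_fps_to_fls)
  moreover have "fls_X * fls_X_inv = (1 :: complex fls)"
    by (simp add: fls_X_inv_times_conv_shift)
  ultimately have "fls_X_inv * (fps_to_fls (wt js) * fps_to_fls (inverse sinhc)) * fps_to_fls (varsigma 1)
      = fps_to_fls (wt js)"
    by (simp add: mult_ac)
  then have "E_weight js = fls_X_inv * fps_to_fls (wt js * inverse sinhc)"
    using varsigma_1_nonzero
    by (simp add: E_weight_def wt_def[symmetric] divide_eq_eq fls_times_fps_to_fls)
  then show ?thesis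
    using rational_fps_mult[OF wt_rational inverse_sinhc_rational]
    by (simp add: fls_X_inv_times_conv_shift)
qed

lemma rational_coeffs_E: "rational_coeffs f \<Longrightarrow> rational_coeffs (E_coeff n m f)"
  unfolding E_coeff_eq_Gop by (rule rational_coeffs_Gop) (simp_all add: E_weight_rational)

lemma op_prod_Cons: "op_prod (A # As) f = A (op_prod As f)"
  by (simp add: op_prod_def)

lemma connected_expectation_rational:
  assumes "\<And>A f. A \<in> set As \<Longrightarrow> rational_coeffs f \<Longrightarrow> rational_coeffs (A f)"
  shows "connected_expectation As \<in> \<rat>"
proof -
  have "rational_coeffs (op_prod Bs 1)" if "set Bs \<subseteq> set As" for Bs
    using that
  proof (induction Bs)
    case Nil
    show ?case by (simp add: op_prod_def rational_coeffs_def lookup_one when_def)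
  qed (simp add: op_prod_Cons assms)
  then have "vev (op_prod (nths As B)) \<in> \<rat>" for B
    using set_nths_subset[of As B] by (simp add: vev_def rational_coeffs_def)
  then show ?thesis
    unfolding connected_expectation_def by (intro Rats_sum Rats_mult Rats_prod) auto
qed

text \<open>The claim also concerns points on walls, where \<open>adm_hurwitz\<close> says nothing.
  So it is derived from the rational coefficients of the operators.\<close>

lemma hurwitz_map_rational: "hurwitz_map g r p \<in> \<rat>"
proof -
  obtain x k where p: "p = (x, k)" by (cases p)
  define As where "As = map (\<lambda>a. Jop (int a)) (pos_part x)
    @ map2 (\<lambda>k r. op_scale (1 / of_nat r) (F_op r k)) (vec_list k) (vec_list r)
    @ map (\<lambda>b. Jop (- int b)) (neg_part x)"
  have "rational_coeffs (A f)" if "A \<in> set As" "rational_coeffs f" for A f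
  proof -
    from that(1) consider j where "A = bos j" | k r where "A = op_scale (1 / of_nat r) (F_op r k)"
      by (auto simp: As_def Jop_eq_bos)
    then show ?thesis
      using that(2)
      by cases (auto simp: rational_coeffs_bos op_scale_def F_op_def
          intro!: rational_coeffs_mconst rational_coeffs_E)
  qed
  then have "connected_expectation As \<in> \<rat>" by (rule connected_expectation_rational)
  then show ?thesis by (simp add: p hurwitz_map_def leaky_hurwitz_def As_def)
qed

section \<open>Chambers\<close>

text \<open>Points become functions on the disjoint sum of the index types, so that a pair (I, J) is
  simply a subset of that sum.\<close>

definition assign :: "('a ^ 'n::finite) \<times> ('a ^ 's::finite) \<Rightarrow> 'n + 's \<Rightarrow> 'a" where
  "assign = (\<lambda>(x, k). case_sum (vec_nth x) (vec_nth k))"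

definition unassign :: "('n::finite + 's::finite \<Rightarrow> 'a) \<Rightarrow> ('a ^ 'n) \<times> ('a ^ 's)" where
  "unassign a = ((\<chi> i. a (Inl i)), (\<chi> j. a (Inr j)))"

lemma assign_unassign [simp]: "assign (unassign a) = a"
  by (intro ext) (simp add: assign_def unassign_def split: sum.split)

lemma unassign_assign [simp]: "unassign (assign p) = p"
  by (cases p) (simp add: assign_def unassign_def)

lemma eval_at_eq: "eval_at p P = meval (\<lambda>v. of_int (assign p v)) P"
proof -
  obtain x k where p: "p = (x, k)" by (cases p)
  have "case_sum (\<lambda>i. of_int (vec_nth x i)) (\<lambda>j. of_int (vec_nth k j)) = (\<lambda>v. of_int (assign p v) :: rat)"
    by (intro ext) (simp add: p assign_def split: sum.split)
  then show ?thesis by (simp add: eval_at_def p)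
qed

text \<open>The energies of the factors: J_{x_i}, or J_{-|x_i|} for negative x_i, has energy x_i,
  and the j-th completed cycles operator has energy -k_j.\<close>

definition leak_sign :: "'n + 's \<Rightarrow> int" where
  "leak_sign = case_sum (\<lambda>_. 1) (\<lambda>_. - 1)"

definition real_energy :: "('n::finite + 's::finite) set \<Rightarrow> (real ^ 'n) \<times> (real ^ 's) \<Rightarrow> real" where
  "real_energy A p = (\<Sum>v\<in>A. of_int (leak_sign v) * assign p v)"

lemma real_energy_Plus:
  "real_energy (I <+> J) (x, k) = (\<Sum>i\<in>I. vec_nth x i) - (\<Sum>j\<in>J. vec_nth k j)"
  unfolding real_energy_def
  by (simp add: sum.Plus leak_sign_def assign_def sum_negf)

lemma Plus_vimage: "A = (Inl -` A) <+> (Inr -` A)"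
  by (auto simp: Plus_def image_iff) (metis sum.exhaust)

lemma continuous_on_real_energy: "continuous_on X (real_energy A)"
proof -
  have "continuous_on X (\<lambda>p. assign p v)" for v
  proof (cases v)
    case (Inl i)
    then show ?thesis by (simp add: assign_def case_prod_unfold) (intro continuous_intros)
  next
    case (Inr j)
    then show ?thesis by (simp add: assign_def case_prod_unfold) (intro continuous_intros)
  qed
  then show ?thesis
    unfolding real_energy_def[abs_def] by (intro continuous_intros)
qed

lemma real_energy_scaleR: "real_energy A (t *\<^sub>R p) = t * real_energy A p"
proof -
  have "assign (t *\<^sub>R p) v = t * assign p v" for v
    by (cases p; cases v) (simp_all add: assign_def)
  then show ?thesis by (simp add: real_energy_def sum_distrib_left mult_ac)
qed

text \<open>Subsets of the disjoint sum encode the pairs (I, J); the two excluded pairs become the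
  empty set and the whole.\<close>

lemma leaky_complement_iff:
  fixes p :: "(real ^ 'n::finite) \<times> (real ^ 's::finite)"
  shows "p \<in> leaky_hyperplane - \<Union>leaky_arrangement \<longleftrightarrow>
     real_energy UNIV p = 0 \<and> (\<forall>A. A \<noteq> {} \<longrightarrow> A \<noteq> UNIV \<longrightarrow> real_energy A p \<noteq> 0)"
proof -
  obtain x k where p: "p = (x, k)" by (cases p)
  have hyp: "p \<in> leaky_hyperplane \<longleftrightarrow> real_energy UNIV p = 0"
    using real_energy_Plus[of UNIV UNIV x k] by (simp add: p leaky_hyperplane_def)
  have wall: "p \<in> leaky_wall I J \<longleftrightarrow> p \<in> leaky_hyperplane \<and> real_energy (I <+> J) p = 0" for I J
    by (simp add: p leaky_wall_def real_energy_Plus)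
  have triv: "I <+> J = {} \<longleftrightarrow> (I, J) = ({}, {})" "I <+> J = UNIV \<longleftrightarrow> (I, J) = (UNIV, UNIV)"
    for I :: "'n set" and J :: "'s set"
  proof -
    have "Inl -` (I <+> J) = I" "Inr -` (I <+> J) = J" by auto
    then show "I <+> J = UNIV \<longleftrightarrow> (I, J) = (UNIV, UNIV)" by (metis UNIV_Plus_UNIV Pair_inject vimage_UNIV)
  qed auto
  have "p \<in> \<Union>leaky_arrangement \<longleftrightarrow>
      p \<in> leaky_hyperplane \<and> (\<exists>A. A \<noteq> {} \<and> A \<noteq> UNIV \<and> real_energy A p = 0)"
  proof
    assume "p \<in> \<Union>leaky_arrangement"
    then obtain I J where "(I, J) \<noteq> ({}, {})" "(I, J) \<noteq> (UNIV, UNIV)" "p \<in> leaky_wall I J"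
      by (auto simp: leaky_arrangement_def)
    then show "p \<in> leaky_hyperplane \<and> (\<exists>A. A \<noteq> {} \<and> A \<noteq> UNIV \<and> real_energy A p = 0)"
    proof -
      have "p \<in> leaky_hyperplane \<and> real_energy (I <+> J) p = 0"
        using \<open>p \<in> leaky_wall I J\<close> by (simp only: wall)
      moreover have "I <+> J \<noteq> {}" "I <+> J \<noteq> UNIV"
        unfolding triv by fact+
      ultimately show ?thesis by (intro conjI exI[of _ "I <+> J"]) simp_all
    qed
  next
    assume "p \<in> leaky_hyperplane \<and> (\<exists>A. A \<noteq> {} \<and> A \<noteq> UNIV \<and> real_energy A p = 0)"
    then obtain A where A: "p \<in> leaky_hyperplane" "A \<noteq> {}" "A \<noteq> UNIV" "real_energy A p = 0" by blast
    define I J where "I = Inl -` A" and "J = Inr -` A"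
    have "A = I <+> J" unfolding I_def J_def by (rule Plus_vimage)
    with A have IJ: "p \<in> leaky_hyperplane" "I <+> J \<noteq> {}" "I <+> J \<noteq> UNIV" "real_energy (I <+> J) p = 0"
      by simp_all
    then have "p \<in> leaky_wall I J" by (simp only: wall)
    moreover have "(I, J) \<noteq> ({}, {})" "(I, J) \<noteq> (UNIV, UNIV)"
      using IJ(2,3) unfolding triv .
    ultimately show "p \<in> \<Union>leaky_arrangement" unfolding leaky_arrangement_def
      by (intro UnionI[of "leaky_wall I J"] CollectI exI[of _ I] exI[of _ J] conjI refl)
  qed
  then show ?thesis using hyp by blast
qed

text \<open>The intermediate value theorem on a connected set: a change of sign would produce a
  point on a wall.\<close>

lemma chamber_sign:
  assumes c: "c \<in> leaky_chambers" and A: "A \<noteq> {}" "A \<noteq> UNIV"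
  shows "(\<forall>p\<in>c. real_energy A p > 0) \<or> (\<forall>p\<in>c. real_energy A p < 0)"
proof (rule ccontr)
  assume contr: "\<not> ?thesis"
  have sub: "c \<subseteq> leaky_hyperplane - \<Union>leaky_arrangement"
    using c unfolding leaky_chambers_def by (rule in_components_subset)
  then have nz: "real_energy A p \<noteq> 0" if "p \<in> c" for p
    using that leaky_complement_iff[of p] A by blast
  from contr obtain p q where pq: "p \<in> c" "q \<in> c" "real_energy A p \<le> 0" "real_energy A q \<ge> 0"
    by (meson not_less)
  have "connected (real_energy A ` c)"
    using c unfolding leaky_chambers_def
    by (intro connected_continuous_image continuous_on_real_energy in_components_connected)
  then have "0 \<in> real_energy A ` c"
    by (rule connectedD_interval) (use pq in auto)
  then show False using nz by auto
qed

text \<open>The open ray through \<open>p\<close> is connected and, the walls being given by linear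
  forms, avoids all of them; hence it stays in the component of \<open>p\<close>.\<close>

lemma chamber_scaleR:
  assumes c: "c \<in> leaky_chambers" and p: "p \<in> c" and "t > 0"
  shows "t *\<^sub>R p \<in> c"
proof -
  let ?M = "leaky_hyperplane - \<Union>leaky_arrangement"
  have cM: "c \<in> components ?M" using c by (simp add: leaky_chambers_def)
  then have pM: "p \<in> ?M" using p in_components_subset by blast
  define T where "T = (\<lambda>s. s *\<^sub>R p) ` {0<..}"
  have "connected T"
    unfolding T_def by (intro connected_continuous_image continuous_intros) simp
  moreover have "T \<subseteq> ?M"
  proof
    fix y assume "y \<in> T"
    then obtain s where s: "s > 0" "y = s *\<^sub>R p" by (auto simp: T_def)
    show "y \<in> ?M"
      using pM s(1) unfolding leaky_complement_iff s(2) real_energy_scaleR by auto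
  qed
  moreover have "p \<in> T" unfolding T_def by (rule image_eqI[of _ _ 1]) auto
  ultimately have "T \<subseteq> c" using components_maximal[OF cM] p by blast
  then show ?thesis using \<open>t > 0\<close> by (auto simp: T_def)
qed

definition real_point :: "(int ^ 'n::finite) \<times> (int ^ 's::finite) \<Rightarrow> (real ^ 'n) \<times> (real ^ 's)" where
  "real_point = (\<lambda>(x, k). ((\<chi> i. real_of_int (vec_nth x i)), (\<chi> j. real_of_int (vec_nth k j))))"

lemma integer_points_iff: "p \<in> integer_points c \<longleftrightarrow> real_point p \<in> c"
  by (cases p) (simp add: integer_points_def real_point_def)

lemma real_energy_real_point: "real_energy A (real_point p) = of_int (energy leak_sign A (assign p))"
proof -
  have "assign (real_point p) v = of_int (assign p v)" for v
    by (cases p; cases v) (simp_all add: assign_def real_point_def)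
  then show ?thesis by (simp add: real_energy_def energy_def)
qed

lemma resonance_chamber_integer_points:
  assumes c: "c \<in> leaky_chambers"
  shows "resonance_chamber (assign ` integer_points c) leak_sign"
proof
  show "cone (assign ` integer_points c)"
    unfolding cone_def
  proof (intro ballI allI impI)
    fix a and t :: nat
    assume "a \<in> assign ` integer_points c" "t > 0"
    then obtain p where p: "a = assign p" "real_point p \<in> c" by (auto simp: integer_points_iff)
    let ?q = "unassign (\<lambda>v. int t * a v)"
    have "real_point ?q = real t *\<^sub>R real_point p"
      by (cases p) (simp add: p(1) real_point_def unassign_def assign_def vec_eq_iff)
    then have "?q \<in> integer_points c"
      using chamber_scaleR[OF c p(2), of "real t"] \<open>t > 0\<close> by (simp add: integer_points_iff)
    then show "(\<lambda>v. int t * a v) \<in> assign ` integer_points c"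
      by (metis assign_unassign image_eqI)
  qed
  have sub: "c \<subseteq> leaky_hyperplane - \<Union>leaky_arrangement"
    using c unfolding leaky_chambers_def by (rule in_components_subset)
  fix a assume "a \<in> assign ` integer_points c"
  then obtain p where p: "a = assign p" "real_point p \<in> c" by (auto simp: integer_points_iff)
  have "real_energy UNIV (real_point p) = 0"
    using p(2) sub leaky_complement_iff by blast
  then show "energy leak_sign UNIV a = 0"
    unfolding real_energy_real_point p(1) by simp
next
  fix A :: "('a + 'b) set" assume A: "A \<noteq> {}" "A \<noteq> UNIV"
  show "(\<forall>p\<in>assign ` integer_points c. 0 < energy leak_sign A p) \<or>
        (\<forall>p\<in>assign ` integer_points c. energy leak_sign A p < 0)"
    using chamber_sign[OF c A] real_energy_real_point[of A]
    by (auto simp: integer_points_iff) (metis of_int_0_less_iff of_int_less_0_iff)+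
qed

section \<open>Hurwitz numbers as words\<close>

text \<open>A coordinate of x becomes J, the coefficient of u^0, with its divisor flagged; a
  coordinate of k becomes the coefficient of u^r without a divisor.\<close>

definition letter_of :: "(nat ^ 's) \<Rightarrow> 'n + 's \<Rightarrow> ('n + 's) letter" where
  "letter_of r z = ({z}, case_sum (\<lambda>_. 0) (vec_nth r) z, case_sum (\<lambda>_. True) (\<lambda>_. False) z)"

text \<open>The order of the factors in \<open>leaky_hurwitz\<close>. It depends on the signs of the
  coordinates of \<open>x\<close> alone and is thus constant on a chamber.\<close>

definition factor_order :: "(int ^ 'n::{finite,linorder}) \<Rightarrow> ('n + 's::{finite,linorder}) list" where
  "factor_order x = map Inl (filter (\<lambda>i. vec_nth x i > 0) (sorted_list_of_set UNIV))
     @ map Inr (sorted_list_of_set UNIV)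
     @ map Inl (filter (\<lambda>i. vec_nth x i < 0) (sorted_list_of_set UNIV))"

text \<open>The scalar r!/r in F_r/r, kept outside the word because it does not vary with the
  point.\<close>

definition letter_scale :: "'v letter \<Rightarrow> rat" where
  "letter_scale = (\<lambda>(A, m, b). if b then 1 else fact m / of_nat m)"

definition letter_op :: "('n + 's \<Rightarrow> int) \<Rightarrow> ('n + 's) letter \<Rightarrow> fock_op" where
  "letter_op a = (\<lambda>(A, m, b) f. mconst (of_rat (letter_scale (A, m, b)))
      * E_coeff (energy leak_sign A a) (int m) f)"

lemma factors_eq:
  "map (\<lambda>a. Jop (int a)) (pos_part x)
     @ map2 (\<lambda>k r. op_scale (1 / of_nat r) (F_op r k)) (vec_list k) (vec_list r)
     @ map (\<lambda>b. Jop (- int b)) (neg_part x)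
   = map (letter_op (assign (x, k))) (map (letter_of r) (factor_order x))"
proof -
  have J: "bos (vec_nth x i) = letter_op (assign (x, k)) (letter_of r (Inl i))" if "vec_nth x i \<noteq> 0" for i
    using that
    by (intro ext) (simp add: letter_op_def letter_of_def letter_scale_def energy_def leak_sign_def
        assign_def E_coeff_0_eq_bos)
  have F: "op_scale (1 / of_nat (vec_nth r j)) (F_op (vec_nth r j) (vec_nth k j))
      = letter_op (assign (x, k)) (letter_of r (Inr j))" for j
    by (intro ext) (simp add: letter_op_def letter_of_def letter_scale_def energy_def leak_sign_def
        assign_def F_op_def op_scale_def of_rat_divide mconst_mult[symmetric] mult.assoc[symmetric])
  have "map (\<lambda>a. Jop (int a)) (pos_part x)
      = map (letter_op (assign (x, k))) (map (letter_of r)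
          (map Inl (filter (\<lambda>i. vec_nth x i > 0) (sorted_list_of_set UNIV))))"
    by (simp add: pos_part_def vec_list_def filter_map o_def Jop_eq_bos J)
  moreover have "map (\<lambda>b. Jop (- int b)) (neg_part x)
      = map (letter_op (assign (x, k))) (map (letter_of r)
          (map Inl (filter (\<lambda>i. vec_nth x i < 0) (sorted_list_of_set UNIV))))"
    by (simp add: neg_part_def vec_list_def filter_map o_def Jop_eq_bos J)
  moreover have "map2 (\<lambda>k r. op_scale (1 / of_nat r) (F_op r k)) (vec_list k) (vec_list r)
      = map (letter_op (assign (x, k))) (map (letter_of r) (map Inr (sorted_list_of_set UNIV)))"
    by (simp add: vec_list_def map2_map_map F)
  ultimately show ?thesis by (simp add: factor_order_def)
qed

lemma op_prod_letters:
  "op_prod (map (letter_op a) w) f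
     = mconst (of_rat (\<Prod>x\<leftarrow>w. letter_scale x)) * word_op leak_sign a w f"
proof (induction w)
  case Nil
  then show ?case by (simp add: op_prod_def word_op_def)
next
  case (Cons x w)
  obtain A m b where "x = (A, m, b)" by (cases x)
  with Cons show ?case
    by (simp add: op_prod_Cons letter_op_def word_op_Cons E_coeff_mconst of_rat_mult mconst_mult mult.assoc)
qed

lemma vev_letters:
  "vev (op_prod (map (letter_op a) w)) = of_rat (\<Prod>x\<leftarrow>w. letter_scale x) * word_vev leak_sign a w"
  by (simp add: vev_def op_prod_letters word_vev_def)

lemma word_vev_eq_0:
  assumes "(\<Sum>x\<leftarrow>w. energy \<epsilon> (fst x) p) \<noteq> 0"
  shows "word_vev \<epsilon> p w = 0"
  unfolding word_vev_def
  by (rule homog_coef_0[OF word_op_homog[OF homog_1]]) (use assms in simp)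

text \<open>Every partition other than the one-block one contains a proper block, which kills its
  product; the one-block partition has coefficient 1.\<close>

lemma connected_expectation_eq_vev:
  assumes "As \<noteq> []"
    and "\<And>B. B \<noteq> {} \<Longrightarrow> B \<subseteq> {..<length As} \<Longrightarrow> B \<noteq> {..<length As} \<Longrightarrow> vev (op_prod (nths As B)) = 0"
  shows "connected_expectation As = vev (op_prod As)"
proof -
  let ?X = "{..<length As}"
  let ?g = "\<lambda>\<pi>. (- 1) ^ (card \<pi> - 1) * fact (card \<pi> - 1) * (\<Prod>B\<in>\<pi>. vev (op_prod (nths As B)))"
  have "sum ?g {\<pi>. partition_on ?X \<pi>} = sum ?g {{?X}}"
  proof (rule sum.mono_neutral_right)
    show "finite {\<pi>. partition_on ?X \<pi>}" by (rule finitely_many_partition_on) simp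
    show "{{?X}} \<subseteq> {\<pi>. partition_on ?X \<pi>}"
      using partition_on_space[of ?X] assms(1) by (auto simp: lessThan_empty_iff)
    show "\<forall>\<pi>\<in>{\<pi>. partition_on ?X \<pi>} - {{?X}}. ?g \<pi> = 0"
    proof
      fix \<pi> assume \<pi>: "\<pi> \<in> {\<pi>. partition_on ?X \<pi>} - {{?X}}"
      then have part: "partition_on ?X \<pi>" and ne: "\<pi> \<noteq> {?X}" by auto
      have un: "\<Union>\<pi> = ?X" and nem: "{} \<notin> \<pi>" using part by (auto simp: partition_on_def)
      have "\<pi> \<noteq> {}" using un assms(1) by (auto simp: lessThan_empty_iff)
      with ne obtain B where B: "B \<in> \<pi>" "B \<noteq> ?X" by blast
      then have "vev (op_prod (nths As B)) = 0"
        using un nem by (intro assms(2)) auto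
      moreover have "finite \<pi>" using part by (rule finite_elements[rotated]) simp
      ultimately have "(\<Prod>B\<in>\<pi>. vev (op_prod (nths As B))) = 0"
        using B(1) by (intro prod_zero) auto
      then show "?g \<pi> = 0" by simp
    qed
  qed
  then show ?thesis by (simp add: connected_expectation_def nths_all)
qed

lemma sum_list_pos_neg:
  "int (sum_list (map nat (filter (\<lambda>a. a > 0) xs)))
     = int (sum_list (map (\<lambda>a. nat (- a)) (filter (\<lambda>a. a < 0) xs))) + sum_list xs"
  by (induction xs) auto

lemma length_pos_neg:
  "0 \<notin> set xs \<Longrightarrow> length (filter (\<lambda>a. a > 0) xs) + length (filter (\<lambda>a. a < 0) xs) = length xs"
  for xs :: "int list"
  by (induction xs) auto

lemma sum_list_vec_list: "sum_list (map h (vec_list x)) = (\<Sum>i\<in>UNIV. h (vec_nth x i))"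
  by (simp add: vec_list_def o_def sum_list_distinct_conv_sum_set)

lemma length_vec_list: "length (vec_list (x :: 'a ^ 'i::{finite,linorder})) = CARD('i)"
  by (simp add: vec_list_def)

lemma denom_factor_order:
  "denom leak_sign (assign (x, k)) (map (letter_of r) (factor_order x))
     = of_nat (prod_list (pos_part x)) * of_nat (prod_list (neg_part x))"
proof -
  have e: "energy leak_sign {Inl i} (assign (x, k)) = vec_nth x i" for i
    by (simp add: energy_def leak_sign_def assign_def)
  have l: "denom leak_sign (assign (x, k)) (map (letter_of r) (map Inl is))
      = (\<Prod>i\<leftarrow>is. of_int \<bar>vec_nth x i\<bar>)" for "is"
    by (simp add: denom_def letter_of_def e o_def)
  have F: "denom leak_sign (assign (x, k)) (map (letter_of r) (map Inr js)) = 1" for js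
    by (induction js) (simp_all add: denom_def letter_of_def)
  have app: "denom \<epsilon> p (u @ v) = denom \<epsilon> p u * denom \<epsilon> p v" for \<epsilon> p and u v :: "('n + 's) letter list"
    by (simp add: denom_def)
  have 1: "(\<Prod>i\<leftarrow>filter (\<lambda>i. vec_nth x i > 0) is. of_int \<bar>vec_nth x i\<bar>)
      = (of_nat (prod_list (map nat (filter (\<lambda>a. a > 0) (map (vec_nth x) is)))) :: complex)" for "is"
    by (induction "is") auto
  have 2: "(\<Prod>i\<leftarrow>filter (\<lambda>i. vec_nth x i < 0) is. of_int \<bar>vec_nth x i\<bar>)
      = (of_nat (prod_list (map (\<lambda>a. nat (- a)) (filter (\<lambda>a. a < 0) (map (vec_nth x) is)))) :: complex)" for "is"
    by (induction "is") auto
  show ?thesis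
    by (simp only: factor_order_def map_append app l F 1 2 pos_part_def neg_part_def vec_list_def)
       (simp add: o_def)
qed

lemma nths_energy:
  fixes zs :: "('n::finite + 's::finite) list"
  assumes "distinct zs"
  shows "(\<Sum>x\<leftarrow>nths (map (letter_of r) zs) B. energy \<epsilon> (fst x) p) = energy \<epsilon> (set (nths zs B)) p"
proof -
  have "(\<Sum>x\<leftarrow>nths (map (letter_of r) zs) B. energy \<epsilon> (fst x) p)
      = (\<Sum>z\<leftarrow>nths zs B. \<epsilon> z * p z)"
    by (simp add: nths_map o_def letter_of_def energy_def)
  then show ?thesis
    using assms by (simp add: energy_def sum_list_distinct_conv_sum_set distinct_nthsI)
qed

lemma set_nths_proper:
  assumes "distinct zs" "B \<subseteq> {..<length zs}" "B \<noteq> {}" "B \<noteq> {..<length zs}"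
  shows "set (nths zs B) \<noteq> {}" "set (nths zs B) \<noteq> set zs"
proof -
  show "set (nths zs B) \<noteq> {}" using assms(2,3) by (auto simp: set_nths)
  obtain i where i: "i < length zs" "i \<notin> B" using assms(2,4) by auto
  then have "zs ! i \<notin> set (nths zs B)"
    using assms(1) by (auto simp: set_nths nth_eq_iff_index_eq)
  with i show "set (nths zs B) \<noteq> set zs" by (metis nth_mem)
qed

context
  fixes c :: "((real ^ 'n::{finite,linorder}) \<times> (real ^ 's::{finite,linorder})) set"
    and g :: nat and r :: "nat ^ 's::{finite,linorder}"
  assumes c: "c \<in> leaky_chambers"
    and genus: "(\<Sum>i\<in>UNIV. int (vec_nth r i) - 1) = 2 * int g - 2 + int CARD('n::{finite,linorder})"
begin

interpretation resonance_chamber "assign ` integer_points c" leak_sign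
  by (rule resonance_chamber_integer_points) (rule c)

lemma chamber_coordinate_nonzero:
  assumes "(x, k) \<in> integer_points c"
  shows "vec_nth x i \<noteq> 0"
proof -
  \<comment> \<open>There is at least one coordinate of k, so a single x_i is a proper subset and
    defines a wall.\<close>
  have "{Inl i :: 'n + 's} \<noteq> UNIV"
    by (metis UNIV_I singletonD sum.distinct(1))
  then have "energy leak_sign {Inl i} (assign (x, k)) \<noteq> 0"
    using sign[of "{Inl i}"] assms by fastforce
  then show ?thesis by (simp add: energy_def leak_sign_def assign_def)
qed

lemma set_factor_order:
  assumes "(x, k) \<in> integer_points c"
  shows "set (factor_order x :: ('n + 's) list) = UNIV"
proof -
  have "z \<in> set (factor_order x)" for z :: "'n + 's"
  proof (cases z)
    case (Inl i)
    have "vec_nth x i > 0 \<or> vec_nth x i < 0"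
      using chamber_coordinate_nonzero[OF assms, of i] by linarith
    then show ?thesis by (auto simp: Inl factor_order_def)
  qed (simp add: factor_order_def)
  then show ?thesis by blast
qed

lemma distinct_factor_order: "distinct (factor_order x)"
  by (auto simp: factor_order_def distinct_map)

lemma factor_order_eq:
  assumes "(x, k) \<in> integer_points c" "(y, l) \<in> integer_points c"
  shows "(factor_order x :: ('n + 's) list) = factor_order y"
proof -
  have "vec_nth x i > 0 \<longleftrightarrow> vec_nth y i > 0" "vec_nth x i < 0 \<longleftrightarrow> vec_nth y i < 0" for i
  proof -
    have "{Inl i :: 'n + 's} \<noteq> UNIV"
      by (metis UNIV_I singletonD sum.distinct(1))
    then have "(\<forall>p\<in>integer_points c. energy leak_sign {Inl i} (assign p) > 0)
        \<or> (\<forall>p\<in>integer_points c. energy leak_sign {Inl i} (assign p) < 0)"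
      using sign[of "{Inl i}"] by auto
    moreover have "energy leak_sign {Inl i} (assign (x, k)) = vec_nth x i"
      "energy leak_sign {Inl i} (assign (y, l)) = vec_nth y i"
      by (simp_all add: energy_def leak_sign_def assign_def)
    ultimately show "vec_nth x i > 0 \<longleftrightarrow> vec_nth y i > 0" "vec_nth x i < 0 \<longleftrightarrow> vec_nth y i < 0"
      using assms by (metis less_asym)+
  qed
  then show ?thesis by (simp add: factor_order_def)
qed

text \<open>At chamber points no x_i vanishes and the balancing equation holds, so the default value
  0 of \<open>leaky_hurwitz\<close> does not intervene. Proper subwords have nonzero energy, which
  reduces the connected expectation to the ordinary one.\<close>

lemma hurwitz_map_eq_word_vev:
  assumes p: "(x, k) \<in> integer_points c"
  defines "w \<equiv> map (letter_of r) (factor_order x)"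
  shows "hurwitz_map g r (x, k) = of_rat (\<Prod>y\<leftarrow>w. letter_scale y)
      * (word_vev leak_sign (assign (x, k)) w / denom leak_sign (assign (x, k)) w)"
proof -
  let ?As = "map (letter_op (assign (x, k))) w"
  have "(\<Sum>i\<in>UNIV. vec_nth x i) = (\<Sum>j\<in>UNIV. vec_nth k j)"
  proof -
    have "energy leak_sign UNIV (assign (x, k)) = 0" using total p by blast
    moreover have "energy leak_sign UNIV (assign (x, k)) = (\<Sum>i\<in>UNIV. vec_nth x i) - (\<Sum>j\<in>UNIV. vec_nth k j)"
      unfolding energy_def UNIV_Plus_UNIV[symmetric]
      by (simp add: sum.Plus leak_sign_def assign_def sum_negf del: UNIV_Plus_UNIV)
    ultimately show ?thesis by simp
  qed
  then have bal: "int (sum_list (pos_part x)) = int (sum_list (neg_part x)) + sum_list (vec_list k)"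
    using sum_list_pos_neg[of "vec_list x"] sum_list_vec_list[of "\<lambda>a. a" x] sum_list_vec_list[of "\<lambda>a. a" k]
    by (simp add: pos_part_def neg_part_def)
  have "0 \<notin> set (vec_list x)"
    using chamber_coordinate_nonzero[OF p] by (auto simp: vec_list_def)
  then have "length (pos_part x) + length (neg_part x) = CARD('n)"
    using length_pos_neg[of "vec_list x"] by (simp add: pos_part_def neg_part_def length_vec_list)
  then have gen: "(\<Sum>r\<leftarrow>vec_list r. int r - 1)
      = 2 * int g - 2 + int (length (pos_part x)) + int (length (neg_part x))"
    using genus by (simp add: sum_list_vec_list)
  have "connected_expectation ?As = vev (op_prod ?As)"
  proof (rule connected_expectation_eq_vev)
    have "factor_order x \<noteq> ([] :: ('n + 's) list)"
      using set_factor_order[OF p] by (metis UNIV_not_empty set_empty)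
    then show "?As \<noteq> []" by (simp add: w_def)
    fix B assume B: "B \<noteq> {}" "B \<subseteq> {..<length ?As}" "B \<noteq> {..<length ?As}"
    let ?zs = "factor_order x :: ('n + 's) list"
    let ?C = "set (nths ?zs B)"
    have "distinct ?zs" "set ?zs = UNIV"
      by (rule distinct_factor_order, rule set_factor_order[OF p])
    then have "?C \<noteq> {}" "?C \<noteq> UNIV"
      using set_nths_proper[of ?zs B] B by (simp_all add: w_def)
    then have "energy leak_sign ?C (assign (x, k)) \<noteq> 0"
      using sign[of ?C] p by force
    then have "word_vev leak_sign (assign (x, k)) (nths w B) = 0"
      by (intro word_vev_eq_0) (simp add: w_def nths_energy distinct_factor_order)
    then show "vev (op_prod (nths ?As B)) = 0"
      by (simp add: nths_map vev_letters)
  qed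
  then show ?thesis
    using bal gen
    by (simp add: hurwitz_map_def leaky_hurwitz_def factors_eq w_def[symmetric] vev_letters)
       (simp add: w_def denom_factor_order)
qed

text \<open>The given point determines one word, which by \<open>factor_order_eq\<close> represents
  the Hurwitz numbers on the whole chamber.\<close>

lemma adm_hurwitz:
  assumes "(x0, k0) \<in> integer_points c"
  shows "adm (assign ` integer_points c) (1 + (\<Sum>i\<in>UNIV. int (vec_nth r i)) - int CARD('n))
      (\<lambda>a. hurwitz_map g r (unassign a))"
proof -
  define zs :: "('n + 's) list" where "zs = factor_order x0"
  define w where "w = map (letter_of r) zs"
  have zs: "distinct zs" "set zs = UNIV"
    using distinct_factor_order set_factor_order[OF assms] by (simp_all add: zs_def)
  have good: "good_word w"
    unfolding good_word_def
  proof (intro conjI)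
    show "sorted_wrt (\<lambda>x y. fst x \<inter> fst y = {}) w"
      using zs(1) by (auto simp: w_def sorted_wrt_iff_nth_less letter_of_def nth_eq_iff_index_eq)
    show "(\<Union>x\<in>set w. fst x) = UNIV" using zs(2) by (auto simp: w_def letter_of_def)
    show "\<forall>(A, m, b)\<in>set w. b \<longrightarrow> m = 0" by (auto simp: w_def letter_of_def split: sum.splits)
    have "letter_of r (Inr undefined) \<in> set w" using zs(2) by (auto simp: w_def)
    then show "\<exists>(A, m, b)\<in>set w. \<not> b" by (force simp: letter_of_def)
  qed (auto simp: w_def letter_of_def)
  have "length zs = card (UNIV <+> UNIV :: ('n + 's) set)"
    using distinct_card[OF zs(1)] zs(2) by simp
  also have "\<dots> = CARD('n) + CARD('s)"
    by (rule card_Plus) simp_all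
  finally have len: "length w \<ge> 2"
    using zero_less_card_finite[where 'a = 'n] zero_less_card_finite[where 'a = 's]
    by (simp add: w_def del: zero_less_card_finite)
  have deg: "word_deg w = 1 + (\<Sum>i\<in>UNIV. int (vec_nth r i)) - int CARD('n)"
  proof -
    have "word_deg w = (\<Sum>z\<leftarrow>zs. case_sum (\<lambda>_. - 1) (\<lambda>j. int (vec_nth r j)) z) + 1"
      unfolding word_deg_def w_def map_map o_def
      by (intro arg_cong[where f = "\<lambda>l. sum_list l + 1"] map_cong refl)
         (auto simp: letter_of_def split: sum.split)
    also have "(\<Sum>z\<leftarrow>zs. case_sum (\<lambda>_. - 1) (\<lambda>j. int (vec_nth r j)) z)
        = (\<Sum>z\<in>(UNIV :: 'n set) <+> (UNIV :: 's set). case_sum (\<lambda>_. - 1) (\<lambda>j. int (vec_nth r j)) z)"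
      using zs by (simp add: sum_list_distinct_conv_sum_set)
    also have "\<dots> = - int CARD('n) + (\<Sum>i\<in>UNIV. int (vec_nth r i))"
      by (subst sum.Plus) simp_all
    finally show ?thesis by simp
  qed
  have "(\<Prod>y\<leftarrow>w. letter_scale y) \<ge> 0"
    by (rule prod_list_nonneg) (auto simp: letter_scale_def)
  then have "adm (assign ` integer_points c) (0 + word_deg w)
      (\<lambda>a. of_rat (\<Prod>y\<leftarrow>w. letter_scale y) * (word_vev leak_sign a w / denom leak_sign a w))"
    by (intro adm_mult adm_const adm_word good len)
  then have "adm (assign ` integer_points c) (0 + word_deg w) (\<lambda>a. hurwitz_map g r (unassign a))"
  proof (rule adm_cong[OF cone])
    fix a assume "a \<in> assign ` integer_points c"
    then obtain x k where p: "(x, k) \<in> integer_points c" "a = assign (x, k)" by auto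
    have "w = map (letter_of r) (factor_order x)"
      unfolding w_def zs_def using factor_order_eq[OF assms p(1)] by simp
    then show "of_rat (\<Prod>y\<leftarrow>w. letter_scale y) * (word_vev leak_sign a w / denom leak_sign a w)
        = hurwitz_map g r (unassign a)"
      using hurwitz_map_eq_word_vev[OF p(1)] p(2) by simp
  qed
  then show ?thesis by (simp add: deg)
qed

end

section \<open>Degrees along rays and conclusion\<close>

lemma meval_ray:
  fixes Q :: "('v, rat) mpoly"
  shows "\<exists>R :: rat poly. degree R \<le> total_degree Q \<and> (\<forall>t. poly R t = meval (\<lambda>v. t * a v) Q)"
proof (intro exI conjI allI)
  let ?R = "\<Sum>m\<in>Poly_Mapping.keys Q. monom (coef Q m * mon a m) (monom_degree m)"
  show "degree ?R \<le> total_degree Q"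
  proof (rule degree_sum_le)
    fix m assume "m \<in> Poly_Mapping.keys Q"
    then have "monom_degree m \<le> total_degree Q" unfolding total_degree_def by (intro Max_ge) auto
    then show "degree (monom (coef Q m * mon a m) (monom_degree m)) \<le> total_degree Q"
      using degree_monom_le order.trans by blast
  qed simp
  fix t
  show "poly ?R t = meval (\<lambda>v. t * a v) Q"
    by (simp add: poly_sum poly_monom meval_def power_mult_distrib prod.distrib monom_degree_def
        power_sum mult_ac)
qed

lemma poly_eq_on_nats:
  fixes R R' :: "rat poly"
  assumes "\<And>t::nat. t > 0 \<Longrightarrow> poly R (of_nat t) = poly R' (of_nat t)"
  shows "R = R'"
proof (rule ccontr)
  assume "R \<noteq> R'"
  then have "finite {x. poly (R - R') x = 0}" by (intro poly_roots_finite) simp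
  moreover have "of_nat ` {0<..} \<subseteq> {x. poly (R - R') x = 0}" using assms by auto
  ultimately have "finite (of_nat ` {0::nat<..} :: rat set)" by (rule rev_finite_subset)
  then have "finite {0::nat<..}" by (rule finite_imageD) (simp add: inj_on_def)
  then show False by (simp add: infinite_Ioi)
qed

theorem theorem3p10:
  fixes g :: nat and r :: "nat ^ 's::{finite,linorder}"
  assumes "\<And>i. vec_nth r i > 0"
    and "(\<Sum>i\<in>UNIV. int (vec_nth r i) - 1) = 2 * int g - 2 + int CARD('n::{finite,linorder})"
  shows "(\<forall>p \<in> (leaky_lattice :: ((int ^ 'n::{finite,linorder}) \<times> (int ^ 's::{finite,linorder})) set). hurwitz_map g r p \<in> \<rat>) \<and>
    (\<forall>c \<in> (leaky_chambers :: ((real ^ 'n::{finite,linorder}) \<times> (real ^ 's::{finite,linorder})) set set).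
       \<exists>P. agrees_on P (hurwitz_map g r) (integer_points c) \<and>
           (P = 0 \<or>
            int (total_degree P) = 1 + (\<Sum>i\<in>UNIV. int (vec_nth r i)) - int CARD('n::{finite,linorder}) \<and>
            (\<forall>Q. agrees_on Q (hurwitz_map g r) (integer_points c) \<longrightarrow>
                 total_degree P \<le> total_degree Q)))"
proof (intro conjI ballI)
  fix c :: "((real ^ 'n::{finite,linorder}) \<times> (real ^ 's::{finite,linorder})) set"
  assume c: "c \<in> leaky_chambers"
  let ?D = "1 + (\<Sum>i\<in>UNIV. int (vec_nth r i)) - int CARD('n)"
  show "\<exists>P. agrees_on P (hurwitz_map g r) (integer_points c) \<and>
      (P = 0 \<or> int (total_degree P) = ?D \<and>
        (\<forall>Q. agrees_on Q (hurwitz_map g r) (integer_points c) \<longrightarrow> total_degree P \<le> total_degree Q))"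
  proof (cases "\<forall>p\<in>integer_points c. hurwitz_map g r p = 0")
    case True
    then have "agrees_on 0 (hurwitz_map g r) (integer_points c)"
      by (simp add: agrees_on_def eval_at_eq)
    then show ?thesis by blast
  next
    case False
    then obtain p where p: "p \<in> integer_points c" "hurwitz_map g r p \<noteq> 0" by blast
    have adm: "adm (assign ` integer_points c) ?D (\<lambda>a. hurwitz_map g r (unassign a))"
      using adm_hurwitz[OF c assms(2), of "fst p" "snd p"] p(1) by simp
    interpret resonance_chamber "assign ` integer_points c" leak_sign
      by (rule resonance_chamber_integer_points) (rule c)
    from adm obtain P where P: "deg_le ?D P" "agrees_on P (hurwitz_map g r) (integer_points c)"
      by (auto simp: adm_def agrees_on_def eval_at_eq)
    \<comment> \<open>A single point with nonzero Hurwitz number suffices: it makes the coefficient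
      at the expected degree positive along its ray.\<close>
    from adm p obtain R where R: "\<And>i. coeff R i \<noteq> 0 \<Longrightarrow> int i \<le> ?D"
      "\<And>t::nat. t > 0 \<Longrightarrow> hurwitz_map g r (unassign (\<lambda>v. int t * assign p v)) = of_rat (poly R (of_nat t))"
      "0 < coeff R (nat ?D)"
      unfolding adm_def by fastforce
    have D: "?D \<ge> 0" using R(1)[of "nat ?D"] R(3) by linarith
    \<comment> \<open>Another representing polynomial may differ from \<open>P\<close> off the
      hyperplane, but on the ray through \<open>p\<close> it agrees with \<open>R\<close> at all
      positive integers, hence identically; so its degree is at least that of
      \<open>R\<close>.\<close>
    have lower: "nat ?D \<le> total_degree Q" if Q: "agrees_on Q (hurwitz_map g r) (integer_points c)" for Q
    proof -
      obtain R' where R': "degree R' \<le> total_degree Q"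
        "\<And>t. poly R' t = meval (\<lambda>v. t * of_int (assign p v)) Q"
        using meval_ray[of Q "\<lambda>v. rat_of_int (assign p v)"] by auto
      have "R = R'"
      proof (rule poly_eq_on_nats)
        fix t :: nat assume t: "t > 0"
        let ?q = "unassign (\<lambda>v. int t * assign p v)"
        have "(\<lambda>v. int t * assign p v) \<in> assign ` integer_points c"
          using cone p(1) t unfolding cone_def by blast
        then have "?q \<in> integer_points c" by auto
        then have "hurwitz_map g r ?q = of_rat (meval (\<lambda>v. of_int (int t * assign p v)) Q)"
          using Q by (simp add: agrees_on_def eval_at_eq)
        then have "of_rat (poly R (of_nat t)) = (of_rat (poly R' (of_nat t)) :: complex)"
          using R(2)[OF t] by (simp add: R'(2))
        then show "poly R (of_nat t) = poly R' (of_nat t)" by simp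
      qed
      then have "coeff R' (nat ?D) \<noteq> 0" using R(3) by simp
      then have "nat ?D \<le> degree R'" by (rule le_degree)
      with R'(1) show ?thesis by simp
    qed
    have "total_degree P \<le> nat ?D"
      using P(1) unfolding total_degree_def deg_le_def by (intro Max.boundedI) auto
    then have "total_degree P = nat ?D" using lower[OF P(2)] by simp
    then show ?thesis using P(2) D lower by (intro exI[of _ P]) auto
  qed
qed (rule hurwitz_map_rational)

end
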